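(* Let $\Psi_i=(\gamma_{i1},\gamma_{i2},\dots)$, $i\ge1$, be a sequence of infinite positive vectors with $$\sup_{i\ge1}\sum_{j\ge1}\gamma_{ij}<\infty\quad\text{and}\quad\sup_{i,j\ge1}\gamma_{ij}<1,$$ and let $E(x;G)\subset\mathbb R^d$, $x\in\mathcal Q_G$, be the associated infinitely generated non-stationary Moran fractals for the continued fraction expansion, with $H_G(x)=\dim_{\mathrm H}(E(x;G))$. Then the function $H_G$ is constant on dense subsets of $\mathcal Q_G$ of positive Hausdorff dimension (namely on the sets $F(\eta)$), and for any $x\in\mathcal Q_G$ and any interval $U\subset[0,1)$ with $x\in U$, $$H_G(\mathcal Q_G)=H_G(U\cap\mathcal Q_G).$$
   Context: $\mathbb N=\{1,2,\dots\}$; $|B|$ is the diameter of $B\subset\mathbb R^d$; $\dim_{\mathrm H}$ is Hausdorff dimension. Continued fractions. $T:[0,1)\to[0,1)$, $T(x)=\frac1x-[\frac1x]$ for $x\ne0$, $T(0)=0$; for irrational $x\in[0,1)$, $d_n(x)=[1/T^{n-1}(x)]$, $n\ge1$, are the continued fraction digits of $x$. For an infinite stochastic vector $\eta=(\eta_1,\eta_2,\dots)$ (all $\eta_i>0$, $\sum_i\eta_i=1$), $F(\eta)$ is the set of $y\in[0,1)$ with $\lim_{n\to\infty}\frac1n\mathrm{Card}\{1\le i\le n:d_i(y)=k\}=\eta_k$ for all $k\ge1$. $\mathcal Q_G$ is the union of the sets $F(\eta)$ over all infinite stochastic vectors $\eta$ with $|\sum_{i\ge1}\eta_i\log\eta_i|<\infty$.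 Moran fractals. For $x\in\mathcal Q_G$ put $c_{kj}:=\gamma_{d_k(x)\,j}$, $k,j\ge1$. Let $D_0=\{\emptyset\}$ (empty word), $D_k=\mathbb N^k$, $D=\bigcup_{k\ge0}D_k$, $D_\infty=\mathbb N^{\mathbb N}$; $\sigma|_k$ is truncation to length $k$; $\sigma*j$ is $\sigma$ followed by $j$. $J\subset\mathbb R^d$ is a fixed nonempty compact set with $J=\mathrm{cl}(\mathrm{int}\,J)$, $|J|=1$. Take a collection $\{J_\sigma:\sigma\in D\}$ with: (1) $J_\emptyset=J$; (2) each $J_\sigma$ is the image of $J$ under a similarity of $\mathbb R^d$; (3) for $\sigma\in D$, the sets $J_{\sigma*1},J_{\sigma*2},\dots$ are subsets of $J_\sigma$ with pairwise disjoint interiors; (4) $|J_{\sigma*j}|/|J_\sigma|=c_{kj}$ for $k\ge1$, $\sigma\in D_{k-1}$, $j\ge1$ (it is understood that such collections exist). Then $E(x;G)=\bigcup_{\sigma\in D_\infty}\bigcap_{i\ge1}J_{\sigma|_i}$. Let $\theta=\inf\{t\ge0:\sup_i\sum_j\gamma_{ij}^t<\infty\}$ and, for $t>\theta$, $P(t)=P_\eta(t)=\sum_{i\ge1}\eta_i\log\sum_{j\ge1}\gamma_{ij}^t$. As a standing assumption, $0<P(u)<\infty$ for some $u\in(\theta,\infty)$. According to the paper, $P_\eta$ has a unique zero $h(\eta)\in(\theta,\infty)$ and $\dim_{\mathrm H}(E(x;G))=h(\eta)$ for $x\in F(\eta)$, so $H_G:\mathcal Q_G\to[0,\infty)$ is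 well defined. *)

theory Defs
  imports "HOL-Analysis.Analysis"
begin

text \<open>Digits, words and the rows and columns of \<open>\<gamma>\<close> are indexed by the positive integers,
  i.e. by \<open>{1..} :: nat set\<close>; values of \<open>\<gamma>\<close> and \<open>\<eta>\<close> at index 0 are irrelevant.\<close>

subsection \<open>Hausdorff dimension\<close>

text \<open>\<open>diam_pow s U\<close> is \<open>|U|\<^sup>s\<close>, with \<open>|U|\<^sup>0 = 1\<close> for \<open>U \<noteq> {}\<close> (note \<open>0 powr 0 = 0\<close>) and the
  empty set contributing 0.  Covers consist of bounded sets because \<open>diameter\<close> is
  unspecified on unbounded ones.\<close>

definition diam_pow :: "real \<Rightarrow> 'a::metric_space set \<Rightarrow> ennreal" where
  "diam_pow s U = (if U = {} then 0 else if s = 0 then 1 else ennreal (diameter U powr s))"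

definition hausdorff_premeasure :: "real \<Rightarrow> real \<Rightarrow> 'a::metric_space set \<Rightarrow> ennreal" where
  "hausdorff_premeasure \<delta> s A =
     (INF U \<in> {U :: nat \<Rightarrow> 'a set. A \<subseteq> (\<Union>i. U i) \<and> (\<forall>i. bounded (U i) \<and> diameter (U i) \<le> \<delta>)}.
        \<Sum>i. diam_pow s (U i))"

definition hausdorff_measure :: "real \<Rightarrow> 'a::metric_space set \<Rightarrow> ennreal" where
  "hausdorff_measure s A = (SUP \<delta> \<in> {0<..}. hausdorff_premeasure \<delta> s A)"

definition hausdorff_dim :: "'a::metric_space set \<Rightarrow> ennreal" where
  "hausdorff_dim A = (INF s \<in> {s. 0 \<le> s \<and> hausdorff_measure s A = 0}. ennreal s)"

subsection \<open>Continued fraction digits\<close>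

definition gauss_map :: "real \<Rightarrow> real" where
  "gauss_map x = (if x = 0 then 0 else 1 / x - of_int \<lfloor>1 / x\<rfloor>)"

definition cf_digit :: "nat \<Rightarrow> real \<Rightarrow> nat" where
  "cf_digit n x = nat \<lfloor>1 / (gauss_map ^^ (n - 1)) x\<rfloor>"

definition stochastic_vec :: "(nat \<Rightarrow> real) \<Rightarrow> bool" where
  "stochastic_vec \<eta> \<longleftrightarrow> (\<forall>i\<ge>1. \<eta> i > 0) \<and> (\<eta> has_sum 1) {1..}"

text \<open>All terms \<open>\<eta>\<^sub>i log \<eta>\<^sub>i\<close> are nonpositive, so finiteness of the sum is summability.\<close>

definition finite_entropy :: "(nat \<Rightarrow> real) \<Rightarrow> bool" where
  "finite_entropy \<eta> \<longleftrightarrow> (\<lambda>i. \<eta> i * ln (\<eta> i)) summable_on {1..}"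

definition freq_set :: "(nat \<Rightarrow> real) \<Rightarrow> real set" where
  "freq_set \<eta> = {y \<in> {0..<1}. y \<notin> \<rat> \<and>
     (\<forall>k\<ge>1. (\<lambda>n. real (card {i \<in> {1..n}. cf_digit i y = k}) / real n) \<longlonglongrightarrow> \<eta> k)}"

definition Q_G :: "real set" where
  "Q_G = \<Union> {freq_set \<eta> | \<eta>. stochastic_vec \<eta> \<and> finite_entropy \<eta>}"

subsection \<open>Moran fractals\<close>

definition similarity :: "('a::metric_space \<Rightarrow> 'a) \<Rightarrow> bool" where
  "similarity f \<longleftrightarrow> (\<exists>r>0. \<forall>x y. dist (f x) (f y) = r * dist x y)"

definition words :: "nat \<Rightarrow> nat list set" where
  "words k = {\<sigma>. length \<sigma> = k \<and> set \<sigma> \<subseteq> {1..}}"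

definition inf_words :: "(nat \<Rightarrow> nat) set" where
  "inf_words = {\<sigma>. \<forall>i\<ge>1. \<sigma> i \<ge> 1}"

definition trunc :: "(nat \<Rightarrow> nat) \<Rightarrow> nat \<Rightarrow> nat list" where
  "trunc \<sigma> k = map \<sigma> [1..<Suc k]"

definition moran_collection ::
    "'a::euclidean_space set \<Rightarrow> (nat \<Rightarrow> nat \<Rightarrow> real) \<Rightarrow> (nat list \<Rightarrow> 'a set) \<Rightarrow> bool" where
  "moran_collection J c K \<longleftrightarrow>
     K [] = J \<and>
     (\<forall>k. \<forall>\<sigma>\<in>words k. \<exists>f. similarity f \<and> K \<sigma> = f ` J) \<and>
     (\<forall>k. \<forall>\<sigma>\<in>words k. (\<forall>j\<ge>1. K (\<sigma> @ [j]) \<subseteq> K \<sigma>) \<and>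
        disjoint_family_on (\<lambda>j. interior (K (\<sigma> @ [j]))) {1..}) \<and>
     (\<forall>k\<ge>1. \<forall>\<sigma>\<in>words (k - 1). \<forall>j\<ge>1. diameter (K (\<sigma> @ [j])) / diameter (K \<sigma>) = c k j)"

definition moran_set :: "(nat list \<Rightarrow> 'a set) \<Rightarrow> 'a set" where
  "moran_set K = (\<Union>\<sigma>\<in>inf_words. \<Inter>i\<in>{1..}. K (trunc \<sigma> i))"

text \<open>In \<open>H_G\<close> the argument \<open>K\<close> selects, for each \<open>x\<close>, the collection from which the fractal
  \<open>E(x;G)\<close> is built.\<close>

definition H_G :: "(real \<Rightarrow> nat list \<Rightarrow> 'a::metric_space set) \<Rightarrow> real \<Rightarrow> ennreal" where
  "H_G K x = hausdorff_dim (moran_set (K x))"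

subsection \<open>Pressure\<close>

definition theta :: "(nat \<Rightarrow> nat \<Rightarrow> real) \<Rightarrow> real" where
  "theta \<gamma> = Inf {t. 0 \<le> t \<and>
     (SUP i\<in>{1..}. \<Sum>\<^sub>\<infinity>j\<in>{1..}. ennreal (\<gamma> i j powr t)) < \<infinity>}"

definition pressure_term :: "(nat \<Rightarrow> nat \<Rightarrow> real) \<Rightarrow> (nat \<Rightarrow> real) \<Rightarrow> real \<Rightarrow> nat \<Rightarrow> real" where
  "pressure_term \<gamma> \<eta> t i = \<eta> i * ln (\<Sum>\<^sub>\<infinity>j\<in>{1..}. \<gamma> i j powr t)"

definition pressure :: "(nat \<Rightarrow> nat \<Rightarrow> real) \<Rightarrow> (nat \<Rightarrow> real) \<Rightarrow> real \<Rightarrow> real" where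
  "pressure \<gamma> \<eta> t = (\<Sum>\<^sub>\<infinity>i\<in>{1..}. pressure_term \<gamma> \<eta> t i)"

text \<open>For \<open>t > \<theta>\<close> the inner sums are finite and bounded above in \<open>i\<close>, so the outer series has a
  value in \<open>[-\<infinity>, \<infinity>)\<close>; it is finite iff the series is summable, and \<open>pressure\<close> is meaningful
  only then.\<close>

definition pressure_assumption :: "(nat \<Rightarrow> nat \<Rightarrow> real) \<Rightarrow> (nat \<Rightarrow> real) \<Rightarrow> bool" where
  "pressure_assumption \<gamma> \<eta> \<longleftrightarrow>
     (\<exists>u > theta \<gamma>. pressure_term \<gamma> \<eta> u summable_on {1..} \<and> 0 < pressure \<gamma> \<eta> u)"

end

theory Submission
  imports Defs "HOL-Probability.Probability" "HOL-Library.Nat_Bijection" "HOL-Library.Sublist"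
begin

text \<open>
  \<^emph>\<open>Constancy.\<close>  The dimension of \<open>E(x;G)\<close> is compared with the sign of the pressure.  Let
  \<open>S\<^sub>i(t) = \<Sum>\<^sub>j \<gamma>\<^sub>i\<^sub>j\<^sup>t\<close>.  Summing \<open>|J\<^sub>\<sigma>|\<^sup>t\<close> over the words of length \<open>n\<close> gives the product of
  \<open>S\<^sub>d(t)\<close> over the first \<open>n\<close> digits \<open>d\<close> of \<open>x\<close>, and the mean of the logarithms of these factors
  tends to \<open>P\<^sub>\<eta>(t)\<close> when \<open>x \<in> F(\<eta>)\<close>.  If \<open>P\<^sub>\<eta>(t) < 0\<close>, the natural covers show that the dimension is
  at most \<open>t\<close> (\<open>dim_le\<close>).  If \<open>P\<^sub>\<eta>(t) > 0\<close>, a product measure on codes shows that it is at least \<open>t\<close>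
  (\<open>dim_ge\<close>).  As \<open>P\<^sub>\<eta>\<close> is strictly decreasing and depends on \<open>\<eta>\<close> only, two points of \<open>F(\<eta>)\<close>
  cannot have fractals of different dimensions.

  Two uniformities make this work with infinitely many rows and columns.  First,
  \<open>log S\<^sub>i(t)\<close> is bounded in \<open>i\<close> for each \<open>t > \<theta>\<close>, otherwise rare digits could spoil the convergence
  of the means.  The bound from below comes from the standing assumption: if it failed for every
  \<open>t > \<theta>\<close>, a vector \<open>\<eta>\<close> of finite entropy could be placed on rows with extremely small sums so
  that its pressure series diverges at every \<open>t > \<theta>\<close> (\<open>row_sum_lower_somewhere\<close>).  Second, the entries
  \<open>\<gamma>\<^sub>i\<^sub>j \<ge> \<delta>\<close> carry almost all of \<open>S\<^sub>i(t)\<close>, uniformly in \<open>i\<close> (\<open>large_entries_ratio\<close>).  Restricting the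
  codes to these entries gives finite alphabets with ratios bounded below, where a volume
  argument bounds the number of pieces of comparable size that meet a given set.

  \<^emph>\<open>The sets \<open>F(\<eta>)\<close>.\<close>  A greedy rule produces a digit sequence with frequencies \<open>\<eta>\<close> whose \<open>n\<close>-th
  digit is at most \<open>n\<close>.  Changing digits at a set of positions of density zero does not affect the
  frequencies.  Replacing an initial segment by the digits of an arbitrary irrational gives density
  (\<open>freq_set_dense\<close>).  Choosing freely, among \<open>2\<close> to the power \<open>4\<^sup>k\<close> values, the digit at position \<open>2\<^sup>k\<close>
  gives a Cantor subset of positive dimension, because the number of these choices dominates, up to
  a fixed power, the product of all the earlier digits (\<open>freq_set_dim_pos\<close>).  The statement about intervals follows: every \<open>F(\<eta>)\<close>
  meets every interval with nonempty interior, and the dimension is constant on it.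
\<close>

section \<open>Bounds for the Hausdorff dimension\<close>

lemma hausdorff_dim_le:
  assumes "0 \<le> s" and "\<And>\<delta> \<epsilon>. 0 < \<delta> \<Longrightarrow> 0 < \<epsilon> \<Longrightarrow> hausdorff_premeasure \<delta> s A \<le> ennreal \<epsilon>"
  shows "hausdorff_dim A \<le> ennreal s"
proof -
  have "hausdorff_premeasure \<delta> s A \<le> 0" if "0 < \<delta>" for \<delta>
    by (rule ennreal_le_epsilon) (use assms(2)[OF that] in auto)
  then have "hausdorff_measure s A = 0"
    unfolding hausdorff_measure_def by (subst le_zero_eq[symmetric]) (auto intro!: SUP_least)
  then show ?thesis
    unfolding hausdorff_dim_def using assms(1) by (intro INF_lower) auto
qed

text \<open>A set of a cover may have diameter \<open>0\<close>; it is then treated as a set of some slightly larger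
  positive scale, at a small cost in the sum of powers.\<close>
lemma powr_enlarge:
  fixes s :: real
  assumes "0 < s" "0 \<le> d" "d < r0" "0 < \<epsilon>"
  obtains r where "d < r" "r < r0" "r powr s \<le> d powr s + \<epsilon>"
proof -
  have "((\<lambda>r. r powr s) \<longlongrightarrow> d powr s) (at_right d)"
    using assms
    by (intro tendsto_powr' tendsto_intros)
       (auto intro: eventually_mono[OF eventually_at_right_less])
  then have "\<forall>\<^sub>F r in at_right d. r powr s < d powr s + \<epsilon>"
    by (rule order_tendstoD) (use assms in auto)
  moreover have "\<forall>\<^sub>F r in at_right d. r < r0"
    using assms by (auto simp: eventually_at_right)
  moreover have "\<forall>\<^sub>F r in at_right d. d < r"
    by (rule eventually_at_right_less)
  ultimately have "\<forall>\<^sub>F r in at_right d. r powr s < d powr s + \<epsilon> \<and> r < r0 \<and> d < r"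
    by eventually_elim auto
  then have "\<exists>r. r powr s < d powr s + \<epsilon> \<and> r < r0 \<and> d < r"
    by (intro eventually_happens'[where F = "at_right d"]) auto
  then show ?thesis
    using that by force
qed

text \<open>The mass distribution principle, for a mass given on a parameter space: the preimages of the
  sets of a cover exhaust a space of mass \<open>1\<close>, so that their masses cannot sum to less.
  Asking only for measurable supersets \<open>B\<close> of small mass allows \<open>\<pi>\<close> to be an arbitrary choice of
  points.\<close>
lemma mass_distribution:
  fixes A :: "'a::metric_space set" and \<pi> :: "'b \<Rightarrow> 'a" and C s r0 :: real
  assumes "prob_space M" and s: "0 < s" and r0: "0 < r0" "r0 \<le> 1" and C: "0 \<le> C"
    and \<pi>: "\<And>\<omega>. \<omega> \<in> space M \<Longrightarrow> \<pi> \<omega> \<in> A"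
    and small: "\<And>U r. U \<noteq> {} \<Longrightarrow> bounded U \<Longrightarrow> diameter U \<le> r \<Longrightarrow> 0 < r \<Longrightarrow> r < r0 \<Longrightarrow>
      \<exists>B\<in>sets M. {\<omega>\<in>space M. \<pi> \<omega> \<in> U} \<subseteq> B \<and> emeasure M B \<le> ennreal (C * r powr s)"
  shows "ennreal s \<le> hausdorff_dim A"
proof -
  interpret prob_space M by fact
  have lower: "1 \<le> ennreal C * (\<Sum>i. diam_pow s (U i))"
    if U: "A \<subseteq> (\<Union>i. U i)" "\<And>i. bounded (U i)" "\<And>i. diameter (U i) \<le> r0 / 2" for U :: "nat \<Rightarrow> 'a set"
  proof (rule ennreal_le_epsilon)
    fix \<epsilon> :: real assume "0 < \<epsilon>"
    \<comment> \<open>enlargements whose total, multiplied by \<open>C\<close>, is at most \<open>\<epsilon>\<close>\<close>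
    define e where "e i = \<epsilon> / (C + 1) * (1/2) ^ Suc i" for i
    have e: "0 < e i" for i using \<open>0 < \<epsilon>\<close> C by (simp add: e_def)
    have "\<exists>B\<in>sets M. {\<omega>\<in>space M. \<pi> \<omega> \<in> U i} \<subseteq> B \<and>
        emeasure M B \<le> ennreal C * diam_pow s (U i) + ennreal (C * e i)" for i
    proof (cases "U i = {}")
      case True
      then show ?thesis by (intro bexI[of _ "{}"]) auto
    next
      case False
      have d: "0 \<le> diameter (U i)" "diameter (U i) < r0"
        using U(2)[of i] U(3)[of i] r0 by (auto intro: diameter_ge_0)
      obtain r where r: "diameter (U i) < r" "r < r0" "r powr s \<le> diameter (U i) powr s + e i"
        using powr_enlarge[OF s d e[of i]] by metis
      obtain B where B: "B \<in> sets M" "{\<omega>\<in>space M. \<pi> \<omega> \<in> U i} \<subseteq> B" "emeasure M B \<le> ennreal (C * r powr s)"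
        using small[OF False U(2), of r] r d by auto
      have "C * r powr s \<le> C * (diameter (U i) powr s) + C * e i"
        using mult_left_mono[OF r(3) C] by (simp add: algebra_simps)
      then have "ennreal (C * r powr s) \<le> ennreal (C * (diameter (U i) powr s) + C * e i)"
        by (rule ennreal_leI)
      also have "\<dots> = ennreal C * diam_pow s (U i) + ennreal (C * e i)"
        using False s C e[of i] by (simp add: diam_pow_def ennreal_plus ennreal_mult less_imp_le)
      finally show ?thesis using B by (meson order_trans)
    qed
    then obtain B where B: "\<And>i. B i \<in> sets M" "\<And>i. {\<omega>\<in>space M. \<pi> \<omega> \<in> U i} \<subseteq> B i"
        "\<And>i. emeasure M (B i) \<le> ennreal C * diam_pow s (U i) + ennreal (C * e i)"
      by metis
    have "space M \<subseteq> (\<Union>i. B i)" using \<pi> U(1) B(2) by blast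
    then have "emeasure M (space M) \<le> emeasure M (\<Union>i. B i)" by (intro emeasure_mono) (use B in auto)
    then have "1 \<le> emeasure M (\<Union>i. B i)" by (simp add: emeasure_space_1)
    also have "\<dots> \<le> (\<Sum>i. emeasure M (B i))" by (rule emeasure_subadditive_countably) (use B in auto)
    also have "\<dots> \<le> (\<Sum>i. ennreal C * diam_pow s (U i) + ennreal (C * e i))"
      by (intro suminf_le B) auto
    also have "\<dots> = ennreal C * (\<Sum>i. diam_pow s (U i)) + (\<Sum>i. ennreal (C * e i))"
      by (subst suminf_add[symmetric]) (auto simp: ennreal_suminf_cmult)
    also have "(\<Sum>i. ennreal (C * e i)) = ennreal (C * (\<epsilon> / (C + 1)))"
    proof -
      have "(\<lambda>i. C * e i) sums (C * (\<epsilon> / (C + 1) * 1))"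
        unfolding e_def by (intro sums_mult power_half_series)
      then show ?thesis using e C by (intro suminf_ennreal_eq) (auto simp: less_imp_le)
    qed
    also have "\<dots> \<le> ennreal \<epsilon>"
    proof (rule ennreal_leI)
      have "C * \<epsilon> \<le> \<epsilon> * (C + 1)" using \<open>0 < \<epsilon>\<close> by (simp add: algebra_simps)
      then show "C * (\<epsilon> / (C + 1)) \<le> \<epsilon>" using C by (simp add: field_simps)
    qed
    finally show "1 \<le> ennreal C * (\<Sum>i. diam_pow s (U i)) + ennreal \<epsilon>" by (simp add: add_left_mono)
  qed
  have pos: "hausdorff_measure t A \<noteq> 0" if t: "0 \<le> t" "t \<le> s" for t
  proof
    assume "hausdorff_measure t A = 0"
    moreover have "hausdorff_premeasure (r0 / 2) t A \<le> hausdorff_measure t A"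
      unfolding hausdorff_measure_def using r0 by (intro SUP_upper) auto
    ultimately have "hausdorff_premeasure (r0 / 2) t A = 0" by simp
    then have "hausdorff_premeasure (r0 / 2) t A < ennreal (1 / (C + 1))" using C by simp
    then obtain U :: "nat \<Rightarrow> 'a set" where U: "A \<subseteq> (\<Union>i. U i)" "\<And>i. bounded (U i)" "\<And>i. diameter (U i) \<le> r0 / 2"
      and lt: "(\<Sum>i. diam_pow t (U i)) < ennreal (1 / (C + 1))"
      unfolding hausdorff_premeasure_def INF_less_iff by auto
    have "diam_pow s (U i) \<le> diam_pow t (U i)" for i
    proof -
      have d: "0 \<le> diameter (U i)" "diameter (U i) \<le> 1"
        using U(2)[of i] U(3)[of i] r0 by (auto intro: diameter_ge_0)
      show ?thesis
      proof (cases "t = 0")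
        case True
        then show ?thesis using d s by (auto simp: diam_pow_def powr_le1)
      next
        case False
        then show ?thesis using d s t
          by (auto simp: diam_pow_def intro!: ennreal_leI powr_mono')
      qed
    qed
    then have "(\<Sum>i. diam_pow s (U i)) \<le> (\<Sum>i. diam_pow t (U i))" by (intro suminf_le) auto
    then have "ennreal C * (\<Sum>i. diam_pow s (U i)) \<le> ennreal C * ennreal (1 / (C + 1))"
      using lt by (intro mult_left_mono) auto
    also have "\<dots> < 1" using C by (simp flip: ennreal_mult ennreal_1 add: ennreal_less_iff field_simps)
    finally show False using lower[OF U] by simp
  qed
  show ?thesis
    unfolding hausdorff_dim_def
  proof (rule INF_greatest)
    fix t assume "t \<in> {s. 0 \<le> s \<and> hausdorff_measure s A = 0}"
    then show "ennreal s \<le> ennreal t" using pos[of t] by (cases "t \<le> s") (auto intro: ennreal_leI)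
  qed
qed

lemma product_prob_space_point_measure:
  fixes A :: "nat \<Rightarrow> nat set" and p :: "nat \<Rightarrow> nat \<Rightarrow> real"
  assumes "\<And>k. finite (A k)" "\<And>k j. j \<in> A k \<Longrightarrow> 0 \<le> p k j" "\<And>k. (\<Sum>j\<in>A k. p k j) = 1"
  shows "product_prob_space (\<lambda>k. point_measure (A k) (\<lambda>j. ennreal (p k j)))"
proof -
  have *: "prob_space (point_measure (A k) (\<lambda>j. ennreal (p k j)))" for k
    using assms by (intro prob_spaceI) (simp add: space_point_measure emeasure_point_measure_finite sum_ennreal)
  show ?thesis
    by (simp add: product_prob_space_def product_prob_space_axioms_def product_sigma_finite_def * prob_space_imp_sigma_finite)
qed

lemma cylinder_measure:
  fixes A :: "nat \<Rightarrow> nat set" and p :: "nat \<Rightarrow> nat \<Rightarrow> real"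
  assumes p: "\<And>k. finite (A k)" "\<And>k j. j \<in> A k \<Longrightarrow> 0 \<le> p k j" "\<And>k. (\<Sum>j\<in>A k. p k j) = 1"
    and I: "finite I" "\<And>k. k \<in> I \<Longrightarrow> \<tau> k \<in> A k"
  defines "M \<equiv> PiM UNIV (\<lambda>k. point_measure (A k) (\<lambda>j. ennreal (p k j)))"
  shows "{\<omega>\<in>space M. \<forall>k\<in>I. \<omega> k = \<tau> k} \<in> sets M"
    and "emeasure M {\<omega>\<in>space M. \<forall>k\<in>I. \<omega> k = \<tau> k} = ennreal (\<Prod>k\<in>I. p k (\<tau> k))"
proof -
  interpret product_prob_space "\<lambda>k. point_measure (A k) (\<lambda>j. ennreal (p k j))" UNIV
    by (rule product_prob_space_point_measure) (use p in auto)
  have "emeasure M {\<omega>\<in>space M. \<forall>k\<in>I. \<omega> k \<in> {\<tau> k}} = (\<Prod>k\<in>I. emeasure (point_measure (A k) (\<lambda>j. ennreal (p k j))) {\<tau> k})"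
    unfolding M_def using I by (intro emeasure_PiM_Collect) (auto simp: sets_point_measure)
  also have "\<dots> = (\<Prod>k\<in>I. ennreal (p k (\<tau> k)))"
    using I p by (intro prod.cong) (auto simp: emeasure_point_measure_finite)
  also have "\<dots> = ennreal (\<Prod>k\<in>I. p k (\<tau> k))"
    using I p by (intro prod_ennreal) auto
  finally show "emeasure M {\<omega>\<in>space M. \<forall>k\<in>I. \<omega> k = \<tau> k} = ennreal (\<Prod>k\<in>I. p k (\<tau> k))" by simp
  have "{\<omega>\<in>space M. \<forall>k\<in>I. \<omega> k = \<tau> k} = prod_emb UNIV (\<lambda>k. point_measure (A k) (\<lambda>j. ennreal (p k j))) I (PiE I (\<lambda>k. {\<tau> k}))"
    unfolding prod_emb_def M_def by (auto simp: space_PiM PiE_iff)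
  also have "\<dots> \<in> sets M" unfolding M_def
    using I by (intro sets_PiM_I) (auto simp: sets_point_measure)
  finally show "{\<omega>\<in>space M. \<forall>k\<in>I. \<omega> k = \<tau> k} \<in> sets M" .
qed

section \<open>Continued fractions with prescribed digits\<close>

text \<open>The composition of the inverse branches \<open>y \<mapsto> 1 / (a + y)\<close> of the Gauss map along a word of
  digits.\<close>
fun cf_branch :: "nat list \<Rightarrow> real \<Rightarrow> real" where
  "cf_branch [] y = y"
| "cf_branch (a # as) y = 1 / (real a + cf_branch as y)"

lemma cf_branch_append: "cf_branch (as @ bs) y = cf_branch as (cf_branch bs y)"
  by (induction as) auto

lemma cf_branch_range:
  assumes "set as \<subseteq> {1..}" "y \<in> {0..1}"
  shows "cf_branch as y \<in> {0..1}"
  using assms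
proof (induction as)
  case (Cons a as)
  then have "0 \<le> cf_branch as y" "1 \<le> real a" by auto
  then show ?case by (auto simp: field_simps)
qed auto

text \<open>The derivative of \<open>y \<mapsto> 1 / (a + y)\<close> has absolute value at least \<open>1 / (a + 1)\<^sup>2\<close> on \<open>[0,1]\<close>.\<close>
lemma cf_branch_lower:
  assumes "set as \<subseteq> {1..}" "u \<in> {0..1}" "v \<in> {0..1}"
  shows "\<bar>u - v\<bar> * (\<Prod>a\<leftarrow>as. 1 / (real a + 1)\<^sup>2) \<le> \<bar>cf_branch as u - cf_branch as v\<bar>"
  using assms
proof (induction as)
  case (Cons a as)
  let ?u = "cf_branch as u" and ?v = "cf_branch as v"
  have a: "1 \<le> real a" using Cons.prems by auto
  have r: "?u \<in> {0..1}" "?v \<in> {0..1}" using Cons.prems by (auto intro!: cf_branch_range simp del: atLeastAtMost_iff)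
  have "1 / (real a + ?u) - 1 / (real a + ?v) = (?v - ?u) / ((real a + ?u) * (real a + ?v))"
    using a r by (auto simp: divide_simps)
  then have eq: "\<bar>1 / (real a + ?u) - 1 / (real a + ?v)\<bar> = \<bar>?u - ?v\<bar> / ((real a + ?u) * (real a + ?v))"
    using a r by (simp add: abs_mult abs_divide abs_minus_commute)
  have "(real a + ?u) * (real a + ?v) \<le> (real a + 1)\<^sup>2"
    unfolding power2_eq_square using a r by (intro mult_mono) auto
  then have "\<bar>?u - ?v\<bar> / (real a + 1)\<^sup>2 \<le> \<bar>?u - ?v\<bar> / ((real a + ?u) * (real a + ?v))"
    using a r by (intro divide_left_mono) (auto intro!: mult_pos_pos)
  moreover have "\<bar>u - v\<bar> * (\<Prod>a\<leftarrow>as. 1 / (real a + 1)\<^sup>2) / (real a + 1)\<^sup>2 \<le> \<bar>?u - ?v\<bar> / (real a + 1)\<^sup>2"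
    using Cons by (intro divide_right_mono) auto
  ultimately show ?case by (simp add: eq)
qed auto

text \<open>A single branch with digit \<open>1\<close> has derivative \<open>-1\<close> at \<open>0\<close>, so contraction is only gained in
  pairs: the composition of two branches is \<open>y \<mapsto> (b + y) / (a (b + y) + 1)\<close>, with derivative at
  most \<open>1/4\<close>.\<close>
lemma cf_branch_upper:
  assumes "set as \<subseteq> {1..}" "u \<in> {0..1}" "v \<in> {0..1}"
  shows "\<bar>cf_branch as u - cf_branch as v\<bar> \<le> (1/4) ^ (length as div 2) * \<bar>u - v\<bar>"
  using assms
proof (induction as rule: induct_list012)
  case 1
  then show ?case by simp
next
  case (2 a)
  then have a: "1 \<le> real a" and r: "0 \<le> u" "0 \<le> v" by auto
  have "1 / (real a + u) - 1 / (real a + v) = (v - u) / ((real a + u) * (real a + v))"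
    using a r by (auto simp: divide_simps)
  then have eq: "\<bar>1 / (real a + u) - 1 / (real a + v)\<bar> = \<bar>u - v\<bar> / ((real a + u) * (real a + v))"
    using a r by (simp add: abs_mult abs_divide abs_minus_commute)
  have "1 * 1 \<le> (real a + u) * (real a + v)"
    using a r by (intro mult_mono) auto
  then have "\<bar>u - v\<bar> / ((real a + u) * (real a + v)) \<le> \<bar>u - v\<bar> / 1"
    using a r by (intro divide_left_mono) auto
  then show ?case by (simp add: eq)
next
  case (3 a b as)
  let ?u = "cf_branch as u" and ?v = "cf_branch as v"
  have a: "1 \<le> real a" "1 \<le> real b" using 3 by auto
  have r: "?u \<in> {0..1}" "?v \<in> {0..1}" using 3 by (auto intro!: cf_branch_range simp del: atLeastAtMost_iff)
  have *: "1 / (real a + 1 / (real b + t)) = (real b + t) / (real a * (real b + t) + 1)" if "0 \<le> t" for t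
    using a that by (simp add: divide_simps add_pos_nonneg)
  have pos: "2 \<le> real a * (real b + t) + 1" if "0 \<le> t" for t
  proof -
    have "1 * 1 \<le> real a * (real b + t)" using a that by (intro mult_mono) auto
    then show ?thesis by simp
  qed
  let ?D = "(real a * (real b + ?u) + 1) * (real a * (real b + ?v) + 1)"
  have "(real b + ?u) / (real a * (real b + ?u) + 1) - (real b + ?v) / (real a * (real b + ?v) + 1) = (?u - ?v) / ?D"
    using pos[of ?u] pos[of ?v] r by (simp add: divide_simps) (simp add: algebra_simps)
  then have eq: "\<bar>cf_branch (a # b # as) u - cf_branch (a # b # as) v\<bar> = \<bar>?u - ?v\<bar> / \<bar>?D\<bar>"
    using r by (simp add: * abs_divide)
  have D: "2 * 2 \<le> ?D" using pos[of ?u] pos[of ?v] r by (intro mult_mono) auto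
  have "\<bar>?u - ?v\<bar> / \<bar>?D\<bar> \<le> \<bar>?u - ?v\<bar> / 4" using D by (intro divide_left_mono) auto
  also have "\<dots> \<le> (1/4) ^ (length as div 2) * \<bar>u - v\<bar> / 4"
    using 3 by (intro divide_right_mono) auto
  finally show ?case unfolding eq by simp
qed

definition cf_prefix :: "(nat \<Rightarrow> nat) \<Rightarrow> nat \<Rightarrow> nat list" where
  "cf_prefix a n = map a [1..<Suc n]"

lemma length_cf_prefix [simp]: "length (cf_prefix a n) = n"
  by (simp add: cf_prefix_def del: upt_Suc)

lemma set_cf_prefix: "\<forall>i\<ge>1. 1 \<le> a i \<Longrightarrow> set (cf_prefix a n) \<subseteq> {1..}"
  by (auto simp: cf_prefix_def)

definition cf_point :: "(nat \<Rightarrow> nat) \<Rightarrow> real" where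
  "cf_point a = (THE x. \<forall>n. x \<in> cf_branch (cf_prefix a n) ` {0..1})"

lemma cf_branch_continuous:
  assumes "set as \<subseteq> {1..}"
  shows "continuous_on {0..1} (cf_branch as)"
  using assms
proof (induction as)
  case Nil
  then show ?case by (simp add: continuous_on_id)
next
  case (Cons a as)
  have "real a + cf_branch as y \<noteq> 0" if "y \<in> {0..1}" for y
    using cf_branch_range[of as y] Cons.prems that by auto
  then show ?case using Cons by (auto intro!: continuous_intros)
qed

lemma cf_point_ex1:
  assumes a: "\<forall>i\<ge>1. 1 \<le> a i"
  shows "\<exists>!x. \<forall>n. x \<in> cf_branch (cf_prefix a n) ` {0..1}"
proof -
  let ?F = "\<lambda>n. cf_branch (cf_prefix a n) ` {0..1}"
  have "\<Inter> (range ?F) \<noteq> {}"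
  proof (rule compact_nest)
    show "compact (?F n)" for n
      by (intro compact_continuous_image cf_branch_continuous set_cf_prefix a) auto
    show "?F n \<noteq> {}" for n by auto
    fix m n :: nat assume "m \<le> n"
    then have "[1..<Suc n] = [1..<Suc m] @ [Suc m..<Suc n]"
      using upt_add_eq_append[of 1 "Suc m" "n - m"] by simp
    then have "cf_prefix a n = cf_prefix a m @ map a [Suc m..<Suc n]"
      by (simp add: cf_prefix_def)
    moreover have "set (map a [Suc m..<Suc n]) \<subseteq> {1..}" using a by auto
    ultimately show "?F n \<subseteq> ?F m"
      using cf_branch_range[of "map a [Suc m..<Suc n]"] by (auto simp: cf_branch_append)
  qed
  then obtain x where x: "x \<in> ?F n" for n by auto
  have uniq: "y = x" if y: "\<And>n. y \<in> ?F n" for y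
  proof -
    have "\<bar>y - x\<bar> \<le> (1/4) ^ n" for n
    proof -
      obtain u v where "u \<in> {0..1}" "v \<in> {0..1}" "x = cf_branch (cf_prefix a (2*n)) u" "y = cf_branch (cf_prefix a (2*n)) v"
        using x[of "2*n"] y[of "2*n"] by auto
      moreover from this have "\<bar>y - x\<bar> \<le> (1/4) ^ n * \<bar>v - u\<bar>"
        using cf_branch_upper[OF set_cf_prefix[OF a], of v u "2*n"] by (simp add: length_cf_prefix)
      moreover have "\<bar>v - u\<bar> \<le> 1" using calculation by auto
      then have "(1/4) ^ n * \<bar>v - u\<bar> \<le> (1/4) ^ n * 1" by (intro mult_left_mono) auto
      ultimately show ?thesis by linarith
    qed
    moreover have "(\<lambda>n. (1/4::real) ^ n) \<longlonglongrightarrow> 0" by (rule LIMSEQ_power_zero) simp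
    ultimately have "\<bar>y - x\<bar> \<le> 0" by (intro LIMSEQ_le_const) auto
    then show "y = x" by simp
  qed
  show ?thesis
  proof (rule ex1I[of _ x])
    show "\<forall>n. x \<in> ?F n" using x by blast
    show "y = x" if "\<forall>n. y \<in> ?F n" for y
      by (rule uniq) (rule that[rule_format])
  qed
qed

lemma cf_point_in: "\<forall>i\<ge>1. 1 \<le> a i \<Longrightarrow> cf_point a \<in> cf_branch (cf_prefix a n) ` {0..1}"
  using theI'[OF cf_point_ex1] unfolding cf_point_def by blast

lemma cf_point_eqI: "\<forall>i\<ge>1. 1 \<le> a i \<Longrightarrow> (\<And>n. x \<in> cf_branch (cf_prefix a n) ` {0..1}) \<Longrightarrow> x = cf_point a"
  using cf_point_ex1[of a] cf_point_in[of a] by blast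

lemma cf_prefix_Suc: "cf_prefix a (Suc n) = a 1 # cf_prefix (\<lambda>i. a (Suc i)) n"
proof -
  have "[1..<Suc (Suc n)] = 1 # map Suc [1..<Suc n]"
    by (simp add: upt_conv_Cons del: upt_Suc flip: map_Suc_upt)
  then show ?thesis by (simp add: cf_prefix_def comp_def del: upt_Suc)
qed

text \<open>Removing the first digit acts on points as the Gauss map; this identity drives all
  computations of digits below.\<close>
lemma cf_point_rec:
  assumes a: "\<forall>i\<ge>1. 1 \<le> a i"
  shows "cf_point a = 1 / (real (a 1) + cf_point (\<lambda>i. a (Suc i)))"
proof -
  let ?b = "\<lambda>i. a (Suc i)"
  have b: "\<forall>i\<ge>1. 1 \<le> ?b i" using a by auto
  have "1 / (real (a 1) + cf_point ?b) \<in> cf_branch (cf_prefix a n) ` {0..1}" for n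
  proof (cases n)
    case 0
    have "cf_point ?b \<in> {0..1}" using cf_point_in[OF b, of 0] by (simp add: cf_prefix_def)
    moreover have "1 \<le> real (a 1)" using a by auto
    ultimately show ?thesis using 0 by (auto simp: cf_prefix_def field_simps)
  next
    case (Suc m)
    then show ?thesis using cf_point_in[OF b, of m] by (auto simp: cf_prefix_Suc)
  qed
  then show ?thesis using cf_point_eqI[OF a] by metis
qed

lemma cf_point_open:
  assumes a: "\<forall>i\<ge>1. 1 \<le> a i"
  shows "0 < cf_point a" "cf_point a < 1"
proof -
  have *: "0 < cf_point a" if a: "\<forall>i\<ge>1. 1 \<le> a i" for a
  proof -
    have "\<forall>i\<ge>1. 1 \<le> a (Suc i)" using a by auto
    from cf_point_in[OF this, of 0] have "0 \<le> cf_point (\<lambda>i. a (Suc i))" by (simp add: cf_prefix_def)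
    moreover have "1 \<le> real (a 1)" using a by auto
    ultimately show ?thesis by (subst cf_point_rec[OF a]) (auto intro!: divide_pos_pos)
  qed
  show "0 < cf_point a" using * a .
  have "0 < cf_point (\<lambda>i. a (Suc i))" using a by (intro *) auto
  moreover have "1 \<le> real (a 1)" using a by auto
  ultimately show "cf_point a < 1" by (subst cf_point_rec[OF a]) auto
qed

lemma gauss_map_cf_point:
  assumes a: "\<forall>i\<ge>1. 1 \<le> a i"
  shows "gauss_map (cf_point a) = cf_point (\<lambda>i. a (Suc i))" "nat \<lfloor>1 / cf_point a\<rfloor> = a 1"
proof -
  have b: "\<forall>i\<ge>1. 1 \<le> a (Suc i)" using a by auto
  note o = cf_point_open[OF b] cf_point_open[OF a]
  have eq: "1 / cf_point a = real (a 1) + cf_point (\<lambda>i. a (Suc i))"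
    using o by (subst cf_point_rec[OF a]) auto
  have fl: "\<lfloor>1 / cf_point a\<rfloor> = int (a 1)"
    unfolding eq using o by (intro floor_unique) auto
  then show "nat \<lfloor>1 / cf_point a\<rfloor> = a 1" by simp
  show "gauss_map (cf_point a) = cf_point (\<lambda>i. a (Suc i))"
    unfolding gauss_map_def fl using o by (simp add: eq)
qed

lemma gauss_map_iter_cf_point:
  assumes a: "\<forall>i\<ge>1. 1 \<le> a i"
  shows "(gauss_map ^^ n) (cf_point a) = cf_point (\<lambda>i. a (n + i))"
proof (induction n)
  case (Suc n)
  have "\<forall>i\<ge>1. 1 \<le> a (n + i)" using a by auto
  from gauss_map_cf_point(1)[OF this] show ?case by (simp add: Suc)
qed simp

lemma cf_digit_cf_point:
  assumes a: "\<forall>i\<ge>1. 1 \<le> a i" and n: "1 \<le> n"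
  shows "cf_digit n (cf_point a) = a n"
proof -
  have "\<forall>i\<ge>1. 1 \<le> a (n - 1 + i)" using a by auto
  from gauss_map_cf_point(2)[OF this] show ?thesis
    using n by (simp add: cf_digit_def gauss_map_iter_cf_point[OF a])
qed

text \<open>On fractions the Gauss map is a step of the Euclidean algorithm: it sends \<open>p / q\<close> to
  \<open>(q mod p) / p\<close>.\<close>
lemma gauss_map_rational:
  assumes "0 \<le> p" "p < q"
  shows "\<exists>n. (gauss_map ^^ n) (real_of_int p / real_of_int q) = 0"
  using assms
proof (induction "nat p" arbitrary: p q rule: less_induct)
  case less
  show ?case
  proof (cases "p = 0")
    case True
    then show ?thesis by (intro exI[of _ 0]) simp
  next
    case False
    have "gauss_map (real_of_int p / real_of_int q) = real_of_int (q mod p) / real_of_int p"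
    proof -
      have "real_of_int q / real_of_int p = real_of_int (q div p) + real_of_int (q mod p) / real_of_int p"
        using False by (simp add: field_simps flip: of_int_mult of_int_add)
      then show ?thesis using False less.prems
        by (simp add: gauss_map_def floor_divide_of_int_eq)
    qed
    moreover obtain n where "(gauss_map ^^ n) (real_of_int (q mod p) / real_of_int p) = 0"
      using less.hyps[of "q mod p" p] False less.prems by (auto simp: nat_less_iff)
    ultimately have "(gauss_map ^^ Suc n) (real_of_int p / real_of_int q) = 0"
      by (simp add: funpow_swap1)
    then show ?thesis by blast
  qed
qed

lemma cf_point_irrational:
  assumes a: "\<forall>i\<ge>1. 1 \<le> a i"
  shows "cf_point a \<notin> \<rat>"
proof
  assume "cf_point a \<in> \<rat>"
  then obtain p q :: int where pq: "0 < q" "cf_point a = real_of_int p / real_of_int q"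
    by (elim Rats_cases') auto
  have "0 \<le> p" "p < q" using cf_point_open[OF a] pq by (auto simp: field_simps)
  then obtain n where "(gauss_map ^^ n) (cf_point a) = 0" using gauss_map_rational pq by metis
  then show False using cf_point_open(1)[of "\<lambda>i. a (n + i)"] a
    by (auto simp: gauss_map_iter_cf_point[OF a])
qed

lemma gauss_map_irrational:
  assumes "x \<in> {0..<1}" "x \<notin> \<rat>"
  shows "gauss_map x \<in> {0..<1}" "gauss_map x \<notin> \<rat>" "1 \<le> nat \<lfloor>1 / x\<rfloor>" "x = 1 / (real (nat \<lfloor>1/x\<rfloor>) + gauss_map x)"
proof -
  have x: "0 < x" "x < 1" using assms by (auto simp: order_le_less)
  then have "1 < 1 / x" by simp
  then have fl: "1 \<le> \<lfloor>1 / x\<rfloor>" by linarith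
  then show "1 \<le> nat \<lfloor>1 / x\<rfloor>" by linarith
  have g: "gauss_map x = 1 / x - of_int \<lfloor>1 / x\<rfloor>" using x by (simp add: gauss_map_def)
  show "gauss_map x \<in> {0..<1}" unfolding g by (auto; linarith)
  show "x = 1 / (real (nat \<lfloor>1/x\<rfloor>) + gauss_map x)"
  proof -
    have "real (nat \<lfloor>1/x\<rfloor>) = of_int \<lfloor>1/x\<rfloor>" using fl by (intro of_nat_nat) linarith
    then show ?thesis unfolding g by simp
  qed
  show "gauss_map x \<notin> \<rat>"
  proof
    assume "gauss_map x \<in> \<rat>"
    then have "1 / (gauss_map x + of_int \<lfloor>1 / x\<rfloor>) \<in> \<rat>" by (intro Rats_divide Rats_add) auto
    then show False using assms by (simp add: g)
  qed
qed

lemma gauss_map_iter_irrational: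
  assumes "x \<in> {0..<1}" "x \<notin> \<rat>"
  shows "(gauss_map ^^ n) x \<in> {0..<1} \<and> (gauss_map ^^ n) x \<notin> \<rat>"
  using assms gauss_map_irrational by (induction n) auto

lemma cf_digit_ge1:
  assumes "x \<in> {0..<1}" "x \<notin> \<rat>"
  shows "1 \<le> cf_digit n x"
  unfolding cf_digit_def using gauss_map_irrational(3) gauss_map_iter_irrational[OF assms] by blast

lemma cf_branch_cf_digit:
  assumes "x \<in> {0..<1}" "x \<notin> \<rat>"
  shows "x = cf_branch (cf_prefix (\<lambda>i. cf_digit i x) n) ((gauss_map ^^ n) x)"
proof (induction n)
  case 0
  then show ?case by (simp add: cf_prefix_def)
next
  case (Suc n)
  have "(gauss_map ^^ n) x = 1 / (real (cf_digit (Suc n) x) + (gauss_map ^^ Suc n) x)"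
    using gauss_map_irrational(4) gauss_map_iter_irrational[OF assms, of n] by (simp add: cf_digit_def)
  moreover have "cf_prefix (\<lambda>i. cf_digit i x) (Suc n) = cf_prefix (\<lambda>i. cf_digit i x) n @ [cf_digit (Suc n) x]"
    by (simp add: cf_prefix_def)
  ultimately show ?case using Suc by (simp add: cf_branch_append)
qed

section \<open>Digit sequences with prescribed frequencies\<close>

definition digit_count :: "(nat \<Rightarrow> nat) \<Rightarrow> nat \<Rightarrow> nat \<Rightarrow> nat" where
  "digit_count a n k = card {i \<in> {1..n}. a i = k}"

definition has_digit_freqs :: "(nat \<Rightarrow> nat) \<Rightarrow> (nat \<Rightarrow> real) \<Rightarrow> bool" where
  "has_digit_freqs a \<eta> \<longleftrightarrow> (\<forall>k\<ge>1. (\<lambda>n. real (digit_count a n k) / real n) \<longlonglongrightarrow> \<eta> k)"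

lemma digit_count_0 [simp]: "digit_count a 0 k = 0"
  by (simp add: digit_count_def)

lemma digit_count_Suc:
  "digit_count a (Suc n) k = digit_count a n k + (if a (Suc n) = k then 1 else 0)"
proof -
  have "{i \<in> {1..Suc n}. a i = k} = {i \<in> {1..n}. a i = k} \<union> (if a (Suc n) = k then {Suc n} else {})"
    by (auto simp: le_Suc_eq)
  then show ?thesis by (auto simp: digit_count_def)
qed

lemma sum_digit_count_Suc:
  "(\<Sum>k=1..K. digit_count a (Suc n) k) = (\<Sum>k=1..K. digit_count a n k) + (if a (Suc n) \<in> {1..K} then 1 else 0)"
  by (simp add: digit_count_Suc sum.distrib)

lemma sum_digit_count_le: "(\<Sum>k=1..K. digit_count a n k) \<le> n"
  by (induction n) (auto simp: sum_digit_count_Suc simp del: One_nat_def atLeastAtMost_iff)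

lemma stochastic_partial_sum:
  assumes "stochastic_vec \<eta>" "\<epsilon> > 0"
  obtains K where "1 - \<epsilon> < (\<Sum>k=1..K. \<eta> k)"
proof -
  have "(\<eta> has_sum 1) {1..}" using assms by (simp add: stochastic_vec_def)
  then have "((\<lambda>F. sum \<eta> F) \<longlongrightarrow> 1) (finite_subsets_at_top {1..})"
    by (simp add: has_sum_def)
  then have "\<forall>\<^sub>F F in finite_subsets_at_top {1..}. 1 - \<epsilon> < sum \<eta> F"
    by (rule order_tendstoD) (use assms in auto)
  then obtain F where F: "finite F" "F \<subseteq> {1..}" "\<And>G. finite G \<Longrightarrow> F \<subseteq> G \<Longrightarrow> G \<subseteq> {1..} \<Longrightarrow> 1 - \<epsilon> < sum \<eta> G"
    by (auto simp: eventually_finite_subsets_at_top)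
  have "F \<subseteq> {1..Max (insert 0 F)}" using F by (auto simp: Max_ge)
  then show ?thesis using F(3)[of "{1..Max (insert 0 F)}"] that by auto
qed

lemma stochastic_partial_sum_le:
  assumes "stochastic_vec \<eta>"
  shows "(\<Sum>k=1..K. \<eta> k) \<le> 1"
  using assms unfolding stochastic_vec_def
  by (intro finite_sum_le_has_sum[where f = \<eta> and A = "{1..}"]) (auto simp: less_imp_le)

text \<open>Taking the least digit below its quota \<open>(n + 1) \<eta>\<^sub>k\<close>, rather than any such digit, keeps the
  partial sums of the counts above the partial sums of the quotas and lets large digits enter
  slowly.\<close>
definition greedy_next :: "(nat \<Rightarrow> real) \<Rightarrow> nat \<Rightarrow> (nat \<Rightarrow> nat) \<Rightarrow> nat" where
  "greedy_next \<eta> n c = (LEAST k. 1 \<le> k \<and> real (c k) < real (Suc n) * \<eta> k)"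

primrec greedy_count :: "(nat \<Rightarrow> real) \<Rightarrow> nat \<Rightarrow> nat \<Rightarrow> nat" where
  "greedy_count \<eta> 0 = (\<lambda>_. 0)"
| "greedy_count \<eta> (Suc n) =
     (greedy_count \<eta> n)(greedy_next \<eta> n (greedy_count \<eta> n) := Suc (greedy_count \<eta> n (greedy_next \<eta> n (greedy_count \<eta> n))))"

definition greedy_digit :: "(nat \<Rightarrow> real) \<Rightarrow> nat \<Rightarrow> nat" where
  "greedy_digit \<eta> n = greedy_next \<eta> (n - 1) (greedy_count \<eta> (n - 1))"

lemma greedy_count_eq: "greedy_count \<eta> n k = digit_count (greedy_digit \<eta>) n k"
  by (induction n arbitrary: k) (auto simp: digit_count_Suc greedy_digit_def)

context
  fixes \<eta> :: "nat \<Rightarrow> real"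
  assumes stoch: "stochastic_vec \<eta>"
begin

text \<open>Some digit is always below its quota: the counts after \<open>n\<close> steps sum to \<open>n\<close>, the quotas to
  \<open>n + 1\<close>.\<close>
lemma greedy_digit_spec:
  "1 \<le> greedy_digit \<eta> (Suc n)"
  "real (digit_count (greedy_digit \<eta>) n (greedy_digit \<eta> (Suc n))) < real (Suc n) * \<eta> (greedy_digit \<eta> (Suc n))"
  "1 \<le> k \<Longrightarrow> k < greedy_digit \<eta> (Suc n) \<Longrightarrow> real (Suc n) * \<eta> k \<le> real (digit_count (greedy_digit \<eta>) n k)"
proof -
  let ?c = "digit_count (greedy_digit \<eta>) n"
  let ?P = "\<lambda>k. 1 \<le> k \<and> real (?c k) < real (Suc n) * \<eta> k"
  have eq: "greedy_digit \<eta> (Suc n) = (LEAST k. ?P k)"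
    by (simp add: greedy_digit_def greedy_next_def greedy_count_eq)
  have ex: "\<exists>k. ?P k"
  proof (rule ccontr)
    assume "\<nexists>k. ?P k"
    then have *: "real (Suc n) * \<eta> k \<le> real (?c k)" if "1 \<le> k" for k using that by force
    obtain K where K: "1 - 1 / real (Suc n) < (\<Sum>k=1..K. \<eta> k)"
      using stochastic_partial_sum[OF stoch, of "1 / real (Suc n)"] by auto
    have "real n < real (Suc n) * (\<Sum>k=1..K. \<eta> k)"
      using K by (simp add: field_simps)
    also have "\<dots> \<le> (\<Sum>k=1..K. real (?c k))"
      unfolding sum_distrib_left by (intro sum_mono *) auto
    also have "\<dots> \<le> real n" using sum_digit_count_le[of "greedy_digit \<eta>" n K]
      by (simp flip: of_nat_sum)
    finally show False by simp
  qed
  from LeastI_ex[OF ex] show "1 \<le> greedy_digit \<eta> (Suc n)"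
    "real (digit_count (greedy_digit \<eta>) n (greedy_digit \<eta> (Suc n))) < real (Suc n) * \<eta> (greedy_digit \<eta> (Suc n))"
    unfolding eq by auto
  show "real (Suc n) * \<eta> k \<le> real (digit_count (greedy_digit \<eta>) n k)"
    if "1 \<le> k" "k < greedy_digit \<eta> (Suc n)"
    using not_less_Least[of k ?P] that unfolding eq by auto
qed

lemma greedy_count_upper:
  assumes "1 \<le> k"
  shows "real (digit_count (greedy_digit \<eta>) n k) \<le> real n * \<eta> k + 1"
proof (induction n)
  case (Suc n)
  have "0 < \<eta> k" using stoch assms by (auto simp: stochastic_vec_def)
  then show ?case using Suc greedy_digit_spec(2)[of n]
    by (auto simp: digit_count_Suc algebra_simps)
qed simp

text \<open>A step that adds a digit \<open>\<le> K\<close> raises the right-hand side by \<open>1\<close> and the left-hand side by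
  at most \<open>1\<close>.  A step that adds a larger digit is only taken when all digits \<open>\<le> K\<close> already meet
  their quotas.\<close>
lemma greedy_count_lower:
  "real n * (\<Sum>k=1..K. \<eta> k) \<le> (\<Sum>k=1..K. real (digit_count (greedy_digit \<eta>) n k))"
proof (induction n)
  case (Suc n)
  let ?s = "\<Sum>k=1..K. \<eta> k"
  have step: "(\<Sum>k=1..K. real (digit_count (greedy_digit \<eta>) (Suc n) k)) =
      (\<Sum>k=1..K. real (digit_count (greedy_digit \<eta>) n k)) + (if greedy_digit \<eta> (Suc n) \<in> {1..K} then 1 else 0)"
    using arg_cong[OF sum_digit_count_Suc[where a = "greedy_digit \<eta>" and n = n and K = K], of real] by (simp split: if_splits)
  show ?case
  proof (cases "greedy_digit \<eta> (Suc n) \<in> {1..K}")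
    case True
    then show ?thesis using Suc stochastic_partial_sum_le[OF stoch, of K]
      unfolding step by (simp add: algebra_simps)
  next
    case False
    then have "K < greedy_digit \<eta> (Suc n)" using greedy_digit_spec(1)[of n] by auto
    then have "real (Suc n) * \<eta> k \<le> real (digit_count (greedy_digit \<eta>) n k)" if "k \<in> {1..K}" for k
      using greedy_digit_spec(3)[of k n] that by auto
    then have "(\<Sum>k=1..K. real (Suc n) * \<eta> k) \<le> (\<Sum>k=1..K. real (digit_count (greedy_digit \<eta>) n k))"
      by (intro sum_mono) auto
    then show ?thesis using False unfolding step sum_distrib_left by auto
  qed
qed simp

text \<open>The lower bound for the first \<open>k\<close> counts together and the upper bounds for the first \<open>k - 1\<close>
  of them leave at least \<open>n \<eta>\<^sub>k - k\<close> occurrences of \<open>k\<close>.\<close>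
lemma greedy_digit_freqs: "has_digit_freqs (greedy_digit \<eta>) \<eta>"
  unfolding has_digit_freqs_def
proof (intro allI impI)
  fix k :: nat assume k: "1 \<le> k"
  let ?c = "\<lambda>n k. real (digit_count (greedy_digit \<eta>) n k)"
  have lower: "real n * \<eta> k - real k \<le> ?c n k" for n
  proof -
    have split: "{1..k} = insert k {1..k-1}" "k \<notin> {1..k-1}" using k by auto
    have "real n * (\<eta> k + (\<Sum>j=1..k-1. \<eta> j)) \<le> ?c n k + (\<Sum>j=1..k-1. ?c n j)"
      using greedy_count_lower[of n k] unfolding split(1) using split(2) by simp
    moreover have "(\<Sum>j=1..k-1. ?c n j) \<le> (\<Sum>j=1..k-1. real n * \<eta> j + 1)"
      by (intro sum_mono greedy_count_upper) auto
    then have "(\<Sum>j=1..k-1. ?c n j) \<le> real n * (\<Sum>j=1..k-1. \<eta> j) + real (k - 1)"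
      by (simp add: sum.distrib sum_distrib_left)
    moreover have "real (k - 1) \<le> real k" by simp
    ultimately show ?thesis by (simp only: distrib_left)
  qed
  have "\<bar>?c n k / real n - \<eta> k\<bar> \<le> real k / real n" if "n \<ge> 1" for n
  proof -
    have "\<bar>?c n k - real n * \<eta> k\<bar> \<le> real k"
      using lower[of n] greedy_count_upper[OF k, of n] k by linarith
    then have "\<bar>(?c n k - real n * \<eta> k) / real n\<bar> \<le> real k / real n"
      by (simp add: divide_right_mono)
    then show ?thesis using that by (simp add: diff_divide_distrib)
  qed
  then have "\<forall>\<^sub>F n in sequentially. norm (?c n k / real n - \<eta> k) \<le> real k / real n"
    unfolding eventually_sequentially by auto
  moreover have "(\<lambda>n. real k / real n) \<longlonglongrightarrow> 0" by (rule lim_const_over_n)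
  ultimately show "(\<lambda>n. ?c n k / real n) \<longlonglongrightarrow> \<eta> k"
    by (rule LIM_zero_cancel[OF Lim_null_comparison])
qed

text \<open>When a digit is chosen, all smaller ones have met their positive quotas and so have occurred
  before.  This slow growth is what makes the free digits of the Cantor set below dominant.\<close>
lemma greedy_digit_le: "greedy_digit \<eta> (Suc n) \<le> Suc n"
proof -
  let ?z = "greedy_digit \<eta> (Suc n)"
  have "1 \<le> digit_count (greedy_digit \<eta>) n k" if "k \<in> {1..?z - 1}" for k
  proof -
    have k: "1 \<le> k" "k < ?z" using that by auto
    have "0 < real (Suc n) * \<eta> k" using stoch k by (auto simp: stochastic_vec_def)
    also have "\<dots> \<le> real (digit_count (greedy_digit \<eta>) n k)" by (rule greedy_digit_spec(3)[OF k])
    finally show ?thesis by linarith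
  qed
  then have "(\<Sum>k=1..?z - 1. 1) \<le> (\<Sum>k=1..?z - 1. digit_count (greedy_digit \<eta>) n k)" by (rule sum_mono)
  also have "\<dots> \<le> n" by (rule sum_digit_count_le)
  finally show ?thesis by simp
qed

end

lemma has_digit_freqs_perturb:
  assumes a: "has_digit_freqs a \<eta>" and ab: "(\<lambda>n. real (card {i \<in> {1..n}. a i \<noteq> b i}) / real n) \<longlonglongrightarrow> 0"
  shows "has_digit_freqs b \<eta>"
  unfolding has_digit_freqs_def
proof (intro allI impI)
  fix k :: nat assume "1 \<le> k"
  have le: "digit_count c n k \<le> digit_count d n k + card {i \<in> {1..n}. c i \<noteq> d i}" for c d :: "nat \<Rightarrow> nat" and n
  proof -
    have "digit_count c n k \<le> card ({i \<in> {1..n}. d i = k} \<union> {i \<in> {1..n}. c i \<noteq> d i})"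
      unfolding digit_count_def by (intro card_mono) auto
    also have "\<dots> \<le> digit_count d n k + card {i \<in> {1..n}. c i \<noteq> d i}"
      unfolding digit_count_def by (rule card_Un_le)
    finally show ?thesis .
  qed
  have "\<bar>real (digit_count b n k) - real (digit_count a n k)\<bar> \<le> real (card {i \<in> {1..n}. a i \<noteq> b i})" for n
  proof -
    have "{i \<in> {1..n}. b i \<noteq> a i} = {i \<in> {1..n}. a i \<noteq> b i}" by auto
    then have "digit_count b n k \<le> digit_count a n k + card {i \<in> {1..n}. a i \<noteq> b i}"
      using le[where c = b and d = a and n = n] by simp
    moreover note le[where c = a and d = b and n = n]
    ultimately show ?thesis by linarith
  qed
  then have "\<bar>real (digit_count b n k) - real (digit_count a n k)\<bar> / real n \<le> real (card {i \<in> {1..n}. a i \<noteq> b i}) / real n" for n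
    by (rule divide_right_mono) simp
  then have "norm (real (digit_count b n k) / real n - real (digit_count a n k) / real n) \<le> real (card {i \<in> {1..n}. a i \<noteq> b i}) / real n" for n
    by (simp add: abs_divide flip: diff_divide_distrib)
  then have "(\<lambda>n. real (digit_count b n k) / real n - real (digit_count a n k) / real n) \<longlonglongrightarrow> 0"
    by (intro Lim_null_comparison[OF _ ab]) auto
  moreover have "(\<lambda>n. real (digit_count a n k) / real n) \<longlonglongrightarrow> \<eta> k"
    using a \<open>1 \<le> k\<close> by (simp add: has_digit_freqs_def)
  ultimately show "(\<lambda>n. real (digit_count b n k) / real n) \<longlonglongrightarrow> \<eta> k"
    by (rule Lim_transform[rotated])
qed

section \<open>Frequency sets are dense and have positive dimension\<close>

lemma cf_point_freq_set:
  assumes "\<forall>i\<ge>1. 1 \<le> a i" "has_digit_freqs a \<eta>"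
  shows "cf_point a \<in> freq_set \<eta>"
proof -
  have "{i \<in> {1..n}. cf_digit i (cf_point a) = k} = {i \<in> {1..n}. a i = k}" for n k
    using cf_digit_cf_point[OF assms(1)] by auto
  then show ?thesis
    using assms cf_point_open[OF assms(1)] cf_point_irrational[OF assms(1)]
    unfolding freq_set_def has_digit_freqs_def digit_count_def by simp
qed

lemma cf_point_cylinder:
  assumes "\<forall>i\<ge>1. 1 \<le> a i"
  obtains v where "v \<in> {0..1}" "cf_point a = cf_branch (cf_prefix a n) v"
  using cf_point_in[OF assms, of n] by auto

lemma freq_set_dense:
  assumes \<eta>: "stochastic_vec \<eta>" and x: "x \<in> {0..<1}" "x \<notin> \<rat>"
  shows "x \<in> closure (freq_set \<eta>)"
  unfolding closure_approachable
proof (intro allI impI)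
  fix \<epsilon> :: real assume "0 < \<epsilon>"
  then obtain N where N: "(1/4::real) ^ N < \<epsilon>"
    using real_arch_pow_inv[of \<epsilon> "1/4"] by auto
  define a where "a i = (if i \<le> 2 * N then cf_digit i x else greedy_digit \<eta> i)" for i
  have a: "\<forall>i\<ge>1. 1 \<le> a i"
  proof (intro allI impI)
    fix i :: nat assume "1 \<le> i"
    then show "1 \<le> a i"
      using cf_digit_ge1[OF x, of i] greedy_digit_spec(1)[OF \<eta>, of "i - 1"] by (simp add: a_def)
  qed
  have "{i \<in> {1..n}. greedy_digit \<eta> i \<noteq> a i} \<subseteq> {1..2*N}" for n by (auto simp: a_def)
  then have "card {i \<in> {1..n}. greedy_digit \<eta> i \<noteq> a i} \<le> 2 * N" for n
    using card_mono[of "{1..2*N}"] by fastforce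
  then have "norm (real (card {i \<in> {1..n}. greedy_digit \<eta> i \<noteq> a i}) / real n) \<le> real (2 * N) / real n" for n
    by (simp only: real_norm_def abs_divide abs_of_nat) (intro divide_right_mono of_nat_mono, auto)
  then have "(\<lambda>n. real (card {i \<in> {1..n}. greedy_digit \<eta> i \<noteq> a i}) / real n) \<longlonglongrightarrow> 0"
    by (intro Lim_null_comparison[OF _ lim_const_over_n[of "real (2 * N)"]]) auto
  then have "has_digit_freqs a \<eta>"
    by (rule has_digit_freqs_perturb[OF greedy_digit_freqs[OF \<eta>]])
  then have "cf_point a \<in> freq_set \<eta>" by (rule cf_point_freq_set[OF a])
  moreover have "dist (cf_point a) x < \<epsilon>"
  proof -
    have eq: "cf_prefix (\<lambda>i. cf_digit i x) (2 * N) = cf_prefix a (2 * N)"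
      by (auto simp: cf_prefix_def a_def)
    obtain v where v: "v \<in> {0..1}" "cf_point a = cf_branch (cf_prefix a (2 * N)) v"
      by (rule cf_point_cylinder[OF a])
    let ?u = "(gauss_map ^^ (2 * N)) x"
    have u: "?u \<in> {0..1}" using gauss_map_iter_irrational[OF x, of "2 * N"] by auto
    have "dist (cf_point a) x = \<bar>cf_branch (cf_prefix a (2 * N)) v - cf_branch (cf_prefix a (2 * N)) ?u\<bar>"
      using cf_branch_cf_digit[OF x, of "2 * N"] by (simp add: v dist_real_def eq)
    also have "\<dots> \<le> (1/4) ^ N * \<bar>v - ?u\<bar>"
      using cf_branch_upper[OF set_cf_prefix[OF a] v(1) u, of "2 * N"] by simp
    also have "\<dots> \<le> (1/4) ^ N * 1" using u v by (intro mult_left_mono) auto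
    finally show ?thesis using N by simp
  qed
  ultimately show "\<exists>y\<in>freq_set \<eta>. dist y x < \<epsilon>" by blast
qed

text \<open>The positions \<open>2\<^sup>k\<close> have density zero, so the digits there may be chosen freely.  Only even
  digits are used: different choices then differ by at least \<open>2\<close>, and stay apart by at least \<open>1\<close>
  when the remaining digits contribute an amount in \<open>[0,1]\<close>.\<close>
definition sparse_digits :: "(nat \<Rightarrow> real) \<Rightarrow> (nat \<Rightarrow> nat) \<Rightarrow> nat \<Rightarrow> nat" where
  "sparse_digits \<eta> \<omega> i = (if i \<in> range (\<lambda>k. 2 ^ k) then 2 * \<omega> (inv (\<lambda>k. 2 ^ k) i) else greedy_digit \<eta> i)"

lemma sparse_digits_power [simp]: "sparse_digits \<eta> \<omega> (2 ^ k) = 2 * \<omega> k"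
proof -
  have "inj (\<lambda>k. 2 ^ k :: nat)" by (auto intro: injI)
  then show ?thesis by (simp add: sparse_digits_def inv_f_f)
qed

lemma sparse_digits_other: "i \<notin> range (\<lambda>k. 2 ^ k) \<Longrightarrow> sparse_digits \<eta> \<omega> i = greedy_digit \<eta> i"
  by (simp add: sparse_digits_def)

text \<open>The exponent \<open>4\<^sup>k\<close> outweighs the logarithm of the product of all the non-free digits at
  positions up to \<open>2\<^sup>k\<close>, which is of order \<open>k 2\<^sup>k\<close>.\<close>
definition free_choices :: "nat \<Rightarrow> nat set" where
  "free_choices k = {1..2 ^ (4 ^ k)}"

lemma between_powers: "2 ^ k < i \<Longrightarrow> i < 2 ^ Suc k \<Longrightarrow> i \<notin> range (\<lambda>k. 2 ^ k :: nat)"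
proof
  assume "i \<in> range (\<lambda>k. 2 ^ k)"
  then obtain j where "i = 2 ^ j" by auto
  moreover assume "2 ^ k < i" "i < 2 ^ Suc k"
  ultimately have "(2::nat) ^ k < 2 ^ j" "(2::nat) ^ j < 2 ^ Suc k" by simp_all
  then have "k < j" "j < Suc k" by (simp_all only: power_strict_increasing_iff one_less_numeral_iff semiring_norm)
  then show False by simp
qed

lemma power_count_tendsto:
  "(\<lambda>n. real (card {i \<in> {1..n}. i \<in> range (\<lambda>k. 2 ^ k :: nat)}) / real n) \<longlonglongrightarrow> 0"
proof -
  have card: "real (card {i \<in> {1..n}. i \<in> range (\<lambda>k. 2 ^ k :: nat)}) \<le> ln (real n) / ln 2 + 1" if "1 \<le> n" for n
  proof -
    let ?L = "nat \<lfloor>log 2 (real n)\<rfloor>"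
    have L: "0 \<le> log 2 (real n)" using that by simp
    have "{i \<in> {1..n}. i \<in> range (\<lambda>k. 2 ^ k :: nat)} \<subseteq> (\<lambda>k. 2 ^ k) ` {..?L}"
    proof clarify
      fix k assume "(2::nat) ^ k \<in> {1..n}"
      then have "(2::real) ^ k \<le> real n" by (simp flip: of_nat_power add: of_nat_le_iff) 
      then have "real k \<le> log 2 (real n)" using that by (simp add: le_log_iff powr_realpow)
      then have "k \<le> ?L" by linarith
      then show "2 ^ k \<in> (\<lambda>k. 2 ^ k :: nat) ` {..?L}" by auto
    qed
    then have "card {i \<in> {1..n}. i \<in> range (\<lambda>k. 2 ^ k :: nat)} \<le> card ((\<lambda>k. 2 ^ k :: nat) ` {..?L})"
      by (intro card_mono) auto
    also have "\<dots> \<le> ?L + 1" using card_image_le[of "{..?L}"] by simp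
    finally have "real (card {i \<in> {1..n}. i \<in> range (\<lambda>k. 2 ^ k :: nat)}) \<le> real ?L + 1" by linarith
    also have "real ?L \<le> log 2 (real n)" using L by linarith
    finally show ?thesis by (simp add: log_def)
  qed
  have "(\<lambda>n. (ln (real n) / real n) / ln 2 + 1 / real n) \<longlonglongrightarrow> 0 / ln 2 + 0"
    by (intro tendsto_intros filterlim_compose[OF lim_ln_over_n] lim_const_over_n) (auto simp: lim_ln_over_n)
  then have lim: "(\<lambda>n. (ln (real n) / real n) / ln 2 + 1 / real n) \<longlonglongrightarrow> 0" by simp
  have "norm (real (card {i \<in> {1..n}. i \<in> range (\<lambda>k. 2 ^ k :: nat)}) / real n) \<le> (ln (real n) / real n) / ln 2 + 1 / real n"
    if "1 \<le> n" for n
    using divide_right_mono[OF card[OF that], of "real n"] by (simp add: add_divide_distrib mult.commute)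
  then show ?thesis
    by (intro Lim_null_comparison[OF _ lim]) (auto simp: eventually_sequentially)
qed

lemma sparse_digits_freqs:
  assumes \<eta>: "stochastic_vec \<eta>"
  shows "has_digit_freqs (sparse_digits \<eta> \<omega>) \<eta>"
proof (rule has_digit_freqs_perturb[OF greedy_digit_freqs[OF \<eta>]])
  have "card {i \<in> {1..n}. greedy_digit \<eta> i \<noteq> sparse_digits \<eta> \<omega> i}
      \<le> card {i \<in> {1..n}. i \<in> range (\<lambda>k. 2 ^ k :: nat)}" for n
    using sparse_digits_other[of _ \<eta> \<omega>] by (intro card_mono) (simp, force)
  then have "norm (real (card {i \<in> {1..n}. greedy_digit \<eta> i \<noteq> sparse_digits \<eta> \<omega> i}) / real n)
      \<le> real (card {i \<in> {1..n}. i \<in> range (\<lambda>k. 2 ^ k :: nat)}) / real n" for n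
    by (simp only: real_norm_def abs_divide abs_of_nat) (intro divide_right_mono of_nat_mono, auto)
  then show "(\<lambda>n. real (card {i \<in> {1..n}. greedy_digit \<eta> i \<noteq> sparse_digits \<eta> \<omega> i}) / real n) \<longlonglongrightarrow> 0"
    by (intro Lim_null_comparison[OF _ power_count_tendsto]) auto
qed

lemma sparse_digits_ge1:
  assumes \<eta>: "stochastic_vec \<eta>" and \<omega>: "\<And>k. \<omega> k \<in> free_choices k"
  shows "\<forall>i\<ge>1. 1 \<le> sparse_digits \<eta> \<omega> i"
proof (intro allI impI)
  fix i :: nat assume "1 \<le> i"
  show "1 \<le> sparse_digits \<eta> \<omega> i"
  proof (cases "i \<in> range (\<lambda>k. 2 ^ k :: nat)")
    case True
    then obtain k where "i = 2 ^ k" by auto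
    then show ?thesis using \<omega>[of k] by (auto simp: free_choices_def)
  next
    case False
    then show ?thesis using greedy_digit_spec(1)[OF \<eta>, of "i - 1"] \<open>1 \<le> i\<close>
      by (simp add: sparse_digits_other)
  qed
qed

text \<open>Between consecutive powers \<open>2\<^sup>k\<close> and \<open>2\<^sup>k\<^sup>+\<^sup>1\<close> there are fewer than \<open>2\<^sup>k\<close> greedy digits, each below
  \<open>2\<^sup>k\<^sup>+\<^sup>1\<close>; their product is at most the number of choices at the free position \<open>2\<^sup>k\<close>.\<close>
lemma sparse_digits_prod_bound:
  assumes \<eta>: "stochastic_vec \<eta>" and \<omega>: "\<And>k. \<omega> k \<in> free_choices k"
  shows "(\<Prod>i\<in>{1..<2 ^ k}. sparse_digits \<eta> \<omega> i + 1) \<le> 2 ^ (2 * 4 ^ k)"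
proof (induction k)
  case (Suc k)
  let ?f = "\<lambda>i. sparse_digits \<eta> \<omega> i + 1"
  have split: "{1..<2 ^ Suc k} = {1..<2 ^ k} \<union> ({2 ^ k} \<union> {2 ^ k<..<2 ^ Suc k :: nat})"
    by (auto simp: not_less)
  have "(\<Prod>i\<in>{1..<2 ^ Suc k}. ?f i) = (\<Prod>i\<in>{1..<2 ^ k}. ?f i) * (?f (2 ^ k) * (\<Prod>i\<in>{2 ^ k<..<2 ^ Suc k}. ?f i))"
    unfolding split
    by (subst prod.union_disjoint; (subst prod.union_disjoint)?; simp; force)
  also have "\<dots> \<le> 2 ^ (2 * 4 ^ k) * (2 ^ (4 ^ k + 2) * 2 ^ (4 ^ k))"
  proof (intro mult_le_mono Suc)
    have "\<omega> k \<le> 2 ^ (4 ^ k)" using \<omega>[of k] by (simp add: free_choices_def)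
    moreover have "(1::nat) \<le> 2 ^ (4 ^ k)" by simp
    ultimately have "?f (2 ^ k) \<le> 2 ^ (4 ^ k) * 4" unfolding sparse_digits_power by linarith
    also have "\<dots> = 2 ^ (4 ^ k + 2)" by (simp add: power_add)
    finally show "?f (2 ^ k) \<le> 2 ^ (4 ^ k + 2)" .
    have "?f i \<le> 2 ^ Suc k" if "i \<in> {2 ^ k<..<2 ^ Suc k}" for i
    proof -
      have "sparse_digits \<eta> \<omega> i = greedy_digit \<eta> i"
        by (rule sparse_digits_other, rule between_powers[of k]) (use that in simp_all)
      moreover have "greedy_digit \<eta> i \<le> i" using greedy_digit_le[OF \<eta>, of "i - 1"] that by auto
      ultimately show ?thesis using that by simp
    qed
    then have "(\<Prod>i\<in>{2 ^ k<..<2 ^ Suc k}. ?f i) \<le> (\<Prod>i\<in>{2 ^ k<..<2 ^ Suc k :: nat}. 2 ^ Suc k)"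
      by (intro prod_mono) auto
    also have "\<dots> = (2 ^ Suc k) ^ (2 ^ k - 1)" by (simp add: mult_2)
    also have "\<dots> \<le> 2 ^ (Suc k * 2 ^ k)"
      unfolding power_mult[symmetric] by (intro power_increasing mult_le_mono) auto
    also have "\<dots> \<le> 2 ^ (4 ^ k)"
    proof (intro power_increasing)
      have "Suc k \<le> 2 ^ k" by (simp add: Suc_leI less_exp)
      then have "Suc k * 2 ^ k \<le> 2 ^ k * 2 ^ k" by (rule mult_le_mono1)
      also have "\<dots> = 4 ^ k" by (simp flip: power_mult_distrib)
      finally show "Suc k * 2 ^ k \<le> 4 ^ k" .
    qed auto
    finally show "(\<Prod>i\<in>{2 ^ k<..<2 ^ Suc k}. ?f i) \<le> 2 ^ (4 ^ k)" .
  qed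
  also have "\<dots> = 2 ^ (2 * 4 ^ k + (4 ^ k + 2 + 4 ^ k))" by (simp only: power_add)
  also have "\<dots> \<le> 2 ^ (2 * 4 ^ Suc k)"
  proof (intro power_increasing)
    have "(1::nat) \<le> 4 ^ k" by simp
    then show "2 * 4 ^ k + (4 ^ k + 2 + 4 ^ k) \<le> 2 * (4::nat) ^ Suc k" by simp
  qed auto
  finally show ?case .
qed auto

text \<open>The first \<open>2\<^sup>k - 1\<close> digits agree; their branches shrink distances at most by \<open>2\<close> to the power
  \<open>-4 \<cdot> 4\<^sup>k\<close>.  The points on which they act differ by at least \<open>2\<close> to the power \<open>-6 \<cdot> 4\<^sup>k\<close>, since the
  digits at position \<open>2\<^sup>k\<close> are different and not larger than \<open>2\<close> times the number of choices.\<close>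
lemma sparse_point_separation:
  assumes \<eta>: "stochastic_vec \<eta>" and \<omega>: "\<And>k. \<omega> k \<in> free_choices k" and \<tau>: "\<And>k. \<tau> k \<in> free_choices k"
    and agree: "\<And>j. j < k \<Longrightarrow> \<omega> j = \<tau> j" and differ: "\<omega> k \<noteq> \<tau> k"
  shows "1 / 2 ^ (10 * 4 ^ k) \<le> \<bar>cf_point (sparse_digits \<eta> \<omega>) - cf_point (sparse_digits \<eta> \<tau>)\<bar>"
proof -
  let ?a = "sparse_digits \<eta> \<omega>" and ?b = "sparse_digits \<eta> \<tau>"
  define n :: nat where "n = 2 ^ k - 1"
  have a: "\<forall>i\<ge>1. 1 \<le> ?a i" and b: "\<forall>i\<ge>1. 1 \<le> ?b i" using sparse_digits_ge1 \<eta> \<omega> \<tau> by auto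
  have n: "Suc n = 2 ^ k" by (simp add: n_def)
  have "?a i = ?b i" if "i < 2 ^ k" for i
  proof (cases "i \<in> range (\<lambda>k. 2 ^ k :: nat)")
    case True
    then obtain j where j: "i = 2 ^ j" by auto
    then have "j < k" using that power_less_imp_less_exp[of 2] by auto
    then show ?thesis using agree j by simp
  qed (simp add: sparse_digits_other)
  then have pre: "cf_prefix ?a n = cf_prefix ?b n"
    unfolding cf_prefix_def n by auto
  obtain v where v: "v \<in> {0..1}" "cf_point ?a = cf_branch (cf_prefix ?a (Suc n)) v"
    by (rule cf_point_cylinder[OF a])
  obtain w where w: "w \<in> {0..1}" "cf_point ?b = cf_branch (cf_prefix ?b (Suc n)) w"
    by (rule cf_point_cylinder[OF b])
  have snoc: "cf_prefix c (Suc m) = cf_prefix c m @ [c (Suc m)]" for c m by (simp add: cf_prefix_def)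
  define x y where "x = 2 * real (\<omega> k) + v" and "y = 2 * real (\<tau> k) + w"
  have eqs: "cf_point ?a = cf_branch (cf_prefix ?a n) (1 / x)" "cf_point ?b = cf_branch (cf_prefix ?a n) (1 / y)"
    unfolding v(2) w(2) snoc cf_branch_append pre unfolding n by (simp_all add: x_def y_def)
  let ?m = "2 * 2 ^ (4 ^ k) + 1 :: real"
  have \<omega>k: "1 \<le> real (\<omega> k)" "real (\<omega> k) \<le> 2 ^ (4 ^ k)" "1 \<le> real (\<tau> k)" "real (\<tau> k) \<le> 2 ^ (4 ^ k)"
    using \<omega>[of k] \<tau>[of k] by (auto simp: free_choices_def)
  have x: "1 \<le> x" "x \<le> ?m" and y: "1 \<le> y" "y \<le> ?m"
    using v(1) w(1) \<omega>k unfolding x_def y_def atLeastAtMost_iff by linarith+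
  have "1 \<le> \<bar>real (\<omega> k) - real (\<tau> k)\<bar>"
    using differ by (cases "\<omega> k < \<tau> k") auto
  then have "1 \<le> \<bar>x - y\<bar>"
    using v(1) w(1) unfolding x_def y_def atLeastAtMost_iff by linarith
  moreover have "x * y \<le> ?m\<^sup>2" unfolding power2_eq_square using x y by (intro mult_mono) auto
  ultimately have "1 / ?m\<^sup>2 \<le> \<bar>x - y\<bar> / (x * y)"
    using x y by (intro frac_le) auto
  also have "\<bar>x - y\<bar> / (x * y) = \<bar>1 / x - 1 / y\<bar>"
  proof -
    have "1 / x - 1 / y = (y - x) / (x * y)" using x y by (simp add: field_simps)
    then show ?thesis using x y by (simp add: abs_mult abs_minus_commute)
  qed
  finally have base: "1 / ?m\<^sup>2 \<le> \<bar>1 / x - 1 / y\<bar>" .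
  have m: "1 / ?m\<^sup>2 \<ge> 1 / 2 ^ (6 * 4 ^ k)"
  proof -
    have "(1::nat) \<le> 4 ^ k" by simp
    then have e: "2 + 4 ^ k \<le> 3 * (4::nat) ^ k" by linarith
    have "(1::real) \<le> 2 ^ (4 ^ k)" by simp
    then have "?m \<le> 2 ^ 2 * 2 ^ (4 ^ k)" unfolding power2_eq_square by linarith
    also have "\<dots> = 2 ^ (2 + 4 ^ k)" by (simp only: power_add)
    also have "\<dots> \<le> (2::real) ^ (3 * 4 ^ k)" using e by (intro power_increasing) auto
    finally have "?m\<^sup>2 \<le> (2 ^ (3 * 4 ^ k))\<^sup>2" by (intro power_mono) auto
    also have "\<dots> = 2 ^ (6 * 4 ^ k)" by (simp flip: power_mult add: mult.commute)
    finally have "?m\<^sup>2 \<le> 2 ^ (6 * 4 ^ k)" .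
    moreover have "0 < ?m\<^sup>2" by (intro zero_less_power add_pos_pos mult_pos_pos) auto
    ultimately show ?thesis by (intro divide_left_mono mult_pos_pos) auto
  qed
  have P: "1 / 2 ^ (4 * 4 ^ k) \<le> (\<Prod>a\<leftarrow>cf_prefix ?a n. 1 / (real a + 1)\<^sup>2)"
  proof -
    have "(\<Prod>a\<leftarrow>cf_prefix ?a n. 1 / (real a + 1)\<^sup>2) = (\<Prod>i\<in>{1..<2 ^ k}. 1 / (real (?a i) + 1)\<^sup>2)"
      unfolding cf_prefix_def n map_map by (subst prod.distinct_set_conv_list[symmetric]) (auto simp: comp_def)
    also have "\<dots> = 1 / (real (\<Prod>i\<in>{1..<2 ^ k}. ?a i + 1))\<^sup>2"
      by (simp add: prod_dividef prod_power_distrib add.commute)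
    also have "\<dots> \<ge> 1 / (2 ^ (2 * 4 ^ k))\<^sup>2"
    proof (intro divide_left_mono power_mono)
      have "real (\<Prod>i\<in>{1..<2 ^ k}. ?a i + 1) \<le> real (2 ^ (2 * 4 ^ k))"
        by (intro of_nat_mono sparse_digits_prod_bound[OF \<eta> \<omega>])
      then show "real (\<Prod>i\<in>{1..<2 ^ k}. ?a i + 1) \<le> 2 ^ (2 * 4 ^ k)" by simp
      have "0 < real (\<Prod>i\<in>{1..<2 ^ k}. ?a i + 1)" by (simp add: prod_pos del: of_nat_prod)
      then show "0 < (2 ^ (2 * 4 ^ k))\<^sup>2 * (real (\<Prod>i = 1..<2 ^ k. ?a i + 1))\<^sup>2"
        by (intro mult_pos_pos zero_less_power) auto
    qed (auto simp: prod_nonneg)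
    finally have "1 / (2 ^ (2 * 4 ^ k))\<^sup>2 \<le> (\<Prod>a\<leftarrow>cf_prefix ?a n. 1 / (real a + 1)\<^sup>2)" .
    moreover have "((2::real) ^ (2 * 4 ^ k))\<^sup>2 = 2 ^ (4 * 4 ^ k)"
      by (simp flip: power_mult add: mult.commute)
    ultimately show ?thesis by simp
  qed
  have "(2::real) ^ (10 * 4 ^ k) = 2 ^ (6 * 4 ^ k) * 2 ^ (4 * 4 ^ k)"
    by (simp flip: power_add)
  then have "1 / (2::real) ^ (10 * 4 ^ k) = 1 / 2 ^ (6 * 4 ^ k) * (1 / 2 ^ (4 * 4 ^ k))"
    by simp
  also have "\<dots> \<le> \<bar>1 / x - 1 / y\<bar> * (\<Prod>a\<leftarrow>cf_prefix ?a n. 1 / (real a + 1)\<^sup>2)"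
    using m base P by (intro mult_mono) auto
  also have "\<dots> \<le> \<bar>cf_point ?a - cf_point ?b\<bar>"
    unfolding eqs using x y set_cf_prefix[OF a] by (intro cf_branch_lower) (auto simp: field_simps)
  finally show ?thesis .
qed

text \<open>Fixing the first \<open>k + 1\<close> free digits costs mass at most \<open>2\<close> to the power \<open>-4\<^sup>k\<close>, while points
  that agree so far and differ at the next free digit have distance at least \<open>2\<close> to the power
  \<open>-10 \<cdot> 4\<^sup>k\<^sup>+\<^sup>1\<close>.  The quotient of the exponents is the lower bound \<open>1/40\<close> for the dimension.\<close>
lemma freq_set_dim_pos:
  assumes \<eta>: "stochastic_vec \<eta>"
  shows "0 < hausdorff_dim (freq_set \<eta>)"
proof -
  define p :: "nat \<Rightarrow> nat \<Rightarrow> real" where "p k j = 1 / 2 ^ (4 ^ k)" for k j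
  define M where "M = PiM UNIV (\<lambda>k. point_measure (free_choices k) (\<lambda>j. ennreal (p k j)))"
  define D where "D k = 1 / (2::real) ^ (10 * 4 ^ k)" for k :: nat
  have root: "(1 / (2::real) ^ (40 * m)) powr (1/40) = 1 / 2 ^ m" for m :: nat
    by (simp add: powr_divide powr_powr flip: powr_realpow)
  have p: "finite (free_choices k)" "0 \<le> p k j" "(\<Sum>j\<in>free_choices k. p k j) = 1" for k j
    by (auto simp: free_choices_def p_def)
  have prob: "prob_space M"
  proof -
    interpret product_prob_space "\<lambda>k. point_measure (free_choices k) (\<lambda>j. ennreal (p k j))" UNIV
      by (rule product_prob_space_point_measure) (use p in auto)
    show ?thesis unfolding M_def by (rule prob_space_axioms)
  qed
  have sp: "\<omega> k \<in> free_choices k" if "\<omega> \<in> space M" for \<omega> k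
    using that by (auto simp: M_def space_PiM space_point_measure)
  have D0: "D \<longlonglongrightarrow> 0"
  proof (rule Lim_null_comparison)
    have "norm (D k) \<le> (1/2) ^ k" for k
    proof -
      have "k < 2 ^ k" by (rule less_exp)
      moreover have "(2::nat) ^ k \<le> 4 ^ k" by (rule power_mono) auto
      ultimately have "k \<le> 10 * 4 ^ k" by linarith
      then have "(2::real) ^ k \<le> 2 ^ (10 * 4 ^ k)" by (intro power_increasing) auto
      then have "D k \<le> 1 / 2 ^ k" unfolding D_def by (intro divide_left_mono) auto
      then show ?thesis by (simp add: D_def power_one_over)
    qed
    then show "\<forall>\<^sub>F k in sequentially. norm (D k) \<le> (1/2) ^ k" by auto
  qed (rule LIMSEQ_power_zero, simp)
  have Danti: "D m \<le> D n" if "n \<le> m" for m n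
    unfolding D_def using that by (intro divide_left_mono power_increasing mult_le_mono) auto
  have "ennreal (1/40) \<le> hausdorff_dim (freq_set \<eta>)"
  proof (rule mass_distribution[OF prob, where \<pi> = "\<lambda>\<omega>. cf_point (sparse_digits \<eta> \<omega>)" and C = 1 and ?r0.0 = "D 0"])
    show "0 < D 0" "D 0 \<le> 1" by (auto simp: D_def)
    show "cf_point (sparse_digits \<eta> \<omega>) \<in> freq_set \<eta>" if "\<omega> \<in> space M" for \<omega>
      using sp[OF that] by (intro cf_point_freq_set sparse_digits_ge1 sparse_digits_freqs \<eta>)
    fix U :: "real set" and r :: real
    assume U: "U \<noteq> {}" "bounded U" "diameter U \<le> r" "0 < r" "r < D 0"
    let ?E = "{\<omega> \<in> space M. cf_point (sparse_digits \<eta> \<omega>) \<in> U}"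
    show "\<exists>B\<in>sets M. ?E \<subseteq> B \<and> emeasure M B \<le> ennreal (1 * r powr (1/40))"
    proof (cases "?E = {}")
      case True
      then show ?thesis by (intro bexI[of _ "{}"]) auto
    next
      case False
      then obtain \<tau> where \<tau>: "\<tau> \<in> space M" "cf_point (sparse_digits \<eta> \<tau>) \<in> U" by auto
      have "\<exists>k. D (Suc k) \<le> r"
      proof -
        have "\<forall>\<^sub>F k in sequentially. D k < r" using D0 U(4) by (rule order_tendstoD)
        then obtain k where "\<forall>n\<ge>k. D n < r" by (auto simp: eventually_sequentially)
        then show ?thesis by (intro exI[of _ k]) (auto simp: less_imp_le)
      qed
      define k where "k = (LEAST k. D (Suc k) \<le> r)"
      have k: "D (Suc k) \<le> r" unfolding k_def by (rule LeastI_ex) fact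
      have k': "r < D k"
      proof (cases k)
        case (Suc m)
        then have "\<not> D (Suc m) \<le> r" using not_less_Least[of m "\<lambda>k. D (Suc k) \<le> r"] by (auto simp: k_def)
        then show ?thesis using Suc by simp
      qed (use U in simp)
      let ?B = "{\<omega>\<in>space M. \<forall>j\<in>{..k}. \<omega> j = \<tau> j}"
      have "?E \<subseteq> ?B"
      proof
        fix \<omega> assume "\<omega> \<in> ?E"
        then have \<omega>: "\<omega> \<in> space M" "cf_point (sparse_digits \<eta> \<omega>) \<in> U" by auto
        have False if j: "j \<in> {..k}" "\<omega> j \<noteq> \<tau> j" for j
        proof -
        define i where "i = (LEAST i. \<omega> i \<noteq> \<tau> i)"
        have i: "\<omega> i \<noteq> \<tau> i" unfolding i_def by (rule LeastI) (rule j)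
        have i': "\<omega> l = \<tau> l" if "l < i" for l using not_less_Least[of l "\<lambda>i. \<omega> i \<noteq> \<tau> i"] that by (auto simp: i_def)
        have "i \<le> j" unfolding i_def by (rule Least_le) (rule j)
        then have "D k \<le> D i" using j by (intro Danti) auto
        also have "\<dots> \<le> \<bar>cf_point (sparse_digits \<eta> \<omega>) - cf_point (sparse_digits \<eta> \<tau>)\<bar>"
          unfolding D_def by (intro sparse_point_separation \<eta> sp \<omega> \<tau> i i')
        also have "\<dots> \<le> diameter U"
          using diameter_bounded_bound[OF U(2) \<omega>(2) \<tau>(2)] by (simp add: dist_real_def)
        finally show False using U k' by simp
        qed
        then show "\<omega> \<in> ?B" using \<omega> by blast
      qed
      moreover have "?B \<in> sets M"
        unfolding M_def by (intro cylinder_measure) (use p sp[OF \<tau>(1)] in auto)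
      moreover have "emeasure M ?B \<le> ennreal (1 * r powr (1/40))"
      proof -
        have "emeasure M ?B = ennreal (\<Prod>j\<in>{..k}. p j (\<tau> j))"
          unfolding M_def by (intro cylinder_measure) (use p sp[OF \<tau>(1)] in auto)
        also have "(\<Prod>j\<in>{..k}. p j (\<tau> j)) \<le> r powr (1/40)"
        proof -
          have "(\<Prod>j\<in>{..k}. p j (\<tau> j)) = (\<Prod>j\<in>{..<k}. p j (\<tau> j)) * p k (\<tau> k)"
            by (simp flip: lessThan_Suc_atMost)
          also have "\<dots> \<le> 1 * p k (\<tau> k)"
            by (intro mult_right_mono prod_le_1) (auto simp: p_def)
          also have "\<dots> = D (Suc k) powr (1/40)"
            using root[of "4 ^ k"] by (simp add: p_def D_def)
          also have "\<dots> \<le> r powr (1/40)"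
            using k by (intro powr_mono2) (auto simp: D_def)
          finally show ?thesis .
        qed
        then have "ennreal (\<Prod>j\<in>{..k}. p j (\<tau> j)) \<le> ennreal (1 * r powr (1/40))" by (simp add: ennreal_leI)
        finally show ?thesis .
      qed
      ultimately show ?thesis by blast
    qed
  qed auto
  then show ?thesis by (rule less_le_trans[rotated]) simp
qed

section \<open>The dimension of a Moran fractal\<close>

text \<open>Comparison of volumes.\<close>
lemma packing_bound:
  fixes x :: "'i \<Rightarrow> 'a::euclidean_space"
  assumes "0 < s" "0 \<le> R" and disj: "disjoint_family_on (\<lambda>i. ball (x i) s) F"
    and sub: "\<And>i. i \<in> F \<Longrightarrow> ball (x i) s \<subseteq> cball z R"
  shows "finite F \<and> real (card F) \<le> (R / s) ^ DIM('a)"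
proof -
  have card: "real (card G) \<le> (R / s) ^ DIM('a)" if G: "G \<subseteq> F" "finite G" for G
  proof -
    let ?v = "unit_ball_vol (real DIM('a))"
    have "measure lborel (\<Union>i\<in>G. ball (x i) s) = (\<Sum>i\<in>G. measure lborel (ball (x i) s))"
      using G disj assms(1)
      by (intro measure_finite_Union) (auto intro: disjoint_family_on_mono simp: emeasure_ball)
    also have "\<dots> = real (card G) * (?v * s ^ DIM('a))"
      using assms by (simp add: content_ball)
    finally have "real (card G) * (?v * s ^ DIM('a)) = measure lborel (\<Union>i\<in>G. ball (x i) s)" ..
    also have "\<dots> \<le> measure lborel (cball z R)"
      using G sub assms(2)
      by (intro measure_mono_fmeasurable fmeasurableI) (auto simp: emeasure_cball)
    also have "\<dots> = ?v * R ^ DIM('a)" using assms by (simp add: content_cball)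
    finally have "real (card G) * s ^ DIM('a) * ?v \<le> R ^ DIM('a) * ?v" by (simp add: mult_ac)
    then have "real (card G) * s ^ DIM('a) \<le> R ^ DIM('a)"
      by (simp add: unit_ball_vol_pos)
    then show ?thesis using assms by (simp add: power_divide pos_le_divide_eq)
  qed
  have "card G \<le> nat \<lfloor>(R / s) ^ DIM('a)\<rfloor>" if "G \<subseteq> F" "finite G" for G
    using card[OF that] by (simp add: le_nat_floor)
  then have "finite F" using finite_if_finite_subsets_card_bdd by blast
  then show ?thesis using card[of F] by auto
qed

text \<open>A similarity of a Euclidean space is affine and injective, hence onto; so it maps balls
  onto balls.\<close>
lemma similarity_ratio:
  fixes f :: "'a::euclidean_space \<Rightarrow> 'a"
  assumes "similarity f"
  obtains r where "0 < r" "\<And>S. bounded S \<Longrightarrow> S \<noteq> {} \<Longrightarrow> diameter (f ` S) = r * diameter S"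
    "\<And>x e. f ` ball x e = ball (f x) (r * e)" "\<And>S. continuous_on S f"
proof -
  obtain r where r: "0 < r" "\<And>x y. dist (f x) (f y) = r * dist x y"
    using assms by (auto simp: similarity_def)
  have cont: "continuous_on S f" for S
    unfolding continuous_on_iff
  proof (intro ballI allI impI)
    fix x e :: 'a and \<epsilon> :: real assume "0 < \<epsilon>"
    then show "\<exists>d>0. \<forall>x'\<in>S. dist x' x < d \<longrightarrow> dist (f x') (f x) < \<epsilon>"
      using r by (intro exI[of _ "\<epsilon> / r"]) (auto simp: field_simps)
  qed
  define g where "g x = f x - f 0" for x
  have "linear g"
    by (rule scaling_linear[where c = r]) (auto simp: g_def r dist_norm norm_minus_commute intro: r(2)[unfolded dist_norm])
  moreover have "inj g"
  proof (rule injI)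
    fix x y assume "g x = g y"
    then have "dist (f x) (f y) = 0" by (simp add: g_def)
    then show "x = y" using r by (simp add: r(2))
  qed
  ultimately have "surj g" by (rule linear_inj_imp_surj)
  then have surj: "\<exists>x. y = f x" for y
    unfolding surj_def g_def by (metis add.commute diff_add_cancel)
  have "f ` ball x e = ball (f x) (r * e)" for x e
  proof
    show "f ` ball x e \<subseteq> ball (f x) (r * e)" using r by auto
    show "ball (f x) (r * e) \<subseteq> f ` ball x e"
    proof
      fix y assume "y \<in> ball (f x) (r * e)"
      moreover obtain w where "y = f w" using surj by blast
      ultimately show "y \<in> f ` ball x e" using r by auto
    qed
  qed
  moreover have "diameter (f ` S) = r * diameter S" if S: "bounded S" "S \<noteq> {}" for S
  proof (rule antisym)
    show "diameter (f ` S) \<le> r * diameter S"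
    proof (rule diameter_le)
      fix u v assume "u \<in> f ` S" "v \<in> f ` S"
      then obtain x y where "u = f x" "v = f y" "x \<in> S" "y \<in> S" by auto
      then show "norm (u - v) \<le> r * diameter S"
        using r diameter_bounded_bound[OF S(1), of x y] by (simp flip: dist_norm)
    qed (use S in auto)
    have bdd: "bounded (f ` S)"
    proof -
      obtain a b where "\<And>y. y \<in> S \<Longrightarrow> dist a y \<le> b" using S by (auto simp: bounded_def)
      then show ?thesis unfolding bounded_def
        using r by (intro exI[of _ "f a"] exI[of _ "r * b"]) auto
    qed
    have "diameter S \<le> diameter (f ` S) / r"
    proof (rule diameter_le)
      fix x y assume "x \<in> S" "y \<in> S"
      then show "norm (x - y) \<le> diameter (f ` S) / r"
        using r diameter_bounded_bound[OF bdd, of "f x" "f y"] by (simp add: field_simps flip: dist_norm)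
    qed (use S in auto)
    then show "r * diameter S \<le> diameter (f ` S)" using r by (simp add: field_simps)
  qed
  ultimately show thesis using that[OF r(1)] cont by blast
qed

lemma trunc_Suc: "trunc \<omega> (Suc k) = trunc \<omega> k @ [\<omega> (Suc k)]"
  by (simp add: trunc_def)

lemma trunc_0 [simp]: "trunc \<omega> 0 = []"
  by (simp add: trunc_def)

lemma length_trunc [simp]: "length (trunc \<omega> k) = k"
  by (simp add: trunc_def del: upt_Suc)

lemma trunc_nth: "i \<in> {1..k} \<Longrightarrow> trunc \<omega> k ! (i - 1) = \<omega> i"
  unfolding trunc_def by (subst nth_map_upt) auto

lemma trunc_prefix: "m \<le> k \<Longrightarrow> take m (trunc \<omega> k) = trunc \<omega> m"
  by (simp add: trunc_def take_map del: upt_Suc)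

lemma trunc_words: "(\<And>i. i \<in> {1..k} \<Longrightarrow> 1 \<le> \<omega> i) \<Longrightarrow> trunc \<omega> k \<in> words k"
  by (auto simp: words_def trunc_def)

lemma words_trunc:
  assumes "\<sigma> \<in> words k"
  obtains \<omega> where "\<sigma> = trunc \<omega> k" "\<And>i. i \<in> {1..k} \<Longrightarrow> 1 \<le> \<omega> i"
proof
  show "\<sigma> = trunc (\<lambda>i. \<sigma> ! (i - 1)) k"
    using assms by (intro nth_equalityI) (auto simp: words_def trunc_def simp del: upt_Suc)
  show "1 \<le> \<sigma> ! (i - 1)" if "i \<in> {1..k}" for i
  proof -
    have "\<sigma> ! (i - 1) \<in> set \<sigma>" using assms that by (intro nth_mem) (auto simp: words_def)
    then show ?thesis using assms by (auto simp: words_def)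
  qed
qed

locale moran_fractal =
  fixes J :: "'a::euclidean_space set" and c :: "nat \<Rightarrow> nat \<Rightarrow> real" and K :: "nat list \<Rightarrow> 'a set" and q :: real
  assumes coll: "moran_collection J c K"
    and J: "compact J" "J \<noteq> {}" "J = closure (interior J)" "diameter J = 1"
    and q: "0 < q" "q < 1" "\<And>k j. 1 \<le> k \<Longrightarrow> 1 \<le> j \<Longrightarrow> c k j \<le> q"
begin

lemma K_Nil: "K [] = J" using coll by (simp add: moran_collection_def)

lemma K_similar: "\<sigma> \<in> words k \<Longrightarrow> \<exists>f. similarity f \<and> K \<sigma> = f ` J"
  using coll by (auto simp: moran_collection_def)

lemma K_mono1: "\<sigma> \<in> words k \<Longrightarrow> 1 \<le> j \<Longrightarrow> K (\<sigma> @ [j]) \<subseteq> K \<sigma>"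
  using coll by (auto simp: moran_collection_def)

lemma K_disjoint: "\<sigma> \<in> words k \<Longrightarrow> disjoint_family_on (\<lambda>j. interior (K (\<sigma> @ [j]))) {1..}"
  using coll by (auto simp: moran_collection_def)

lemma K_ratio: "\<sigma> \<in> words k \<Longrightarrow> 1 \<le> j \<Longrightarrow> diameter (K (\<sigma> @ [j])) / diameter (K \<sigma>) = c (Suc k) j"
proof -
  assume "\<sigma> \<in> words k" "1 \<le> j"
  moreover have "\<forall>k\<ge>1. \<forall>\<sigma>\<in>words (k - 1). \<forall>j\<ge>1. diameter (K (\<sigma> @ [j])) / diameter (K \<sigma>) = c k j"
    using coll unfolding moran_collection_def by blast
  from this[rule_format, of "Suc k" \<sigma> j] calculation show ?thesis by simp
qed

lemma K_facts:
  assumes "\<sigma> \<in> words k"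
  shows "0 < diameter (K \<sigma>)" "compact (K \<sigma>)" "K \<sigma> \<noteq> {}"
proof -
  obtain f where f: "similarity f" "K \<sigma> = f ` J" using K_similar[OF assms] by auto
  obtain r where r: "0 < r" "\<And>S. bounded S \<Longrightarrow> S \<noteq> {} \<Longrightarrow> diameter (f ` S) = r * diameter S"
    "\<And>S. continuous_on S f"
    using similarity_ratio[OF f(1)] by metis
  show "0 < diameter (K \<sigma>)" using r J f by (simp add: compact_imp_bounded)
  show "compact (K \<sigma>)" unfolding f(2) by (intro compact_continuous_image r J)
  show "K \<sigma> \<noteq> {}" using f J by simp
qed

lemma words_append: "\<sigma> @ \<tau> \<in> words k \<Longrightarrow> \<sigma> \<in> words (length \<sigma>)"
  by (auto simp: words_def)

lemma K_mono: "\<sigma> @ \<tau> \<in> words k \<Longrightarrow> K (\<sigma> @ \<tau>) \<subseteq> K \<sigma>"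
proof (induction \<tau> arbitrary: k rule: rev_induct)
  case (snoc j \<tau>)
  then have w: "\<sigma> @ \<tau> \<in> words (length (\<sigma> @ \<tau>))" "1 \<le> j" by (auto simp: words_def)
  then have "K ((\<sigma> @ \<tau>) @ [j]) \<subseteq> K (\<sigma> @ \<tau>)" by (rule K_mono1)
  then show ?case using snoc.IH[OF w(1)] by simp
qed simp

lemma diameter_trunc:
  assumes "\<And>i. i \<in> {1..k} \<Longrightarrow> 1 \<le> \<omega> i"
  shows "diameter (K (trunc \<omega> k)) = (\<Prod>i\<in>{1..k}. c i (\<omega> i))"
  using assms
proof (induction k)
  case 0
  then show ?case by (simp add: K_Nil J(4))
next
  case (Suc k)
  have w: "trunc \<omega> k \<in> words k" using Suc.prems by (intro trunc_words) auto
  have "diameter (K (trunc \<omega> (Suc k))) = c (Suc k) (\<omega> (Suc k)) * diameter (K (trunc \<omega> k))"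
    using K_ratio[OF w, of "\<omega> (Suc k)"] K_facts(1)[OF w] Suc.prems by (simp add: trunc_Suc field_simps)
  then show ?case using Suc by simp
qed

lemma c_pos: "1 \<le> k \<Longrightarrow> 1 \<le> j \<Longrightarrow> 0 < c k j"
proof -
  assume k: "1 \<le> k" "1 \<le> j"
  have w: "replicate (k - 1) 1 \<in> words (k - 1)" "replicate (k - 1) 1 @ [j] \<in> words k" using k by (auto simp: words_def)
  have "0 < diameter (K (replicate (k - 1) 1 @ [j])) / diameter (K (replicate (k - 1) 1))"
    using K_facts(1)[OF w(1)] K_facts(1)[OF w(2)] by (rule divide_pos_pos[rotated])
  then show ?thesis using K_ratio[OF w(1) k(2)] k by simp
qed

lemma diameter_trunc_le:
  assumes "\<And>i. i \<in> {1..k} \<Longrightarrow> 1 \<le> \<omega> i"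
  shows "diameter (K (trunc \<omega> k)) \<le> q ^ k"
proof -
  have "(\<Prod>i\<in>{1..k}. c i (\<omega> i)) \<le> (\<Prod>i\<in>{1..k}. q)"
    using assms q c_pos by (intro prod_mono) (auto simp: less_imp_le)
  then show ?thesis by (subst diameter_trunc) (use assms in auto)
qed

text \<open>A piece is a similar image of \<open>J\<close>, and its diameter is the ratio of the similarity because
  \<open>|J| = 1\<close>; so a fixed ball in \<open>J\<close> serves all pieces.\<close>
lemma K_contains_ball:
  "\<exists>\<rho>>0. \<forall>k. \<forall>\<sigma>\<in>words k. \<exists>x. ball x (diameter (K \<sigma>) * \<rho>) \<subseteq> K \<sigma>"
proof -
  have "interior J \<noteq> {}" using J by auto
  then obtain x where "x \<in> interior J" by blast
  then obtain \<rho> where \<rho>: "0 < \<rho>" "ball x \<rho> \<subseteq> J" by (auto simp: mem_interior)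
  have "\<exists>x. ball x (diameter (K \<sigma>) * \<rho>) \<subseteq> K \<sigma>" if \<sigma>: "\<sigma> \<in> words k" for \<sigma> k
  proof -
    obtain f where f: "similarity f" "K \<sigma> = f ` J" using K_similar[OF \<sigma>] by auto
    obtain r where r: "0 < r" "\<And>S. bounded S \<Longrightarrow> S \<noteq> {} \<Longrightarrow> diameter (f ` S) = r * diameter S"
      "\<And>x e. f ` ball x e = ball (f x) (r * e)"
      using similarity_ratio[OF f(1)] by metis
    have "diameter (K \<sigma>) = r" using r J f by (simp add: compact_imp_bounded)
    then have "ball (f x) (diameter (K \<sigma>) * \<rho>) = f ` ball x \<rho>" using r by simp
    also have "\<dots> \<subseteq> K \<sigma>" using f \<rho> by auto
    finally show ?thesis by blast
  qed
  then show ?thesis using \<rho> by blast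
qed

lemma incomparable_disjoint:
  assumes "\<sigma> \<in> words k" "\<tau> \<in> words l" "parallel \<sigma> \<tau>"
  shows "interior (K \<sigma>) \<inter> interior (K \<tau>) = {}"
proof -
  obtain \<pi> i \<sigma>' j \<tau>' where d: "i \<noteq> j" "\<sigma> = \<pi> @ i # \<sigma>'" "\<tau> = \<pi> @ j # \<tau>'"
    using parallel_decomp[OF assms(3)] by blast
  have ij: "1 \<le> i" "1 \<le> j" using assms d by (auto simp: words_def)
  have \<pi>: "\<pi> \<in> words (length \<pi>)" using assms d words_append by blast
  have "K \<sigma> \<subseteq> K (\<pi> @ [i])" "K \<tau> \<subseteq> K (\<pi> @ [j])"
    using K_mono[of "\<pi> @ [i]" \<sigma>' k] K_mono[of "\<pi> @ [j]" \<tau>' l] assms d by auto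
  then have "interior (K \<sigma>) \<subseteq> interior (K (\<pi> @ [i]))" "interior (K \<tau>) \<subseteq> interior (K (\<pi> @ [j]))"
    by (auto intro!: interior_mono)
  moreover have "interior (K (\<pi> @ [i])) \<inter> interior (K (\<pi> @ [j])) = {}"
    using K_disjoint[OF \<pi>] ij d(1) unfolding disjoint_family_on_def by auto
  ultimately show ?thesis by blast
qed

text \<open>The digit \<open>k\<close> of a code gets the value \<open>j\<close> with probability \<open>c\<^sub>k\<^sub>j\<^sup>t\<close> divided by the sum of these
  powers over \<open>A k\<close>, independently of the other digits.  The mass of a cylinder is then
  \<open>|K\<^sub>\<sigma>|\<^sup>t\<close> divided by a product that is at least \<open>b\<close>.  To bound the mass of a set \<open>U\<close> of diameter
  \<open>\<le> r\<close>, each code is cut as soon as its piece has diameter \<open>\<le> r\<close>.  The pieces of the cut words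
  have diameter between \<open>\<delta> r\<close> and \<open>r\<close> and disjoint interiors, so by volume only boundedly many of
  them meet \<open>U\<close>.\<close>
lemma dim_ge:
  fixes A :: "nat \<Rightarrow> nat set" and \<delta> t b :: real
  assumes A: "\<And>k. 1 \<le> k \<Longrightarrow> finite (A k)" "\<And>k. 1 \<le> k \<Longrightarrow> A k \<noteq> {}" "\<And>k. 1 \<le> k \<Longrightarrow> A k \<subseteq> {1..}"
    and \<delta>: "0 < \<delta>" "\<And>k j. 1 \<le> k \<Longrightarrow> j \<in> A k \<Longrightarrow> \<delta> \<le> c k j"
    and t: "0 < t" and b: "0 < b" "\<And>k. b \<le> (\<Prod>i\<in>{1..k}. \<Sum>j\<in>A i. c i j powr t)"
  shows "ennreal t \<le> hausdorff_dim (moran_set K)"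
proof -
  obtain \<rho> where \<rho>: "0 < \<rho>" "\<And>\<sigma> k. \<sigma> \<in> words k \<Longrightarrow> \<exists>x. ball x (diameter (K \<sigma>) * \<rho>) \<subseteq> K \<sigma>"
    using K_contains_ball by blast
  \<comment> \<open>Words are indexed from \<open>1\<close>; position \<open>0\<close> of a code gets a one-point alphabet.\<close>
  define A' where "A' k = (if k = 0 then {1} else A k)" for k
  define W where "W k = (\<Sum>j\<in>A k. c k j powr t)" for k
  define p where "p k j = (if k = 0 then 1 else c k j powr t / W k)" for k j
  define M where "M = PiM UNIV (\<lambda>k. point_measure (A' k) (\<lambda>j. ennreal (p k j)))"
  have cA: "0 < c k j" if "1 \<le> k" "j \<in> A k" for k j
    using that A(3) c_pos by blast
  have W: "0 < W k" if "1 \<le> k" for k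
    unfolding W_def using A(1,2)[OF that] cA[OF that] by (intro sum_pos) (auto simp: less_le)
  have p: "finite (A' k)" "j \<in> A' k \<Longrightarrow> 0 \<le> p k j" "(\<Sum>j\<in>A' k. p k j) = 1" for k j
  proof -
    show "finite (A' k)" using A by (auto simp: A'_def)
    show "j \<in> A' k \<Longrightarrow> 0 \<le> p k j" using W[of k] by (auto simp: p_def)
    show "(\<Sum>j\<in>A' k. p k j) = 1"
    proof (cases "k = 0")
      case False
      then have "(\<Sum>j\<in>A' k. p k j) = W k / W k"
        unfolding W_def sum_divide_distrib by (simp add: A'_def p_def W_def)
      then show ?thesis using W[of k] False by simp
    qed (simp add: A'_def p_def)
  qed
  have prob: "prob_space M"
  proof -
    interpret product_prob_space "\<lambda>k. point_measure (A' k) (\<lambda>j. ennreal (p k j))" UNIV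
      by (rule product_prob_space_point_measure) (use p in auto)
    show ?thesis unfolding M_def by (rule prob_space_axioms)
  qed
  have sp': "\<omega> k \<in> A' k" if "\<omega> \<in> space M" for \<omega> k
    using that by (auto simp: M_def space_PiM space_point_measure)
  have sp: "\<omega> k \<in> A k" if "\<omega> \<in> space M" "1 \<le> k" for \<omega> k
    using sp'[OF that(1), of k] that by (simp add: A'_def split: if_splits)
  have sp1: "1 \<le> \<omega> k" if "\<omega> \<in> space M" "1 \<le> k" for \<omega> k
    using sp[OF that] A(3)[OF that(2)] by auto
  have tw: "trunc \<omega> k \<in> words k" if "\<omega> \<in> space M" for \<omega> k
    using sp1[OF that] by (intro trunc_words) auto
  have "\<exists>x. \<forall>i. x \<in> K (trunc \<omega> i)" if \<omega>: "\<omega> \<in> space M" for \<omega>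
  proof -
    have "\<Inter> (range (\<lambda>i. K (trunc \<omega> i))) \<noteq> {}"
    proof (rule compact_nest)
      show "compact (K (trunc \<omega> n))" "K (trunc \<omega> n) \<noteq> {}" for n using K_facts[OF tw[OF \<omega>]] by auto
      fix m n :: nat assume "m \<le> n"
      then have "trunc \<omega> n = trunc \<omega> m @ drop m (trunc \<omega> n)"
        using trunc_prefix[of m n \<omega>] append_take_drop_id[of m "trunc \<omega> n"] by simp
      then show "K (trunc \<omega> n) \<subseteq> K (trunc \<omega> m)"
        using K_mono[of "trunc \<omega> m" "drop m (trunc \<omega> n)" n] tw[OF \<omega>, of n] by simp
    qed
    then show ?thesis by auto
  qed
  then obtain \<pi> where \<pi>: "\<And>\<omega> i. \<omega> \<in> space M \<Longrightarrow> \<pi> \<omega> \<in> K (trunc \<omega> i)" by metis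
  define N where "N = (2 / (\<rho> * \<delta>)) ^ DIM('a)"
  show ?thesis
  proof (rule mass_distribution[OF prob t, where \<pi> = \<pi> and C = "N / b" and ?r0.0 = 1])
    show "0 \<le> N / b" using \<rho> \<delta> b by (simp add: N_def)
    show "\<pi> \<omega> \<in> moran_set K" if "\<omega> \<in> space M" for \<omega>
      using \<pi>[OF that] sp1[OF that] unfolding moran_set_def inf_words_def by auto
    fix U :: "'a set" and r :: real
    assume U: "U \<noteq> {}" "bounded U" "diameter U \<le> r" "0 < r" "r < 1"
    have exq: "\<exists>k. diameter (K (trunc \<omega> k)) \<le> r" if \<omega>: "\<omega> \<in> space M" for \<omega>
    proof -
      obtain k where "q ^ k < r" using real_arch_pow_inv[OF U(4) q(2)] by auto
      then show ?thesis using diameter_trunc_le[of k \<omega>] sp1[OF \<omega>] by (intro exI[of _ k]) fastforce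
    qed
    define cut where "cut \<omega> = (LEAST k. diameter (K (trunc \<omega> k)) \<le> r)" for \<omega>
    have cut: "diameter (K (trunc \<omega> (cut \<omega>))) \<le> r" if "\<omega> \<in> space M" for \<omega>
      unfolding cut_def by (rule LeastI_ex) (rule exq[OF that])
    have cut_le: "cut \<omega> \<le> k" if "diameter (K (trunc \<omega> k)) \<le> r" for \<omega> k
      unfolding cut_def by (rule Least_le) (rule that)
    have cut_lower: "\<delta> * r \<le> diameter (K (trunc \<omega> (cut \<omega>)))" if \<omega>: "\<omega> \<in> space M" for \<omega>
    proof (cases "cut \<omega>")
      case 0
      then show ?thesis using cut[OF \<omega>] U by (simp add: K_Nil J(4))
    next
      case (Suc m)
      then have "r < diameter (K (trunc \<omega> m))" using cut_le[of \<omega> m] by force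
      moreover have "\<delta> \<le> c (Suc m) (\<omega> (Suc m))" using \<delta> sp[OF \<omega>] by auto
      ultimately have "\<delta> * r \<le> c (Suc m) (\<omega> (Suc m)) * diameter (K (trunc \<omega> m))"
        using \<delta> U by (intro mult_mono) auto
      also have "\<dots> = diameter (K (trunc \<omega> (Suc m)))"
        using sp1[OF \<omega>] by (subst (1 2) diameter_trunc) auto
      finally show ?thesis using Suc by simp
    qed
    let ?E = "{\<omega> \<in> space M. \<pi> \<omega> \<in> U}"
    define V where "V = (\<lambda>\<omega>. trunc \<omega> (cut \<omega>)) ` ?E"
    have VE: "\<exists>\<omega>\<in>?E. w = trunc \<omega> (cut \<omega>)" if "w \<in> V" for w using that by (auto simp: V_def)
    have Vw: "w \<in> words (length w)" "diameter (K w) \<le> r" "\<delta> * r \<le> diameter (K w)" if "w \<in> V" for w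
      using VE[OF that] tw cut cut_lower by auto
    have par: "parallel v w" if vw: "v \<in> V" "w \<in> V" "v \<noteq> w" for v w
    proof -
      have *: "v = w" if vw: "v \<in> V" "w \<in> V" and pre: "prefix v w" for v w
      proof -
        obtain \<tau> where \<tau>: "\<tau> \<in> ?E" "w = trunc \<tau> (cut \<tau>)" using VE vw by blast
        have len: "length v \<le> cut \<tau>" using prefix_length_le[OF pre] \<tau> by simp
        then have "v = trunc \<tau> (length v)"
          using pre \<tau> trunc_prefix[OF len] by (metis append_eq_conv_conj prefixE)
        then have "cut \<tau> \<le> length v" using cut_le[of \<tau> "length v"] Vw(2)[OF vw(1)] by simp
        then show ?thesis using len \<tau> \<open>v = trunc \<tau> (length v)\<close> by simp
      qed
      show ?thesis using *[of v w] *[of w v] vw unfolding parallel_def by auto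
    qed
    obtain z where z: "z \<in> U" using U by blast
    have "\<exists>x. ball x (\<rho> * \<delta> * r) \<subseteq> K w" if w: "w \<in> V" for w
    proof -
      obtain x where x: "ball x (diameter (K w) * \<rho>) \<subseteq> K w" using \<rho>(2) Vw(1)[OF w] by blast
      have "\<rho> * \<delta> * r \<le> diameter (K w) * \<rho>" using Vw(3)[OF w] \<rho> by (simp add: mult_ac)
      then have "ball x (\<rho> * \<delta> * r) \<subseteq> ball x (diameter (K w) * \<rho>)" by (rule subset_ball)
      then show ?thesis using x by blast
    qed
    then obtain x where x: "\<And>w. w \<in> V \<Longrightarrow> ball (x w) (\<rho> * \<delta> * r) \<subseteq> K w" by metis
    have "finite V \<and> real (card V) \<le> (2 * r / (\<rho> * \<delta> * r)) ^ DIM('a)"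
    proof (rule packing_bound[where x = x and z = z])
      show "0 < \<rho> * \<delta> * r" "0 \<le> 2 * r" using \<rho> \<delta> U by auto
      show "disjoint_family_on (\<lambda>i. ball (x i) (\<rho> * \<delta> * r)) V"
        unfolding disjoint_family_on_def
      proof (intro ballI impI)
        fix v w assume vw: "v \<in> V" "w \<in> V" "v \<noteq> w"
        have "ball (x u) (\<rho> * \<delta> * r) \<subseteq> interior (K u)" if "u \<in> V" for u
          using x[OF that] by (intro interior_maximal) auto
        then show "ball (x v) (\<rho> * \<delta> * r) \<inter> ball (x w) (\<rho> * \<delta> * r) = {}"
          using incomparable_disjoint[OF Vw(1)[OF vw(1)] Vw(1)[OF vw(2)] par[OF vw]] vw by blast
      qed
      fix w assume w: "w \<in> V"
      obtain \<omega> where \<omega>: "\<omega> \<in> ?E" "w = trunc \<omega> (cut \<omega>)" using VE[OF w] by blast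
      then have y: "\<pi> \<omega> \<in> U" "\<pi> \<omega> \<in> K w" using \<pi> by auto
      have "K w \<subseteq> cball z (2 * r)"
      proof
        fix u assume "u \<in> K w"
        then have "dist (\<pi> \<omega>) u \<le> diameter (K w)"
          using y K_facts(2)[OF Vw(1)[OF w]] by (intro diameter_bounded_bound compact_imp_bounded)
        moreover have "dist z (\<pi> \<omega>) \<le> diameter U" using y z U by (intro diameter_bounded_bound)
        ultimately have "dist z u \<le> 2 * r"
          using Vw(2)[OF w] U dist_triangle[of z u "\<pi> \<omega>"] by linarith
        then show "u \<in> cball z (2 * r)" by simp
      qed
      then show "ball (x w) (\<rho> * \<delta> * r) \<subseteq> cball z (2 * r)" using x[OF w] by blast
    qed
    moreover have "2 * r / (\<rho> * \<delta> * r) = 2 / (\<rho> * \<delta>)" using U by simp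
    ultimately have V: "finite V" "real (card V) \<le> N" by (auto simp: N_def)
    define Cyl where "Cyl w = {\<omega>\<in>space M. \<forall>k\<in>{1..length w}. \<omega> k = w ! (k - 1)}" for w
    have Cyl: "Cyl w \<in> sets M \<and> emeasure M (Cyl w) \<le> ennreal (r powr t / b)" if w: "w \<in> V" for w
    proof -
      obtain \<omega> where \<omega>: "\<omega> \<in> ?E" "w = trunc \<omega> (cut \<omega>)" using VE[OF w] by blast
      let ?k = "cut \<omega>"
      have nth: "w ! (k - 1) = \<omega> k" if "k \<in> {1..length w}" for k
        using trunc_nth[of k "cut \<omega>" \<omega>] that \<omega> by simp
      have mem: "w ! (k - 1) \<in> A' k" if "k \<in> {1..length w}" for k
        using nth[OF that] sp'[of \<omega> k] \<omega> by simp
      have "emeasure M (Cyl w) = ennreal (\<Prod>k\<in>{1..length w}. p k (w ! (k - 1)))"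
        unfolding Cyl_def M_def by (rule cylinder_measure) (use p mem in auto)
      also have "(\<Prod>k\<in>{1..length w}. p k (w ! (k - 1))) = (\<Prod>k\<in>{1..length w}. c k (\<omega> k) powr t / W k)"
        using nth by (intro prod.cong) (auto simp: p_def)
      also have "\<dots> = (\<Prod>k\<in>{1..?k}. c k (\<omega> k)) powr t / (\<Prod>k\<in>{1..?k}. W k)"
        using \<omega> cA sp by (simp add: prod_dividef prod_powr_distrib less_imp_le)
      also have "\<dots> = diameter (K w) powr t / (\<Prod>k\<in>{1..?k}. W k)"
      proof -
        have "diameter (K w) = (\<Prod>k\<in>{1..?k}. c k (\<omega> k))"
          unfolding \<omega>(2) by (rule diameter_trunc) (use \<omega> sp1 in auto)
        then show ?thesis by simp
      qed
      also have "\<dots> \<le> r powr t / b"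
        using b Vw(2)[OF w] K_facts(1)[OF Vw(1)[OF w]] t unfolding W_def
        by (intro frac_le powr_mono2) auto
      finally have "emeasure M (Cyl w) \<le> ennreal (r powr t / b)" by (simp add: ennreal_leI)
      moreover have "Cyl w \<in> sets M"
        unfolding Cyl_def M_def by (rule cylinder_measure) (use p mem in auto)
      ultimately show ?thesis by simp
    qed
    show "\<exists>B\<in>sets M. ?E \<subseteq> B \<and> emeasure M B \<le> ennreal (N / b * r powr t)"
    proof (intro bexI conjI)
      show "(\<Union>w\<in>V. Cyl w) \<in> sets M" using V Cyl by auto
      show "?E \<subseteq> (\<Union>w\<in>V. Cyl w)"
      proof
        fix \<omega> assume \<omega>: "\<omega> \<in> ?E"
        then have "\<omega> \<in> Cyl (trunc \<omega> (cut \<omega>))"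
          unfolding Cyl_def using trunc_nth[of _ "cut \<omega>" \<omega>] by auto
        then show "\<omega> \<in> (\<Union>w\<in>V. Cyl w)" using \<omega> by (auto simp: V_def)
      qed
      have "emeasure M (\<Union>w\<in>V. Cyl w) \<le> (\<Sum>w\<in>V. emeasure M (Cyl w))"
        using V Cyl by (intro emeasure_subadditive_finite) auto
      also have "\<dots> \<le> (\<Sum>w\<in>V. ennreal (r powr t / b))" using Cyl by (intro sum_mono) auto
      also have "\<dots> = ennreal (real (card V) * (r powr t / b))"
        using b by (simp add: ennreal_of_nat_eq_real_of_nat times_divide_eq_right[symmetric] flip: ennreal_mult del: times_divide_eq_right)
      also have "\<dots> \<le> ennreal (N / b * r powr t)"
      proof (rule ennreal_leI)
        have "real (card V) * (r powr t / b) \<le> N * (r powr t / b)" using V b by (intro mult_right_mono) auto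
        then show "real (card V) * (r powr t / b) \<le> N / b * r powr t" by simp
      qed
      finally show "emeasure M (\<Union>w\<in>V. Cyl w) \<le> ennreal (N / b * r powr t)" .
    qed
  qed auto
qed

lemma words_Suc_bij: "bij_betw (\<lambda>(\<sigma>, j). \<sigma> @ [j]) (words k \<times> {1..}) (words (Suc k))"
  unfolding bij_betw_def
proof
  show "inj_on (\<lambda>(\<sigma>, j). \<sigma> @ [j]) (words k \<times> {1..})" by (auto simp: inj_on_def)
  show "(\<lambda>(\<sigma>, j). \<sigma> @ [j]) ` (words k \<times> {1..}) = words (Suc k)"
  proof (intro equalityI subsetI)
    fix w assume w: "w \<in> words (Suc k)"
    then have "w = butlast w @ [last w]" by (intro append_butlast_last_id[symmetric]) (auto simp: words_def)
    moreover have "butlast w \<in> words k" "last w \<in> {1..}"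
      using w by (auto simp: words_def dest: in_set_butlastD) (metis last_in_set atLeast_iff list.size(3) nat.distinct(1) subsetD One_nat_def)
    ultimately show "w \<in> (\<lambda>(\<sigma>, j). \<sigma> @ [j]) ` (words k \<times> {1..})" by force
  qed (auto simp: words_def)
qed

text \<open>The diameter of a piece is a product over the letters of its word, so the sum over all words
  factorizes.\<close>
lemma sum_words:
  "(\<integral>\<^sup>+\<sigma>. ennreal (diameter (K \<sigma>) powr t) \<partial>count_space (words k))
    = (\<Prod>i\<in>{1..k}. \<integral>\<^sup>+j. ennreal (c i j powr t) \<partial>count_space {1..})"
proof (induction k)
  case 0
  have "words 0 = {[]}" by (auto simp: words_def)
  then show ?case by (simp add: nn_integral_count_space_finite K_Nil J(4))
next
  case (Suc k)
  let ?g = "\<lambda>\<sigma>. ennreal (diameter (K \<sigma>) powr t)"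
  have step: "?g (\<sigma> @ [j]) = ?g \<sigma> * ennreal (c (Suc k) j powr t)" if "\<sigma> \<in> words k" "j \<in> {1..}" for \<sigma> j
  proof -
    have "diameter (K (\<sigma> @ [j])) = diameter (K \<sigma>) * c (Suc k) j"
      using K_ratio[OF that(1), of j] K_facts(1)[OF that(1)] that by (simp add: field_simps)
    then show ?thesis using K_facts(1)[OF that(1)] c_pos[of "Suc k" j] that
      by (simp add: powr_mult ennreal_mult)
  qed
  have "(\<integral>\<^sup>+\<sigma>. ?g \<sigma> \<partial>count_space (words (Suc k))) = (\<integral>\<^sup>+(\<sigma>, j). ?g (\<sigma> @ [j]) \<partial>count_space (words k \<times> {1..}))"
    by (subst nn_integral_bij_count_space[OF words_Suc_bij, symmetric]) (simp add: case_prod_unfold)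
  also have "\<dots> = (\<integral>\<^sup>+(\<sigma>, j). ?g \<sigma> * ennreal (c (Suc k) j powr t) \<partial>count_space (words k \<times> {1..}))"
    by (intro nn_integral_cong) (auto simp: step)
  also have "\<dots> = (\<integral>\<^sup>+x. (case x of (\<sigma>, j) \<Rightarrow> (?g \<sigma> * indicator (words k) \<sigma>) * (ennreal (c (Suc k) j powr t) * indicator {1..} j)) \<partial>count_space UNIV)"
    by (subst nn_integral_count_space_indicator) (auto intro!: nn_integral_cong simp: indicator_def)
  also have "\<dots> = (\<integral>\<^sup>+\<sigma>. \<integral>\<^sup>+j. (?g \<sigma> * indicator (words k) \<sigma>) * (ennreal (c (Suc k) j powr t) * indicator {1..} j) \<partial>count_space UNIV \<partial>count_space UNIV)"
    by (subst nn_integral_fst_count_space[symmetric]) simp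
  also have "\<dots> = (\<integral>\<^sup>+\<sigma>. ?g \<sigma> * indicator (words k) \<sigma> \<partial>count_space UNIV) * (\<integral>\<^sup>+j. ennreal (c (Suc k) j powr t) * indicator {1..} j \<partial>count_space UNIV)"
    by (simp add: nn_integral_cmult nn_integral_multc)
  also have "\<dots> = (\<integral>\<^sup>+\<sigma>. ?g \<sigma> \<partial>count_space (words k)) * (\<integral>\<^sup>+j. ennreal (c (Suc k) j powr t) \<partial>count_space {1..})"
    by (simp add: nn_integral_count_space_indicator)
  finally show ?case using Suc by (simp add: mult.commute)
qed

text \<open>Each level of the construction is a countable cover; \<open>list_decode\<close> enumerates it, with the
  empty set (which contributes \<open>0\<close>) in place of the words of other lengths.\<close>
lemma dim_le:
  fixes t :: real
  assumes t: "0 < t"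
    and small: "\<And>\<epsilon> k0. 0 < \<epsilon> \<Longrightarrow> \<exists>k\<ge>k0. (\<Prod>i\<in>{1..k}. \<integral>\<^sup>+j. ennreal (c i j powr t) \<partial>count_space {1..}) \<le> ennreal \<epsilon>"
  shows "hausdorff_dim (moran_set K) \<le> ennreal t"
proof (rule hausdorff_dim_le)
  fix \<delta> \<epsilon> :: real assume \<delta>: "0 < \<delta>" and \<epsilon>: "0 < \<epsilon>"
  obtain k0 where k0: "q ^ k0 < \<delta>" using real_arch_pow_inv[OF \<delta> q(2)] by auto
  obtain k where k: "Suc k0 \<le> k" "(\<Prod>i\<in>{1..k}. \<integral>\<^sup>+j. ennreal (c i j powr t) \<partial>count_space {1..}) \<le> ennreal \<epsilon>"
    using small[OF \<epsilon>] by blast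
  have qk: "q ^ k \<le> \<delta>"
  proof -
    have "q ^ k \<le> q ^ k0" using k(1) q by (intro power_decreasing) auto
    then show ?thesis using k0 by simp
  qed
  define U where "U n = (if list_decode n \<in> words k then K (list_decode n) else {})" for n
  have "hausdorff_premeasure \<delta> t (moran_set K) \<le> (\<Sum>n. diam_pow t (U n))"
    unfolding hausdorff_premeasure_def
  proof (rule INF_lower, intro CollectI conjI allI)
    show "moran_set K \<subseteq> (\<Union>n. U n)"
    proof
      fix x assume "x \<in> moran_set K"
      then obtain \<sigma> where \<sigma>: "\<sigma> \<in> inf_words" "\<And>i. 1 \<le> i \<Longrightarrow> x \<in> K (trunc \<sigma> i)" by (auto simp: moran_set_def)
      have "trunc \<sigma> k \<in> words k" using \<sigma>(1) by (intro trunc_words) (auto simp: inf_words_def)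
      then have "x \<in> U (list_encode (trunc \<sigma> k))" using \<sigma>(2)[of k] k by (simp add: U_def)
      then show "x \<in> (\<Union>n. U n)" by blast
    qed
    show "bounded (U n)" for n using K_facts(2) by (auto simp: U_def compact_imp_bounded)
    show "diameter (U n) \<le> \<delta>" for n
    proof (cases "list_decode n \<in> words k")
      case True
      obtain \<omega> where \<omega>: "list_decode n = trunc \<omega> k" "\<And>i. i \<in> {1..k} \<Longrightarrow> 1 \<le> \<omega> i"
        using words_trunc[OF True] by blast
      then show ?thesis using diameter_trunc_le[of k \<omega>] qk True by (simp add: U_def)
    qed (use \<delta> in \<open>simp add: U_def\<close>)
  qed
  also have "(\<Sum>n. diam_pow t (U n)) = (\<integral>\<^sup>+n. diam_pow t (U n) \<partial>count_space UNIV)"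
    by (rule nn_integral_count_space_nat[symmetric])
  also have "\<dots> = (\<integral>\<^sup>+n. ennreal (diameter (K (list_decode n)) powr t) * indicator (words k) (list_decode n) \<partial>count_space UNIV)"
    using t K_facts(3) by (intro nn_integral_cong) (auto simp: U_def diam_pow_def)
  also have "\<dots> = (\<integral>\<^sup>+\<sigma>. ennreal (diameter (K \<sigma>) powr t) * indicator (words k) \<sigma> \<partial>count_space UNIV)"
    by (rule nn_integral_bij_count_space[OF bij_list_decode])
  also have "\<dots> = (\<integral>\<^sup>+\<sigma>. ennreal (diameter (K \<sigma>) powr t) \<partial>count_space (words k))"
    by (simp add: nn_integral_count_space_indicator)
  also have "\<dots> \<le> ennreal \<epsilon>" unfolding sum_words by (rule k(2))
  finally show "hausdorff_premeasure \<delta> t (moran_set K) \<le> ennreal \<epsilon>" .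
qed (use t in auto)

end

section \<open>Averages along a digit sequence and the row sums\<close>

text \<open>Since the limit frequencies sum to \<open>1\<close>, no mass escapes to large digits: digits above \<open>K\<close>
  have asymptotic frequency \<open>1 - \<Sum>\<^sub>k\<^sub>\<le>\<^sub>K \<eta>\<^sub>k\<close>, which is small, and \<open>f\<close> is bounded.\<close>
lemma tendsto_digit_average:
  fixes f :: "nat \<Rightarrow> real"
  assumes \<eta>: "stochastic_vec \<eta>" and a: "\<forall>i\<ge>1. 1 \<le> a i" "has_digit_freqs a \<eta>"
    and f: "\<And>k. 1 \<le> k \<Longrightarrow> \<bar>f k\<bar> \<le> B"
  shows "(\<lambda>n. (\<Sum>i=1..n. f (a i)) / real n) \<longlonglongrightarrow> (\<Sum>\<^sub>\<infinity>k\<in>{1..}. \<eta> k * f k)"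
proof (rule LIMSEQ_I)
  fix \<epsilon> :: real assume \<epsilon>: "0 < \<epsilon>"
  let ?s = "\<Sum>\<^sub>\<infinity>k\<in>{1..}. \<eta> k * f k"
  have sub: "{K<..} \<subseteq> {1..}" for K :: nat by auto
  let ?fr = "\<lambda>n k. real (digit_count a n k) / real n"
  have B: "0 \<le> B" using f[of 1] by simp
  obtain K where K: "1 - \<epsilon> / (2 * B + 1) < (\<Sum>k=1..K. \<eta> k)"
    using stochastic_partial_sum[OF \<eta>, of "\<epsilon> / (2 * B + 1)"] \<epsilon> B by auto
  let ?e = "1 - (\<Sum>k=1..K. \<eta> k)"
  have pos: "0 < \<eta> k" if "1 \<le> k" for k using \<eta> that by (simp add: stochastic_vec_def)
  have hs: "(\<eta> has_sum 1) {1..}" using \<eta> by (simp add: stochastic_vec_def)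
  have e: "0 \<le> ?e" using stochastic_partial_sum_le[OF \<eta>] by simp
  have count: "\<bar>(\<Sum>i=1..n. f (a i)) - (\<Sum>k=1..K. real (digit_count a n k) * f k)\<bar>
      \<le> B * (real n - (\<Sum>k=1..K. real (digit_count a n k)))" for n
  proof (induction n)
    case (Suc n)
    let ?y = "a (Suc n)"
    have y: "1 \<le> ?y" using a by auto
    have s1: "(\<Sum>k=1..K. real (digit_count a (Suc n) k) * f k)
        = (\<Sum>k=1..K. real (digit_count a n k) * f k) + (if ?y \<in> {1..K} then f ?y else 0)"
    proof -
      have "(\<Sum>k=1..K. real (digit_count a (Suc n) k) * f k)
          = (\<Sum>k=1..K. real (digit_count a n k) * f k + (if ?y = k then f k else 0))"
        by (intro sum.cong) (auto simp: digit_count_Suc algebra_simps)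
      then show ?thesis by (simp add: sum.distrib)
    qed
    have s2: "(\<Sum>k=1..K. real (digit_count a (Suc n) k))
        = (\<Sum>k=1..K. real (digit_count a n k)) + (if ?y \<in> {1..K} then 1 else 0)"
      using arg_cong[OF sum_digit_count_Suc[where a = a and n = n and K = K], of real] by (simp split: if_splits)
    show ?case
    proof (cases "?y \<in> {1..K}")
      case True
      then show ?thesis using Suc unfolding s1 s2 by (simp add: algebra_simps)
    next
      case False
      then show ?thesis using Suc f[OF y] unfolding s1 s2 by (simp only: if_False) (simp add: algebra_simps)
    qed
  qed simp
  have part1: "\<bar>(\<Sum>i=1..n. f (a i)) / real n - (\<Sum>k=1..K. ?fr n k * f k)\<bar> \<le> B * (1 - (\<Sum>k=1..K. ?fr n k))" if "1 \<le> n" for n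
  proof -
    have "\<bar>(\<Sum>i=1..n. f (a i)) - (\<Sum>k=1..K. real (digit_count a n k) * f k)\<bar> / real n
      \<le> B * (real n - (\<Sum>k=1..K. real (digit_count a n k))) / real n"
      using count[of n] by (rule divide_right_mono) simp
    also have "\<dots> = B * (1 - (\<Sum>k=1..K. real (digit_count a n k)) / real n)"
      using that by (simp add: diff_divide_distrib flip: times_divide_eq_right)
    also have "\<dots> = B * (1 - (\<Sum>k=1..K. ?fr n k))"
      by (simp add: sum_divide_distrib)
    also have "\<bar>(\<Sum>i=1..n. f (a i)) - (\<Sum>k=1..K. real (digit_count a n k) * f k)\<bar> / real n
       = \<bar>(\<Sum>i=1..n. f (a i)) / real n - (\<Sum>k=1..K. ?fr n k * f k)\<bar>"
    proof -
      have "(\<Sum>i=1..n. f (a i)) / real n - (\<Sum>k=1..K. ?fr n k * f k)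
          = ((\<Sum>i=1..n. f (a i)) - (\<Sum>k=1..K. real (digit_count a n k) * f k)) / real n"
        by (simp add: diff_divide_distrib sum_divide_distrib)
      then show ?thesis by simp
    qed
    finally show ?thesis .
  qed
  have summ: "(\<lambda>k. \<eta> k * f k) summable_on {1..}"
  proof -
    have "(\<lambda>k. B * \<eta> k) summable_on {1..}"
      using has_sum_imp_summable[OF hs] by (rule summable_on_cmult_right)
    moreover have "norm (\<eta> k * f k) \<le> B * \<eta> k" if "k \<in> {1..}" for k
      using f[of k] pos[of k] that by (simp add: abs_mult mult.commute)
    ultimately have "(\<lambda>k. norm (\<eta> k * f k)) summable_on {1..}"
      by (rule Infinite_Sum.abs_summable_on_comparison_test')
    then show ?thesis by (rule abs_summable_summable)
  qed
  have part2: "\<bar>?s - (\<Sum>k=1..K. \<eta> k * f k)\<bar> \<le> B * ?e"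
  proof -
    have "?s = infsum (\<lambda>k. \<eta> k * f k) ({1..K} \<union> {K<..})"
      by (rule arg_cong[where f = "infsum (\<lambda>k. \<eta> k * f k)"]) auto
    also have "\<dots> = (\<Sum>k=1..K. \<eta> k * f k) + infsum (\<lambda>k. \<eta> k * f k) {K<..}"
      using summable_on_subset_banach[OF summ sub] by (subst infsum_Un_disjoint) auto
    finally have 1: "?s - (\<Sum>k=1..K. \<eta> k * f k) = infsum (\<lambda>k. \<eta> k * f k) {K<..}" by simp
    have s\<eta>: "\<eta> summable_on {1..}" by (rule has_sum_imp_summable[OF hs])
    have "{1..} = {1..K} \<union> {K<..}" by auto
    then have "1 = infsum \<eta> ({1..K} \<union> {K<..})"
      using infsumI[OF hs] by simp
    also have "\<dots> = (\<Sum>k=1..K. \<eta> k) + infsum \<eta> {K<..}"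
      using summable_on_subset_banach[OF s\<eta> sub] by (subst infsum_Un_disjoint) auto
    finally have 2: "infsum \<eta> {K<..} = ?e" by simp
    have "norm (infsum (\<lambda>k. \<eta> k * f k) {K<..}) \<le> infsum (\<lambda>k. B * \<eta> k) {K<..}"
    proof (rule norm_infsum_le)
      show "((\<lambda>k. \<eta> k * f k) has_sum infsum (\<lambda>k. \<eta> k * f k) {K<..}) {K<..}"
        using summable_on_subset_banach[OF summ sub] by (intro has_sum_infsum) auto
      show "((\<lambda>k. B * \<eta> k) has_sum infsum (\<lambda>k. B * \<eta> k) {K<..}) {K<..}"
        using summable_on_subset_banach[OF s\<eta> sub] by (intro has_sum_infsum summable_on_cmult_right) auto
      show "norm (\<eta> k * f k) \<le> B * \<eta> k" if "k \<in> {K<..}" for k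
        using f[of k] pos[of k] that by (simp add: abs_mult mult.commute)
    qed
    then show ?thesis unfolding 1 by (simp add: infsum_cmult_right' 2)
  qed
  let ?X = "\<lambda>n. B * (1 - (\<Sum>k=1..K. ?fr n k)) + \<bar>(\<Sum>k=1..K. ?fr n k * f k) - (\<Sum>k=1..K. \<eta> k * f k)\<bar> + B * ?e"
  have fr: "(\<lambda>n. ?fr n k) \<longlonglongrightarrow> \<eta> k" if "k \<in> {1..K}" for k
    using a(2) that by (simp add: has_digit_freqs_def)
  have "?X \<longlonglongrightarrow> B * ?e + \<bar>(\<Sum>k=1..K. \<eta> k * f k) - (\<Sum>k=1..K. \<eta> k * f k)\<bar> + B * ?e"
    by (intro tendsto_intros fr)
  moreover have "B * ?e + \<bar>(\<Sum>k=1..K. \<eta> k * f k) - (\<Sum>k=1..K. \<eta> k * f k)\<bar> + B * ?e < \<epsilon>"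
  proof -
    have "?e < \<epsilon> / (2 * B + 1)" using K by linarith
    then have "?e * (2 * B + 1) < \<epsilon>" using B by (simp add: pos_less_divide_eq)
    then show ?thesis using e by (simp add: algebra_simps)
  qed
  ultimately have "\<forall>\<^sub>F n in sequentially. ?X n < \<epsilon>" by (rule order_tendstoD(2))
  then obtain n0 where n0: "\<And>n. n0 \<le> n \<Longrightarrow> ?X n < \<epsilon>" by (auto simp: eventually_sequentially)
  show "\<exists>n0. \<forall>n\<ge>n0. norm ((\<Sum>i=1..n. f (a i)) / real n - ?s) < \<epsilon>"
  proof (intro exI allI impI)
    fix n assume n: "max 1 n0 \<le> n"
    then show "norm ((\<Sum>i=1..n. f (a i)) / real n - ?s) < \<epsilon>"
      using part1[of n] part2 n0[of n] unfolding real_norm_def by linarith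
  qed
qed

definition row_sum :: "(nat \<Rightarrow> nat \<Rightarrow> real) \<Rightarrow> real \<Rightarrow> nat \<Rightarrow> real" where
  "row_sum \<gamma> t i = (\<Sum>\<^sub>\<infinity>j\<in>{1..}. \<gamma> i j powr t)"

definition large_entries :: "(nat \<Rightarrow> nat \<Rightarrow> real) \<Rightarrow> real \<Rightarrow> nat \<Rightarrow> nat set" where
  "large_entries \<gamma> \<delta> i = {j \<in> {1..}. \<delta> \<le> \<gamma> i j}"

locale contraction_rows =
  fixes \<gamma> :: "nat \<Rightarrow> nat \<Rightarrow> real" and q :: real
  assumes pos: "\<And>i j. 1 \<le> i \<Longrightarrow> 1 \<le> j \<Longrightarrow> 0 < \<gamma> i j"
    and le_q: "\<And>i j. 1 \<le> i \<Longrightarrow> 1 \<le> j \<Longrightarrow> \<gamma> i j \<le> q" and q: "0 < q" "q < 1"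
    and rows: "(SUP i\<in>{1..}. \<Sum>\<^sub>\<infinity>j\<in>{1..}. ennreal (\<gamma> i j)) < \<infinity>"
begin

lemma powr_antimono: "1 \<le> i \<Longrightarrow> 1 \<le> j \<Longrightarrow> s \<le> t \<Longrightarrow> \<gamma> i j powr t \<le> \<gamma> i j powr s"
  using pos[of i j] le_q[of i j] q by (intro powr_mono') auto

abbreviation "finite_exponents \<equiv> {t. 0 \<le> t \<and> (SUP i\<in>{1..}. \<Sum>\<^sub>\<infinity>j\<in>{1..}. ennreal (\<gamma> i j powr t)) < \<infinity>}"

lemma one_finite_exponent: "1 \<in> finite_exponents"
proof -
  have "(SUP i\<in>{1..}. \<Sum>\<^sub>\<infinity>j\<in>{1..}. ennreal (\<gamma> i j powr 1)) = (SUP i\<in>{1..}. \<Sum>\<^sub>\<infinity>j\<in>{1..}. ennreal (\<gamma> i j))"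
    using pos by (intro SUP_cong infsum_cong refl) (auto simp: less_imp_le)
  then show ?thesis using rows by simp
qed

lemma theta_nonneg: "0 \<le> theta \<gamma>"
  unfolding theta_def by (rule cInf_greatest) (use one_finite_exponent in blast)+

lemma finite_exponent_below:
  assumes "theta \<gamma> < t"
  obtains s where "s \<in> finite_exponents" "s < t"
proof -
  have "finite_exponents \<noteq> {}" using one_finite_exponent by blast
  then show thesis using cInf_lessD[of finite_exponents t] assms that unfolding theta_def by blast
qed

lemma row_partial_sums_bounded:
  assumes "theta \<gamma> < t"
  obtains M where "0 < M" "\<And>i F. 1 \<le> i \<Longrightarrow> finite F \<Longrightarrow> F \<subseteq> {1..} \<Longrightarrow> (\<Sum>j\<in>F. \<gamma> i j powr t) \<le> M"
proof -
  obtain s where s: "s \<in> finite_exponents" "s < t" using finite_exponent_below[OF assms] .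
  let ?S = "SUP i\<in>{1..}. \<Sum>\<^sub>\<infinity>j\<in>{1..}. ennreal (\<gamma> i j powr s)"
  have "(\<Sum>j\<in>F. \<gamma> i j powr t) \<le> enn2real ?S + 1" if "1 \<le> i" "finite F" "F \<subseteq> {1..}" for i F
  proof -
    have "(\<Sum>j\<in>F. ennreal (\<gamma> i j powr s)) \<le> (\<Sum>\<^sub>\<infinity>j\<in>{1..}. ennreal (\<gamma> i j powr s))"
      using that by (subst nonneg_infsum_complete) (auto intro!: SUP_upper)
    also have "\<dots> \<le> ?S" using that by (intro SUP_upper) auto
    finally have "ennreal (\<Sum>j\<in>F. \<gamma> i j powr s) \<le> ?S" by (simp add: sum_ennreal)
    then have "(\<Sum>j\<in>F. \<gamma> i j powr s) \<le> enn2real ?S"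
      using enn2real_mono[of "ennreal (\<Sum>j\<in>F. \<gamma> i j powr s)" ?S] s by (simp add: sum_nonneg)
    moreover have "(\<Sum>j\<in>F. \<gamma> i j powr t) \<le> (\<Sum>j\<in>F. \<gamma> i j powr s)"
      using that s by (intro sum_mono powr_antimono) auto
    ultimately show ?thesis by simp
  qed
  then show thesis by (intro that[of "enn2real ?S + 1"]) (auto simp: add_nonneg_pos)
qed

lemma row_summable:
  assumes "theta \<gamma> < t" "1 \<le> i"
  shows "(\<lambda>j. \<gamma> i j powr t) summable_on {1..}"
proof -
  obtain M where M: "0 < M" "\<And>i F. 1 \<le> i \<Longrightarrow> finite F \<Longrightarrow> F \<subseteq> {1..} \<Longrightarrow> (\<Sum>j\<in>F. \<gamma> i j powr t) \<le> M"
    using row_partial_sums_bounded[OF assms(1)] by blast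
  show ?thesis by (rule nonneg_bdd_above_summable_on) (auto intro!: bdd_aboveI[of _ M] M assms)
qed

lemma row_sum_ge: "theta \<gamma> < t \<Longrightarrow> 1 \<le> i \<Longrightarrow> finite F \<Longrightarrow> F \<subseteq> {1..} \<Longrightarrow> (\<Sum>j\<in>F. \<gamma> i j powr t) \<le> row_sum \<gamma> t i"
  unfolding row_sum_def by (rule finite_sum_le_infsum[OF row_summable]) auto

lemma row_sum_leI:
  assumes "theta \<gamma> < t" "1 \<le> i" "\<And>F. finite F \<Longrightarrow> F \<subseteq> {1..} \<Longrightarrow> (\<Sum>j\<in>F. \<gamma> i j powr t) \<le> M"
  shows "row_sum \<gamma> t i \<le> M"
  unfolding row_sum_def by (rule infsum_le_finite_sums) (use assms row_summable in auto)

lemma row_sum_pos: "theta \<gamma> < t \<Longrightarrow> 1 \<le> i \<Longrightarrow> 0 < row_sum \<gamma> t i"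
  using row_sum_ge[of t i "{1}"] pos[of i 1] by (auto intro: less_le_trans[rotated])

lemma row_sum_bounded:
  assumes "theta \<gamma> < t"
  obtains M where "0 < M" "\<And>i. 1 \<le> i \<Longrightarrow> row_sum \<gamma> t i \<le> M"
proof -
  obtain M where M: "0 < M" "\<And>i F. 1 \<le> i \<Longrightarrow> finite F \<Longrightarrow> F \<subseteq> {1..} \<Longrightarrow> (\<Sum>j\<in>F. \<gamma> i j powr t) \<le> M"
    using row_partial_sums_bounded[OF assms] by blast
  show thesis by (rule that[OF M(1)], rule row_sum_leI[OF assms]) (use M(2) in auto)
qed

lemma row_sum_shift:
  assumes t: "theta \<gamma> < t" "t \<le> t'" and i: "1 \<le> i"
  shows "row_sum \<gamma> t' i \<le> q powr (t' - t) * row_sum \<gamma> t i"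
proof (rule row_sum_leI)
  fix F :: "nat set" assume F: "finite F" "F \<subseteq> {1..}"
  have "\<gamma> i j powr t' \<le> q powr (t' - t) * \<gamma> i j powr t" if "j \<in> F" for j
  proof -
    have j: "1 \<le> j" using F that by auto
    have "\<gamma> i j powr t' = \<gamma> i j powr (t' - t) * \<gamma> i j powr t" by (simp flip: powr_add)
    also have "\<dots> \<le> q powr (t' - t) * \<gamma> i j powr t"
      using t pos[OF i j] le_q[OF i j] by (intro mult_right_mono powr_mono2) auto
    finally show ?thesis .
  qed
  then have "(\<Sum>j\<in>F. \<gamma> i j powr t') \<le> q powr (t' - t) * (\<Sum>j\<in>F. \<gamma> i j powr t)"
    unfolding sum_distrib_left by (rule sum_mono)
  also have "\<dots> \<le> q powr (t' - t) * row_sum \<gamma> t i"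
    using row_sum_ge[OF t(1) i F] by (intro mult_left_mono) auto
  finally show "(\<Sum>j\<in>F. \<gamma> i j powr t') \<le> q powr (t' - t) * row_sum \<gamma> t i" .
qed (use t i in auto)

lemma row_sum_antimono:
  assumes "theta \<gamma> < t" "t \<le> t'" "1 \<le> i"
  shows "row_sum \<gamma> t' i \<le> row_sum \<gamma> t i"
proof -
  have "q powr (t' - t) * row_sum \<gamma> t i \<le> 1 * row_sum \<gamma> t i"
    using assms q row_sum_pos[OF assms(1,3)] by (intro mult_right_mono powr_le1) auto
  then show ?thesis using row_sum_shift[OF assms] by simp
qed

lemma finite_large_entries:
  assumes \<delta>: "0 < \<delta>" and i: "1 \<le> i"
  shows "finite (large_entries \<gamma> \<delta> i)"
proof -
  define t where "t = theta \<gamma> + 1"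
  have t: "theta \<gamma> < t" "0 < t" using theta_nonneg by (auto simp: t_def)
  obtain M where M: "0 < M" "\<And>i F. 1 \<le> i \<Longrightarrow> finite F \<Longrightarrow> F \<subseteq> {1..} \<Longrightarrow> (\<Sum>j\<in>F. \<gamma> i j powr t) \<le> M"
    using row_partial_sums_bounded[OF t(1)] by blast
  have "card G \<le> nat \<lfloor>M / \<delta> powr t\<rfloor>" if G: "G \<subseteq> large_entries \<gamma> \<delta> i" "finite G" for G
  proof -
    have "(\<Sum>j\<in>G. \<delta> powr t) \<le> (\<Sum>j\<in>G. \<gamma> i j powr t)"
      using G \<delta> t by (intro sum_mono powr_mono2) (auto simp: large_entries_def)
    also have "\<dots> \<le> M" using G i by (intro M) (auto simp: large_entries_def)
    finally have "real (card G) \<le> M / \<delta> powr t" using \<delta> by (simp add: field_simps)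
    then show ?thesis by (simp add: le_nat_floor)
  qed
  then show ?thesis using finite_if_finite_subsets_card_bdd by blast
qed

text \<open>For an intermediate exponent \<open>\<theta> < s < t\<close>, entries below \<open>\<delta>\<close> satisfy
  \<open>\<gamma>\<^sub>i\<^sub>j\<^sup>t \<le> \<delta>\<^sup>t\<^sup>-\<^sup>s \<gamma>\<^sub>i\<^sub>j\<^sup>s\<close>, and the sums of the \<open>s\<close>-th powers are bounded in \<open>i\<close>.\<close>
lemma large_entries_sum:
  assumes t: "theta \<gamma> < t" and \<epsilon>: "0 < \<epsilon>"
  obtains \<delta> where "0 < \<delta>" "\<And>i. 1 \<le> i \<Longrightarrow> row_sum \<gamma> t i - \<epsilon> \<le> (\<Sum>j\<in>large_entries \<gamma> \<delta> i. \<gamma> i j powr t)"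
proof -
  define s where "s = (theta \<gamma> + t) / 2"
  have s: "theta \<gamma> < s" "s < t" using t by (auto simp: s_def)
  obtain M where M: "0 < M" "\<And>i F. 1 \<le> i \<Longrightarrow> finite F \<Longrightarrow> F \<subseteq> {1..} \<Longrightarrow> (\<Sum>j\<in>F. \<gamma> i j powr s) \<le> M"
    using row_partial_sums_bounded[OF s(1)] by blast
  define \<delta> where "\<delta> = (\<epsilon> / M) powr (1 / (t - s))"
  have \<delta>: "0 < \<delta>" "\<delta> powr (t - s) = \<epsilon> / M" using M \<epsilon> s by (auto simp: \<delta>_def powr_powr)
  have "row_sum \<gamma> t i - \<epsilon> \<le> (\<Sum>j\<in>large_entries \<gamma> \<delta> i. \<gamma> i j powr t)" if i: "1 \<le> i" for i
  proof -
    let ?A = "large_entries \<gamma> \<delta> i"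
    have "row_sum \<gamma> t i \<le> (\<Sum>j\<in>?A. \<gamma> i j powr t) + \<epsilon>"
    proof (rule row_sum_leI[OF t i])
      fix F :: "nat set" assume F: "finite F" "F \<subseteq> {1..}"
      have "(\<Sum>j\<in>F - ?A. \<gamma> i j powr t) \<le> (\<Sum>j\<in>F - ?A. \<epsilon> / M * \<gamma> i j powr s)"
      proof (rule sum_mono)
        fix j assume "j \<in> F - ?A"
        then have j: "1 \<le> j" "\<gamma> i j < \<delta>" using F by (auto simp: large_entries_def)
        have "\<gamma> i j powr t = \<gamma> i j powr (t - s) * \<gamma> i j powr s" by (simp flip: powr_add)
        also have "\<dots> \<le> \<delta> powr (t - s) * \<gamma> i j powr s"
          using j pos[OF i j(1)] s by (intro mult_right_mono powr_mono2) auto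
        finally show "\<gamma> i j powr t \<le> \<epsilon> / M * \<gamma> i j powr s" by (simp add: \<delta>)
      qed
      also have "\<dots> \<le> \<epsilon> / M * M"
        unfolding sum_distrib_left[symmetric] using F i M \<epsilon> by (intro mult_left_mono M) auto
      also have "\<dots> = \<epsilon>" using M by simp
      finally have "(\<Sum>j\<in>F - ?A. \<gamma> i j powr t) \<le> \<epsilon>" .
      moreover have "(\<Sum>j\<in>F \<inter> ?A. \<gamma> i j powr t) \<le> (\<Sum>j\<in>?A. \<gamma> i j powr t)"
        using finite_large_entries[OF \<delta>(1) i] by (intro sum_mono2) auto
      moreover have "(\<Sum>j\<in>F. \<gamma> i j powr t) = (\<Sum>j\<in>F \<inter> ?A. \<gamma> i j powr t) + (\<Sum>j\<in>F - ?A. \<gamma> i j powr t)"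
        using F by (subst sum.Int_Diff[of F _ ?A]) auto
      ultimately show "(\<Sum>j\<in>F. \<gamma> i j powr t) \<le> (\<Sum>j\<in>?A. \<gamma> i j powr t) + \<epsilon>" by simp
    qed
    then show ?thesis by simp
  qed
  then show thesis using that \<delta>(1) by blast
qed

end

section \<open>The standing assumption and the pressure\<close>

lemma entropy_subadditive:
  fixes a b :: real
  assumes "0 < a" "0 \<le> b" "a + b \<le> 1"
  shows "- ((a + b) * ln (a + b)) \<le> - (a * ln a) - b * ln b"
proof -
  have "a * ln a \<le> a * ln (a + b)" using assms by (intro mult_left_mono) auto
  moreover have "b * ln b \<le> b * ln (a + b)"
    using assms by (cases "b = 0") (auto intro!: mult_left_mono)
  ultimately show ?thesis by (simp add: algebra_simps)
qed

lemma dyadic_entropy_summable: "(\<lambda>n. - ((1/2) ^ n * ln ((1/2::real) ^ n))) summable_on UNIV"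
proof -
  have "(\<lambda>n. real (Suc n) * (1/2) ^ n) sums (1 / (1 - 1/2)\<^sup>2)"
    using geometric_deriv_sums[of "1/2 :: real"] by simp
  then have "summable (\<lambda>n. real (Suc n) * (1/2) ^ n)" by (rule sums_summable)
  then have "summable (\<lambda>n. ln 2 * (real n * (1/2) ^ n))"
    by (intro summable_mult, elim summable_comparison_test'[where N = 0]) (auto intro: mult_right_mono)
  moreover have "(\<lambda>n. - ((1/2) ^ n * ln ((1/2::real) ^ n))) = (\<lambda>n. ln 2 * (real n * (1/2) ^ n))"
    by (auto simp: ln_realpow ln_div)
  ultimately show ?thesis
    by (simp add: summable_on_UNIV_nonneg_real_iff)
qed

text \<open>Half of the mass is spread geometrically over all indices, which makes every entry positive;
  the other half gives mass \<open>2\<^sup>-\<^sup>n\<^sup>-\<^sup>2\<close> to the prescribed index \<open>f n\<close>.  The entropy is finite since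
  \<open>x \<mapsto> -x log x\<close> is subadditive and the dyadic entropy series converges.\<close>
lemma gliding_hump_vector:
  fixes f :: "nat \<Rightarrow> nat"
  assumes f: "strict_mono f" "1 \<le> f 0"
  obtains \<eta> where "stochastic_vec \<eta>" "finite_entropy \<eta>" "\<And>n. (1/2) ^ (n + 2) \<le> \<eta> (f n)"
proof -
  have f1: "1 \<le> f n" for n using f strict_mono_less_eq[OF f(1), of 0 n] by (meson le0 order_trans)
  have inj: "inj f" using f(1) by (rule strict_mono_imp_inj_on)
  define w where "w i = (if i \<in> range f then (1/2::real) ^ (inv f i + 2) else 0)" for i
  define \<eta> where "\<eta> i = (1/2) ^ (i + 1) + w i" for i :: nat
  have wf: "w (f n) = (1/2) ^ (n + 2)" for n by (simp add: w_def inv_f_f[OF inj])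
  have w0: "0 \<le> w i" for i by (simp add: w_def)
  have half: "((\<lambda>n. (1/2::real) ^ (n + 2)) has_sum (1/2)) UNIV"
  proof (rule sums_nonneg_imp_has_sum)
    show "(\<lambda>n. (1/2::real) ^ (n + 2)) sums (1/2)"
      using sums_mult[OF power_half_series, of "1/2"] by simp
  qed auto
  have "(w has_sum (1/2)) (range f)"
    using half by (subst has_sum_reindex[OF inj]) (simp add: comp_def wf)
  then have W: "(w has_sum (1/2)) {1..}"
    by (rule has_sum_cong_neutral[THEN iffD1, rotated -1]) (use f1 in \<open>auto simp: w_def\<close>)
  have Suc_range: "{1..} = Suc ` UNIV" by (auto simp: image_def) (metis Suc_le_D)
  have G: "((\<lambda>i. (1/2::real) ^ (i + 1)) has_sum (1/2)) {1..}"
    using half unfolding Suc_range by (subst has_sum_reindex) (auto simp: comp_def)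
  have sum1: "(\<eta> has_sum 1) {1..}"
    using has_sum_add[OF G W] by (simp add: \<eta>_def[abs_def])
  have pos: "0 < \<eta> i" for i using w0[of i] by (simp add: \<eta>_def add_pos_nonneg)
  have stoch: "stochastic_vec \<eta>" using sum1 pos by (simp add: stochastic_vec_def)
  have le1: "\<eta> i \<le> 1" if "1 \<le> i" for i
    using finite_sum_le_has_sum[OF sum1, of "{i}"] that pos by (auto simp: less_imp_le)
  let ?h = "\<lambda>x::real. - (x * ln x)"
  have ent: "(\<lambda>i. ?h (\<eta> i)) summable_on {1..}"
  proof (rule summable_on_comparison_test)
    show "(\<lambda>i. ?h ((1/2) ^ (i + 1)) + ?h (w i)) summable_on {1..}"
    proof (rule summable_on_add)
      have shift: "(\<lambda>n. ?h ((1/2) ^ (n + k))) summable_on UNIV" for k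
      proof -
        have "(\<lambda>n. ?h ((1/2) ^ n)) summable_on range (\<lambda>n. n + k)"
          by (rule summable_on_subset_banach[OF dyadic_entropy_summable]) auto
        then show ?thesis by (subst (asm) summable_on_reindex) (auto simp: comp_def)
      qed
      show "(\<lambda>i. ?h ((1/2) ^ (i + 1))) summable_on {1..}"
        by (rule summable_on_subset_banach[OF shift]) auto
      have "(\<lambda>i. ?h (w i)) summable_on range f"
        using shift[of 2] by (subst summable_on_reindex[OF inj]) (simp add: comp_def wf)
      then show "(\<lambda>i. ?h (w i)) summable_on {1..}"
        by (rule summable_on_cong_neutral[THEN iffD1, rotated -1]) (use f1 in \<open>auto simp: w_def\<close>)
    qed
    fix i :: nat assume "i \<in> {1..}"
    then have i: "1 \<le> i" by simp
    show "?h (\<eta> i) \<le> ?h ((1/2) ^ (i + 1)) + ?h (w i)"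
      using entropy_subadditive[of "(1/2) ^ (i + 1)" "w i"] w0[of i] le1[OF i] by (simp add: \<eta>_def)
    show "0 \<le> ?h (\<eta> i)" using pos[of i] le1[OF i] by (simp add: mult_nonneg_nonpos)
  qed
  have "finite_entropy \<eta>"
    unfolding finite_entropy_def using ent by (simp add: summable_on_uminus)
  moreover have "(1/2) ^ (n + 2) \<le> \<eta> (f n)" for n by (simp add: \<eta>_def wf)
  ultimately show thesis using that stoch by blast
qed

context contraction_rows
begin

text \<open>A gliding hump.  If no exponent above \<open>\<theta>\<close> had row sums bounded away from \<open>0\<close>, there would be
  rows \<open>f n\<close> with logarithm of the row sum below \<open>-4\<^sup>n\<close> at exponents \<open>u n\<close> decreasing to \<open>\<theta>\<close>.  With
  weight at least \<open>2\<^sup>-\<^sup>n\<^sup>-\<^sup>2\<close> on row \<open>f n\<close>, the terms of the pressure series do not tend to \<open>0\<close> at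
  any exponent above \<open>\<theta>\<close>.\<close>
lemma row_sum_lower_somewhere:
  assumes standing: "\<forall>\<eta>. stochastic_vec \<eta> \<and> finite_entropy \<eta> \<longrightarrow> pressure_assumption \<gamma> \<eta>"
  shows "\<exists>u>theta \<gamma>. \<exists>L>0. \<forall>i\<ge>1. L \<le> row_sum \<gamma> u i"
proof (rule ccontr)
  assume "\<not> ?thesis"
  then have no: "\<exists>i\<ge>1. row_sum \<gamma> u i < L" if "theta \<gamma> < u" "0 < L" for u L
    using that by (meson not_le)
  define u where "u n = theta \<gamma> + 1 / real (Suc n)" for n
  have u: "theta \<gamma> < u n" for n by (simp add: u_def)
  have far: "\<exists>i>N. row_sum \<gamma> (u n) i < exp (- (4 ^ n))" for n N
  proof -
    \<comment> \<open>A row sum below those of the first \<open>N\<close> rows belongs to a row beyond \<open>N\<close>.\<close>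
    let ?L = "Min (insert (exp (- (4 ^ n))) (row_sum \<gamma> (u n) ` {1..N}))"
    have "0 < ?L" using row_sum_pos[OF u] by (subst Min_gr_iff) auto
    then obtain i where i: "1 \<le> i" "row_sum \<gamma> (u n) i < ?L" using no[OF u] by blast
    then have lt: "row_sum \<gamma> (u n) i < exp (- (4 ^ n))" "\<And>j. j \<in> {1..N} \<Longrightarrow> row_sum \<gamma> (u n) i < row_sum \<gamma> (u n) j"
      by (subst (asm) Min_gr_iff; auto)+
    have "i \<notin> {1..N}" using lt(2)[of i] by blast
    then show ?thesis using lt(1) i(1) by (intro exI[of _ i]) auto
  qed
  have "\<exists>f. \<forall>n. (1 \<le> f n \<and> row_sum \<gamma> (u n) (f n) < exp (- (4 ^ n))) \<and> f n < f (Suc n)"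
  proof (rule dependent_nat_choice)
    show "\<exists>i. 1 \<le> i \<and> row_sum \<gamma> (u 0) i < exp (- (4 ^ 0))" using far[of 0 0] by (auto simp: Suc_le_eq)
    show "\<exists>j. (1 \<le> j \<and> row_sum \<gamma> (u (Suc n)) j < exp (- (4 ^ Suc n))) \<and> i < j" for i n
    proof -
      obtain j where "i < j" "row_sum \<gamma> (u (Suc n)) j < exp (- (4 ^ Suc n))"
        using far[where N = i and n = "Suc n"] by blast
      then show ?thesis by (intro exI[of _ j]) simp
    qed
  qed
  then obtain f where f: "\<And>n. 1 \<le> f n" "\<And>n. row_sum \<gamma> (u n) (f n) < exp (- (4 ^ n))" "\<And>n. f n < f (Suc n)" by blast
  have mono: "strict_mono f" using f(3) by (simp add: strict_mono_Suc_iff)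
  obtain \<eta> where \<eta>: "stochastic_vec \<eta>" "finite_entropy \<eta>" "\<And>n. (1/2) ^ (n + 2) \<le> \<eta> (f n)"
    using gliding_hump_vector[OF mono f(1)] by blast
  then obtain v where v: "theta \<gamma> < v" "pressure_term \<gamma> \<eta> v summable_on {1..}"
    using standing by (auto simp: pressure_assumption_def)
  have "(pressure_term \<gamma> \<eta> v) summable_on range f"
    by (rule summable_on_subset_banach[OF v(2)]) (use f(1) in auto)
  then have "(pressure_term \<gamma> \<eta> v \<circ> f) summable_on UNIV"
    by (subst (asm) summable_on_reindex) (auto intro: strict_mono_imp_inj_on mono)
  then have "summable (\<lambda>n. pressure_term \<gamma> \<eta> v (f n))"
    using summable_on_imp_summable by (force simp: comp_def)
  then have "(\<lambda>n. pressure_term \<gamma> \<eta> v (f n)) \<longlonglongrightarrow> 0" by (rule summable_LIMSEQ_zero)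
  then have "\<forall>\<^sub>F n in sequentially. - (1/4) < pressure_term \<gamma> \<eta> v (f n)"
    by (rule order_tendstoD) simp
  moreover have "\<forall>\<^sub>F n in sequentially. 1 / real (Suc n) < v - theta \<gamma>"
    using v(1) by (intro order_tendstoD(2)[OF LIMSEQ_Suc[OF lim_1_over_n]]) auto
  ultimately have "\<forall>\<^sub>F n in sequentially. False"
  proof eventually_elim
    case (elim n)
    have "row_sum \<gamma> v (f n) \<le> row_sum \<gamma> (u n) (f n)"
      using elim f(1) by (intro row_sum_antimono u) (auto simp: u_def)
    then have "row_sum \<gamma> v (f n) < exp (- (4 ^ n))" using f(2)[of n] by linarith
    then have "ln (row_sum \<gamma> v (f n)) < ln (exp (- (4 ^ n)))"
      using row_sum_pos[OF v(1) f(1)] by (subst ln_less_cancel_iff) auto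
    then have "ln (row_sum \<gamma> v (f n)) < - (4 ^ n)" by simp
    moreover have "(2::real) ^ n \<le> 4 ^ n" by (rule power_mono) auto
    ultimately have l: "2 ^ n \<le> - ln (row_sum \<gamma> v (f n))" by linarith
    have "1 / 4 = (1/2) ^ (n + 2) * (2::real) ^ n" by (simp add: power_add power_one_over)
    also have "\<dots> \<le> \<eta> (f n) * - ln (row_sum \<gamma> v (f n))"
      using \<eta>(3)[of n] l order_trans[OF _ \<eta>(3)[of n], of 0] by (intro mult_mono) simp_all
    also have "\<dots> = - pressure_term \<gamma> \<eta> v (f n)" by (simp add: pressure_term_def row_sum_def)
    finally show False using elim by simp
  qed
  then show False by simp
qed

text \<open>For exponents up to \<open>u\<close> this is monotonicity.  For larger ones, the entries \<open>\<ge> \<delta>\<close> carry half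
  of the bound at exponent \<open>u\<close>, and raising the exponent by \<open>v - u\<close> costs them at most the factor
  \<open>\<delta>\<^sup>v\<^sup>-\<^sup>u\<close>.\<close>
lemma row_sum_lower:
  assumes standing: "\<forall>\<eta>. stochastic_vec \<eta> \<and> finite_entropy \<eta> \<longrightarrow> pressure_assumption \<gamma> \<eta>"
    and t: "theta \<gamma> < t"
  obtains L where "0 < L" "\<And>i. 1 \<le> i \<Longrightarrow> L \<le> row_sum \<gamma> t i"
proof -
  obtain u L where u: "theta \<gamma> < u" "0 < L" "\<And>i. 1 \<le> i \<Longrightarrow> L \<le> row_sum \<gamma> u i"
    using row_sum_lower_somewhere[OF standing] by blast
  define v where "v = max t u"
  have v: "theta \<gamma> < v" "t \<le> v" "u \<le> v" using t by (auto simp: v_def)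
  obtain \<delta> where \<delta>: "0 < \<delta>" "\<And>i. 1 \<le> i \<Longrightarrow> row_sum \<gamma> u i - L / 2 \<le> (\<Sum>j\<in>large_entries \<gamma> \<delta> i. \<gamma> i j powr u)"
    using large_entries_sum[OF u(1), of "L / 2"] u(2) by auto
  have "\<delta> powr (v - u) * (L / 2) \<le> row_sum \<gamma> t i" if i: "1 \<le> i" for i
  proof -
    let ?A = "large_entries \<gamma> \<delta> i"
    have "\<delta> powr (v - u) * (L / 2) \<le> \<delta> powr (v - u) * (\<Sum>j\<in>?A. \<gamma> i j powr u)"
      using \<delta>(2)[OF i] u(3)[OF i] by (intro mult_left_mono) auto
    also have "\<dots> \<le> (\<Sum>j\<in>?A. \<gamma> i j powr v)"
      unfolding sum_distrib_left
    proof (rule sum_mono)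
      fix j assume "j \<in> ?A"
      then have "\<delta> powr (v - u) * \<gamma> i j powr u \<le> \<gamma> i j powr (v - u) * \<gamma> i j powr u"
        using \<delta>(1) v by (intro mult_right_mono powr_mono2) (auto simp: large_entries_def)
      then show "\<delta> powr (v - u) * \<gamma> i j powr u \<le> \<gamma> i j powr v" by (simp flip: powr_add)
    qed
    also have "\<dots> \<le> row_sum \<gamma> v i"
      using finite_large_entries[OF \<delta>(1) i] by (intro row_sum_ge v i) (auto simp: large_entries_def)
    also have "\<dots> \<le> row_sum \<gamma> t i" by (intro row_sum_antimono t v i)
    finally show ?thesis .
  qed
  then show thesis using that[of "\<delta> powr (v - u) * (L / 2)"] \<delta>(1) u(2) by auto
qed

lemma ln_row_sum_bounded:
  assumes standing: "\<forall>\<eta>. stochastic_vec \<eta> \<and> finite_entropy \<eta> \<longrightarrow> pressure_assumption \<gamma> \<eta>"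
    and t: "theta \<gamma> < t"
  obtains B where "\<And>i. 1 \<le> i \<Longrightarrow> \<bar>ln (row_sum \<gamma> t i)\<bar> \<le> B"
proof -
  obtain L where L: "0 < L" "\<And>i. 1 \<le> i \<Longrightarrow> L \<le> row_sum \<gamma> t i" using row_sum_lower[OF assms] by blast
  obtain M where M: "0 < M" "\<And>i. 1 \<le> i \<Longrightarrow> row_sum \<gamma> t i \<le> M" using row_sum_bounded[OF t] by blast
  have "\<bar>ln (row_sum \<gamma> t i)\<bar> \<le> \<bar>ln L\<bar> + \<bar>ln M\<bar>" if "1 \<le> i" for i
  proof -
    have "ln L \<le> ln (row_sum \<gamma> t i)" "ln (row_sum \<gamma> t i) \<le> ln M"
      using L(1) L(2)[OF that] M(2)[OF that] row_sum_pos[OF t that] M(1) by auto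
    then show ?thesis by linarith
  qed
  then show thesis using that by blast
qed

text \<open>The row sums are bounded away from \<open>0\<close>, so a small absolute error is a small relative error.\<close>
lemma large_entries_ratio:
  assumes standing: "\<forall>\<eta>. stochastic_vec \<eta> \<and> finite_entropy \<eta> \<longrightarrow> pressure_assumption \<gamma> \<eta>"
    and t: "theta \<gamma> < t" and \<epsilon>: "0 < \<epsilon>"
  obtains \<delta> where "0 < \<delta>"
    "\<And>i. 1 \<le> i \<Longrightarrow> exp (- \<epsilon>) * row_sum \<gamma> t i \<le> (\<Sum>j\<in>large_entries \<gamma> \<delta> i. \<gamma> i j powr t)"
proof -
  obtain L where L: "0 < L" "\<And>i. 1 \<le> i \<Longrightarrow> L \<le> row_sum \<gamma> t i"
    using row_sum_lower[OF standing t] by blast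
  have e: "0 < (1 - exp (- \<epsilon>)) * L" using \<epsilon> L by simp
  obtain \<delta> where \<delta>: "0 < \<delta>"
    "\<And>i. 1 \<le> i \<Longrightarrow> row_sum \<gamma> t i - (1 - exp (- \<epsilon>)) * L \<le> (\<Sum>j\<in>large_entries \<gamma> \<delta> i. \<gamma> i j powr t)"
    using large_entries_sum[OF t e] by blast
  have "exp (- \<epsilon>) * row_sum \<gamma> t i \<le> (\<Sum>j\<in>large_entries \<gamma> \<delta> i. \<gamma> i j powr t)" if i: "1 \<le> i" for i
  proof -
    have "(1 - exp (- \<epsilon>)) * L \<le> (1 - exp (- \<epsilon>)) * row_sum \<gamma> t i"
      using L(2)[OF i] \<epsilon> by (intro mult_left_mono) auto
    then show ?thesis using \<delta>(2)[OF i] by (simp add: algebra_simps)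
  qed
  then show thesis using that \<delta>(1) by blast
qed

text \<open>The boundedness of \<open>log S\<^sub>i(t)\<close> in \<open>i\<close> is what allows the passage from frequencies to means.\<close>
lemma pressure_average:
  assumes standing: "\<forall>\<eta>. stochastic_vec \<eta> \<and> finite_entropy \<eta> \<longrightarrow> pressure_assumption \<gamma> \<eta>"
    and t: "theta \<gamma> < t" and \<eta>: "stochastic_vec \<eta>" and x: "x \<in> freq_set \<eta>"
  shows "(\<lambda>n. (\<Sum>i=1..n. ln (row_sum \<gamma> t (cf_digit i x))) / real n) \<longlonglongrightarrow> pressure \<gamma> \<eta> t"
proof -
  obtain B where B: "\<And>i. 1 \<le> i \<Longrightarrow> \<bar>ln (row_sum \<gamma> t i)\<bar> \<le> B" using ln_row_sum_bounded[OF standing t] by blast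
  have "has_digit_freqs (\<lambda>i. cf_digit i x) \<eta>" "\<forall>i\<ge>1. 1 \<le> cf_digit i x"
    using x cf_digit_ge1 by (auto simp: freq_set_def has_digit_freqs_def digit_count_def)
  from tendsto_digit_average[OF \<eta> this(2,1) B] show ?thesis
    by (simp add: pressure_def pressure_term_def[abs_def] row_sum_def)
qed

text \<open>All entries are at most \<open>q < 1\<close>, so each factor loses at least \<open>(t' - t) \<bar>log q\<bar>\<close> on the
  logarithmic scale.\<close>
lemma pressure_decreasing:
  assumes standing: "\<forall>\<eta>. stochastic_vec \<eta> \<and> finite_entropy \<eta> \<longrightarrow> pressure_assumption \<gamma> \<eta>"
    and t: "theta \<gamma> < t" "t < t'" and \<eta>: "stochastic_vec \<eta>" and x: "x \<in> freq_set \<eta>"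
  shows "pressure \<gamma> \<eta> t' < pressure \<gamma> \<eta> t"
proof -
  let ?F = "\<lambda>t n. (\<Sum>i=1..n. ln (row_sum \<gamma> t (cf_digit i x))) / real n"
  have t': "theta \<gamma> < t'" using t by simp
  have d: "1 \<le> cf_digit i x" for i using x cf_digit_ge1 by (auto simp: freq_set_def)
  have shift: "ln (row_sum \<gamma> t' i) \<le> (t' - t) * ln q + ln (row_sum \<gamma> t i)" if i: "1 \<le> i" for i
  proof -
    have "ln (row_sum \<gamma> t' i) \<le> ln (q powr (t' - t) * row_sum \<gamma> t i)"
      using row_sum_shift[OF t(1) less_imp_le[OF t(2)] i] row_sum_pos[OF t' i]
      by (subst ln_le_cancel_iff) auto
    also have "\<dots> = (t' - t) * ln q + ln (row_sum \<gamma> t i)"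
      using q row_sum_pos[OF t(1) i] by (simp add: ln_mult ln_powr)
    finally show ?thesis .
  qed
  have "?F t' n \<le> (t' - t) * ln q + ?F t n" if "1 \<le> n" for n
  proof -
    have "(\<Sum>i=1..n. ln (row_sum \<gamma> t' (cf_digit i x))) \<le> (\<Sum>i=1..n. (t' - t) * ln q + ln (row_sum \<gamma> t (cf_digit i x)))"
      by (intro sum_mono shift d)
    also have "\<dots> = real n * ((t' - t) * ln q) + (\<Sum>i=1..n. ln (row_sum \<gamma> t (cf_digit i x)))"
      by (simp add: sum.distrib)
    finally have "?F t' n \<le> (real n * ((t' - t) * ln q) + (\<Sum>i=1..n. ln (row_sum \<gamma> t (cf_digit i x)))) / real n"
      by (rule divide_right_mono) simp
    then show ?thesis using that by (simp add: add_divide_distrib)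
  qed
  moreover have "(\<lambda>n. (t' - t) * ln q + ?F t n) \<longlonglongrightarrow> (t' - t) * ln q + pressure \<gamma> \<eta> t"
    by (intro tendsto_intros pressure_average[OF standing t(1) \<eta> x])
  ultimately have "pressure \<gamma> \<eta> t' \<le> (t' - t) * ln q + pressure \<gamma> \<eta> t"
    by (intro LIMSEQ_le[OF pressure_average[OF standing t' \<eta> x]]) auto
  moreover have "(t' - t) * ln q < 0" using t q by (simp add: mult_pos_neg)
  ultimately show ?thesis by linarith
qed

lemma nn_integral_row_le:
  assumes "theta \<gamma> < t" "1 \<le> i"
  shows "(\<integral>\<^sup>+j. ennreal (\<gamma> i j powr t) \<partial>count_space {1..}) \<le> ennreal (row_sum \<gamma> t i)"
proof -
  have bij: "bij_betw Suc UNIV {1..}"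
    by (auto simp: bij_betw_def image_def) (metis Suc_le_D)
  have "(\<integral>\<^sup>+j. ennreal (\<gamma> i j powr t) \<partial>count_space {1..}) = (\<integral>\<^sup>+n. ennreal (\<gamma> i (Suc n) powr t) \<partial>count_space UNIV)"
    by (rule nn_integral_bij_count_space[OF bij, symmetric])
  also have "\<dots> = (\<Sum>n. ennreal (\<gamma> i (Suc n) powr t))"
    by (rule nn_integral_count_space_nat)
  also have "\<dots> \<le> ennreal (row_sum \<gamma> t i)"
  proof (rule suminf_le_const)
    fix n
    have "(\<Sum>k<n. \<gamma> i (Suc k) powr t) = (\<Sum>j\<in>Suc ` {..<n}. \<gamma> i j powr t)"
      by (simp add: sum.reindex)
    also have "\<dots> \<le> row_sum \<gamma> t i" by (rule row_sum_ge[OF assms]) auto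
    finally show "(\<Sum>k<n. ennreal (\<gamma> i (Suc k) powr t)) \<le> ennreal (row_sum \<gamma> t i)"
      by (simp add: sum_ennreal ennreal_leI)
  qed auto
  finally show ?thesis .
qed

end

locale moran_over_digits = contraction_rows \<gamma> q for \<gamma> q +
  fixes J :: "'a::euclidean_space set" and K :: "nat list \<Rightarrow> 'a set" and \<eta> x
  assumes standing: "\<forall>\<eta>. stochastic_vec \<eta> \<and> finite_entropy \<eta> \<longrightarrow> pressure_assumption \<gamma> \<eta>"
    and J: "compact J" "J \<noteq> {}" "J = closure (interior J)" "diameter J = 1"
    and \<eta>: "stochastic_vec \<eta>" and x: "x \<in> freq_set \<eta>"
    and coll: "moran_collection J (\<lambda>k j. \<gamma> (cf_digit k x) j) K"
begin

lemma digit_ge1: "1 \<le> cf_digit i x"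
  using x cf_digit_ge1 by (auto simp: freq_set_def)

sublocale moran_fractal J "\<lambda>k j. \<gamma> (cf_digit k x) j" K q
  using coll J q le_q digit_ge1 by unfold_locales auto

lemma prod_row_sum:
  assumes t: "theta \<gamma> < t"
  shows "(\<Prod>i\<in>{1..n}. row_sum \<gamma> t (cf_digit i x)) = exp (\<Sum>i=1..n. ln (row_sum \<gamma> t (cf_digit i x)))"
  using row_sum_pos[OF t digit_ge1] by (simp add: exp_sum)

lemma dim_le_of_neg_pressure:
  assumes t: "theta \<gamma> < t" and P: "pressure \<gamma> \<eta> t < 0"
  shows "hausdorff_dim (moran_set K) \<le> ennreal t"
proof (rule dim_le)
  show "0 < t" using t theta_nonneg by linarith
  fix \<epsilon> :: real and k0 :: nat assume \<epsilon>: "0 < \<epsilon>"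
  let ?S = "\<lambda>n. \<Sum>i=1..n. ln (row_sum \<gamma> t (cf_digit i x))"
  let ?P = "pressure \<gamma> \<eta> t"
  have "\<forall>\<^sub>F n in sequentially. ?S n / real n < ?P / 2"
    by (rule order_tendstoD(2)[OF pressure_average[OF standing t \<eta> x]]) (use P in simp)
  moreover have "\<forall>\<^sub>F n in sequentially. 2 * \<bar>ln \<epsilon>\<bar> / - ?P < real n"
    using filterlim_real_sequentially unfolding filterlim_at_top_dense by blast
  ultimately have "\<forall>\<^sub>F n in sequentially. k0 \<le> n \<and> 1 \<le> n \<and> ?S n / real n < ?P / 2 \<and> 2 * \<bar>ln \<epsilon>\<bar> / - ?P < real n"
    using eventually_ge_at_top[of k0] eventually_ge_at_top[of 1] by eventually_elim auto
  then obtain n where n: "k0 \<le> n" "1 \<le> n" "?S n / real n < ?P / 2" "2 * \<bar>ln \<epsilon>\<bar> / - ?P < real n"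
    by (auto simp: eventually_sequentially)
  have "?S n < ?P / 2 * real n" using n by (simp add: pos_divide_less_eq)
  moreover have "2 * \<bar>ln \<epsilon>\<bar> < real n * - ?P" using n(4) P by (subst (asm) pos_divide_less_eq) auto
  ultimately have "?S n < ln \<epsilon>" by (simp add: algebra_simps)
  then have "exp (?S n) \<le> \<epsilon>" using \<epsilon> by (metis exp_le_cancel_iff exp_ln less_imp_le)
  have "(\<Prod>i\<in>{1..n}. \<integral>\<^sup>+j. ennreal (\<gamma> (cf_digit i x) j powr t) \<partial>count_space {1..})
      \<le> (\<Prod>i\<in>{1..n}. ennreal (row_sum \<gamma> t (cf_digit i x)))"
    by (rule prod_mono_ennreal) (rule nn_integral_row_le[OF t digit_ge1])
  also have "\<dots> = ennreal (\<Prod>i\<in>{1..n}. row_sum \<gamma> t (cf_digit i x))"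
    using row_sum_pos[OF t digit_ge1] by (intro prod_ennreal) (auto simp: less_imp_le)
  also have "\<dots> \<le> ennreal \<epsilon>" unfolding prod_row_sum[OF t] using \<open>exp (?S n) \<le> \<epsilon>\<close> by (rule ennreal_leI)
  finally show "\<exists>k\<ge>k0. (\<Prod>i\<in>{1..k}. \<integral>\<^sup>+j. ennreal (\<gamma> (cf_digit i x) j powr t) \<partial>count_space {1..}) \<le> ennreal \<epsilon>"
    using n(1) by blast
qed

text \<open>Keeping only the entries \<open>\<ge> \<delta>\<close> lowers the mean logarithm by at most half of the pressure, so
  the products of the truncated row sums still stay away from \<open>0\<close>.\<close>
lemma dim_ge_of_pos_pressure:
  assumes t: "theta \<gamma> < t" and P: "0 < pressure \<gamma> \<eta> t"
  shows "ennreal t \<le> hausdorff_dim (moran_set K)"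
proof -
  let ?P = "pressure \<gamma> \<eta> t"
  obtain \<delta> where \<delta>: "0 < \<delta>" 
    "\<And>i. 1 \<le> i \<Longrightarrow> exp (- (?P / 2)) * row_sum \<gamma> t i \<le> (\<Sum>j\<in>large_entries \<gamma> \<delta> i. \<gamma> i j powr t)"
    using large_entries_ratio[OF standing t, of "?P / 2"] P by auto
  define A where "A k = large_entries \<gamma> \<delta> (cf_digit k x)" for k
  let ?W = "\<lambda>k. \<Sum>j\<in>A k. \<gamma> (cf_digit k x) j powr t"
  let ?S = "\<lambda>n. \<Sum>i=1..n. ln (row_sum \<gamma> t (cf_digit i x))"
  have W: "exp (- (?P / 2)) * row_sum \<gamma> t (cf_digit k x) \<le> ?W k" for k
    using \<delta>(2)[OF digit_ge1] by (simp add: A_def)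
  have Wpos: "0 < ?W k" for k
    by (rule less_le_trans[OF _ W]) (simp add: row_sum_pos[OF t digit_ge1])
  have "\<forall>\<^sub>F n in sequentially. ?P / 2 < ?S n / real n"
    by (rule order_tendstoD(1)[OF pressure_average[OF standing t \<eta> x]]) (use P in simp)
  then obtain n0 where n0: "\<And>n. n0 \<le> n \<Longrightarrow> ?P / 2 < ?S n / real n" by (auto simp: eventually_sequentially)
  have big: "1 \<le> (\<Prod>i\<in>{1..n}. ?W i)" if n: "n0 \<le> n" "1 \<le> n" for n
  proof -
    have "real n * (?P / 2) \<le> ?S n" using n0[OF n(1)] n(2) by (simp add: pos_less_divide_eq mult.commute less_imp_le)
    then have "1 \<le> exp (?S n - real n * (?P / 2))" by simp
    also have "\<dots> = exp (- (?P / 2)) ^ n * (\<Prod>i\<in>{1..n}. row_sum \<gamma> t (cf_digit i x))"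
      unfolding prod_row_sum[OF t] exp_of_nat_mult[symmetric] exp_add[symmetric] by simp
    also have "\<dots> = (\<Prod>i\<in>{1..n}. exp (- (?P / 2)) * row_sum \<gamma> t (cf_digit i x))"
      by (simp add: prod.distrib)
    also have "\<dots> \<le> (\<Prod>i\<in>{1..n}. ?W i)"
      using W row_sum_pos[OF t digit_ge1] by (intro prod_mono) (auto simp: less_imp_le)
    finally show ?thesis .
  qed
  define b where "b = Min (insert 1 ((\<lambda>n. \<Prod>i\<in>{1..n}. ?W i) ` {..n0}))"
  have b0: "0 < b" unfolding b_def using Wpos by (subst Min_gr_iff) (auto intro!: prod_pos)
  have b: "b \<le> (\<Prod>i\<in>{1..n}. ?W i)" for n
  proof (cases "n \<le> n0")
    case True
    then show ?thesis unfolding b_def by (intro Min_le) auto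
  next
    case False
    have "b \<le> 1" unfolding b_def by (intro Min_le) auto
    then show ?thesis using big[of n] False by simp
  qed
  have A: "finite (A k)" "A k \<noteq> {}" "A k \<subseteq> {1..}" for k
    using Wpos[of k] finite_large_entries[OF \<delta>(1) digit_ge1] by (auto simp: A_def) (auto simp: large_entries_def)
  show ?thesis
    by (rule dim_ge[where A = A and \<delta> = \<delta> and b = b])
       (use A \<delta>(1) b0 b t theta_nonneg in \<open>auto simp: A_def large_entries_def\<close>)
qed

end

section \<open>Constancy of the dimension and its range over intervals\<close>

lemma freq_set_subset_Q_G: "stochastic_vec \<eta> \<Longrightarrow> finite_entropy \<eta> \<Longrightarrow> freq_set \<eta> \<subseteq> Q_G"
  by (auto simp: Q_G_def)

lemma Q_G_irrational: "x \<in> Q_G \<Longrightarrow> x \<in> {0..<1} \<and> x \<notin> \<rat>"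
  by (auto simp: Q_G_def freq_set_def)

text \<open>\<open>F(\<eta>)\<close> is dense in the irrationals of \<open>[0,1)\<close>, and these meet every open subset.\<close>
lemma freq_set_meets_interval:
  assumes \<eta>: "stochastic_vec \<eta>" and U: "interior U \<noteq> {}" "U \<subseteq> {0..<1::real}"
  shows "freq_set \<eta> \<inter> U \<noteq> {}"
proof -
  obtain u e where u: "0 < e" "ball u e \<subseteq> U"
    using U(1) interior_subset by (metis all_not_in_conv mem_interior)
  have "\<not> ball u e \<subseteq> \<rat>"
    using uncountable_ball[OF u(1)] countable_rat countable_subset by blast
  then obtain v where v: "v \<notin> \<rat>" and vU: "v \<in> ball u e" by blast
  have "v \<in> {0..<1}" using vU u(2) U(2) by blast
  then have "v \<in> closure (freq_set \<eta>)" by (rule freq_set_dense[OF \<eta> _ v])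
  then have "freq_set \<eta> \<inter> ball u e \<noteq> {}"
    using vU open_Int_closure_eq_empty[of "ball u e" "freq_set \<eta>"] by auto
  then show ?thesis using u(2) by blast
qed

theorem theorem4p11:
  fixes \<gamma> :: "nat \<Rightarrow> nat \<Rightarrow> real"
    and J :: "'a::euclidean_space set"
    and K :: "real \<Rightarrow> nat list \<Rightarrow> 'a set"
  assumes gamma_pos: "\<forall>i\<ge>1. \<forall>j\<ge>1. \<gamma> i j > 0"
    and row_sums: "(SUP i\<in>{1..}. \<Sum>\<^sub>\<infinity>j\<in>{1..}. ennreal (\<gamma> i j)) < \<infinity>"
    and gamma_sup: "(SUP i\<in>{1..}. SUP j\<in>{1..}. ennreal (\<gamma> i j)) < 1"
    and standing: "\<forall>\<eta>. stochastic_vec \<eta> \<and> finite_entropy \<eta> \<longrightarrow> pressure_assumption \<gamma> \<eta>"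
    and J: "compact J" "J \<noteq> {}" "J = closure (interior J)" "diameter J = 1"
    and coll: "\<forall>x\<in>Q_G. moran_collection J (\<lambda>k j. \<gamma> (cf_digit k x) j) (K x)"
  shows "(\<forall>\<eta>. stochastic_vec \<eta> \<and> finite_entropy \<eta> \<longrightarrow>
            freq_set \<eta> \<subseteq> Q_G \<and> Q_G \<subseteq> closure (freq_set \<eta>) \<and>
            hausdorff_dim (freq_set \<eta>) > 0 \<and>
            H_G K constant_on freq_set \<eta>)
       \<and> (\<forall>x\<in>Q_G. \<forall>U. is_interval U \<and> interior U \<noteq> {} \<and> U \<subseteq> {0..<1} \<and> x \<in> U \<longrightarrow>
            H_G K ` Q_G = H_G K ` (U \<inter> Q_G))"
proof -
  let ?q0 = "SUP i\<in>{1..}. SUP j\<in>{1..}. ennreal (\<gamma> i j)"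
  have entry: "ennreal (\<gamma> i j) \<le> ?q0" if "1 \<le> i" "1 \<le> j" for i j
    using that by (intro SUP_upper2[of i] SUP_upper) auto
  have rows: "contraction_rows \<gamma> (enn2real ?q0)"
  proof
    show "0 < \<gamma> i j" if "1 \<le> i" "1 \<le> j" for i j using gamma_pos that by blast
    show le: "\<gamma> i j \<le> enn2real ?q0" if "1 \<le> i" "1 \<le> j" for i j
    proof -
      have "enn2real (ennreal (\<gamma> i j)) \<le> enn2real ?q0"
        using order_less_trans[OF gamma_sup ennreal_one_less_top] by (rule enn2real_mono[OF entry[OF that]])
      then show ?thesis using gamma_pos that by (simp add: less_imp_le)
    qed
    have "0 < \<gamma> 1 1" using gamma_pos by blast
    then show "0 < enn2real ?q0" using le[of 1 1] by simp
    have "ennreal (enn2real ?q0) = ?q0"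
      using order_less_trans[OF gamma_sup ennreal_one_less_top] by (rule ennreal_enn2real)
    then have "ennreal (enn2real ?q0) < ennreal 1" using gamma_sup by simp
    then show "enn2real ?q0 < 1" by (subst (asm) ennreal_less_iff) auto
  qed (rule row_sums)
  then interpret contraction_rows \<gamma> "enn2real ?q0" .
  have const: "H_G K x = H_G K y"
    if \<eta>: "stochastic_vec \<eta>" "finite_entropy \<eta>" and xy: "x \<in> freq_set \<eta>" "y \<in> freq_set \<eta>" for \<eta> x y
  proof -
    have fractal: "moran_over_digits \<gamma> (enn2real ?q0) J (K x) \<eta> x" if "x \<in> freq_set \<eta>" for x
      using coll freq_set_subset_Q_G[OF \<eta>] that standing J \<eta>(1) by unfold_locales auto
    obtain u where u: "theta \<gamma> < u" "0 < pressure \<gamma> \<eta> u"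
      using standing \<eta> by (auto simp: pressure_assumption_def)
    \<comment> \<open>Two exponents are needed strictly between different dimensions: the pressure is at most \<open>0\<close>
      at the smaller one, and therefore negative at the larger one.\<close>
    have "H_G K y \<le> H_G K x" if xy: "x \<in> freq_set \<eta>" "y \<in> freq_set \<eta>" for x y
    proof (rule ccontr)
      assume "\<not> H_G K y \<le> H_G K x"
      interpret X: moran_over_digits \<gamma> "enn2real ?q0" J "K x" \<eta> x by (rule fractal[OF xy(1)])
      interpret Y: moran_over_digits \<gamma> "enn2real ?q0" J "K y" \<eta> y by (rule fractal[OF xy(2)])
      have "H_G K x < H_G K y" using \<open>\<not> H_G K y \<le> H_G K x\<close> by simp
      then obtain a where a: "H_G K x < a" "a < H_G K y" using dense by blast
      then obtain b where b: "a < b" "b < H_G K y" using dense by blast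
      have fin: "a \<noteq> top" "b \<noteq> top" using a b by auto
      define t t' where "t = enn2real a" and "t' = enn2real b"
      have t: "ennreal t = a" "ennreal t' = b" using fin by (auto simp: t_def t'_def less_top)
      have nn: "0 \<le> t" "0 \<le> t'" by (auto simp: t_def t'_def)
      have tt: "t < t'" using b(1) nn by (simp add: t[symmetric] ennreal_less_iff)
      have "ennreal u < ennreal t"
        using X.dim_ge_of_pos_pressure[OF u] a(1) by (simp add: H_G_def t)
      then have ut: "theta \<gamma> < t" using u(1) nn by (metis ennreal_leI less_le_not_le linorder_not_less order_less_le_trans)
      have "\<not> 0 < pressure \<gamma> \<eta> t"
      proof
        assume "0 < pressure \<gamma> \<eta> t"
        from X.dim_ge_of_pos_pressure[OF ut this] show False using a(1) by (simp add: H_G_def t)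
      qed
      then have "pressure \<gamma> \<eta> t' < 0"
        using pressure_decreasing[OF standing ut tt \<eta>(1) xy(1)] by simp
      then have "H_G K y \<le> b"
        using Y.dim_le_of_neg_pressure[of t'] ut tt by (simp add: H_G_def t)
      then show False using b(2) by simp
    qed
    then show ?thesis using xy by (intro antisym) auto
  qed
  show ?thesis
  proof (intro conjI allI impI ballI)
    fix \<eta> assume "stochastic_vec \<eta> \<and> finite_entropy \<eta>"
    then have \<eta>: "stochastic_vec \<eta>" "finite_entropy \<eta>" by auto
    show "freq_set \<eta> \<subseteq> Q_G" by (rule freq_set_subset_Q_G[OF \<eta>])
    show "Q_G \<subseteq> closure (freq_set \<eta>)" using Q_G_irrational freq_set_dense[OF \<eta>(1)] by blast
    show "0 < hausdorff_dim (freq_set \<eta>)" by (rule freq_set_dim_pos[OF \<eta>(1)])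
    show "H_G K constant_on freq_set \<eta>" unfolding constant_on_def using const[OF \<eta>] by metis
  next
    fix x U assume "x \<in> Q_G" and "is_interval U \<and> interior U \<noteq> {} \<and> U \<subseteq> {0..<1} \<and> x \<in> U"
    then have U: "interior U \<noteq> {}" "U \<subseteq> {0..<1}" by auto
    have "H_G K y \<in> H_G K ` (U \<inter> Q_G)" if y: "y \<in> Q_G" for y
    proof -
      obtain \<eta> where \<eta>: "stochastic_vec \<eta>" "finite_entropy \<eta>" "y \<in> freq_set \<eta>"
        using y by (auto simp: Q_G_def)
      obtain z where z: "z \<in> freq_set \<eta>" "z \<in> U" using freq_set_meets_interval[OF \<eta>(1) U] by blast
      then have "H_G K y = H_G K z" "z \<in> Q_G" using const[OF \<eta>(1,2) \<eta>(3)] freq_set_subset_Q_G[OF \<eta>(1,2)] by auto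
      then show ?thesis using z(2) by blast
    qed
    then show "H_G K ` Q_G = H_G K ` (U \<inter> Q_G)" by blast
  qed
qed

end
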